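(* The ring homomorphisms $\Theta_i:\Pi\to\Pi$, $i\in I$, generate an action of the Weyl group $W$ on $\Pi$; that is, there is an action of $W$ on the ring $\Pi$ by ring automorphisms in which the simple reflection $s_i$ acts as $\Theta_i$ for every $i\in I$.
   Context: Lie algebra data. Let $\mathfrak g$ be a finite-dimensional simple Lie algebra over $\mathbb C$ of rank $n$, $I=\{1,\dots,n\}$, with Cartan matrix $C=(C_{i,j})_{i,j\in I}$ (conventions of Kac), simple roots $\alpha_i$, fundamental weights $\omega_i$ (so $\alpha_i=\sum_{j\in I}C_{j,i}\,\omega_j$), weight lattice $P=\bigoplus_i\mathbb Z\omega_i$, $Q^+=\bigoplus_i\mathbb Z_{\ge0}\alpha_i$, set of roots $\Delta=\Delta_+\sqcup\Delta_-$, and Weyl group $W$ generated by the simple reflections $s_i$, $i\in I$. Let $D=\mathrm{diag}(d_1,\dots,d_n)$ with $d_i$ relatively prime positive integers such that $DC$ is symmetric. Fix $q\in\mathbb C^\times$ not a root of unity and set $q_i=q^{d_i}$. Laurent polynomials. $\mathcal Y=\mathbb Z[Y_{i,a}^{\pm1}]_{i\in I,a\in\mathbb C^\times}$, and $\mathcal M$ is its multiplicative group of (Laurent) monomials. The weight of $m=\prod Y_{i,a}^{u_{i,a}(m)}\in\mathcal M$ is $\omega(m)=\sum_{i,a}u_{i,a}(m)\omega_i\in P$. Put $$A_{i,a}=Y_{i,aq_i^{-1}}Y_{i,aq_i}\Big(\prod_{j:\,C_{j,i}=-1}Y_{j,a}\prod_{j:\,C_{j,i}=-2}Y_{j,aq^{-1}}Y_{j,aq}\prod_{j:\,C_{j,i}=-3}Y_{j,aq^{-2}}Y_{j,a}Y_{j,aq^2}\Big)^{-1},$$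 which has weight $\alpha_i$. Completions. For $w\in W$, $\widetilde{\mathcal Y}^w$ is the ring of formal series $\sum_{m\in S}a_m m$, $a_m\in\mathbb Z$, $S\subset\mathcal M$, such that (i) there are finitely many integral weights $\lambda_1,\dots,\lambda_N$ with $w(\omega(m))\in\bigcup_{j=1}^N(\lambda_j-Q^+)$ for all $m\in S$, and (ii) for every $\omega\in P$ the set $\{m\in S:\omega(m)=\omega,\ a_m\ne0\}$ is finite. It contains $\mathcal Y$. Set $\Pi=\bigoplus_{w\in W}\widetilde{\mathcal Y}^w$ (a ring with componentwise operations). The elements $\Sigma$. For $i\in I$, $a\in\mathbb C^\times$ let $$\Sigma_{i,a}^+=\sum_{k\ge0}\ \prod_{0<j\le k}A_{i,aq_i^{-2j+2}}^{-1},\qquad \Sigma_{i,a}^-=-\sum_{k>0}\ \prod_{0<j\le k}A_{i,aq_i^{2j}}$$ (the $k=0$ term is $1$). For $w\in W$, $\Sigma_{i,a}^w\in\widetilde{\mathcal Y}^w$ is $\Sigma^+_{i,a}$ if $w(\alpha_i)\in\Delta_+$ and $\Sigma^-_{i,a}$ if $w(\alpha_i)\in\Delta_-$; it is invertible in $\widetilde{\mathcal Y}^w$. The operators $\Theta_i$. For $i\in I$, $w\in W$, the ring homomorphism $\Theta_i^w:\mathcal Y\to\widetilde{\mathcal Y}^{ws_i}$ is defined by $\Theta_i^w(Y_{j,a}^{\pm1})=Y_{j,a}^{\pm1}$ for $j\ne i$ and $$\Theta_i^w(Y_{i,a})=Y_{i,a}A_{i,aq_i^{-1}}^{-1}\,\frac{\Sigma^{ws_i}_{i,aq_i^{-3}}}{\Sigma^{ws_i}_{i,aq_i^{-1}}}.$$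 Here the source $\mathcal Y$ is regarded as a subring of $\widetilde{\mathcal Y}^w$, and $\Theta_i^w$ is extended by continuity (i.e. termwise on formal series, which is well-defined) to a ring homomorphism $\widetilde{\mathcal Y}^w\to\widetilde{\mathcal Y}^{ws_i}$. The direct sum over $w\in W$ of these maps is the ring homomorphism $\Theta_i:\Pi\to\Pi$, so the $ws_i$-component of $\Theta_i(f)$ is $\Theta_i^w(f_w)$ for $f=(f_w)_{w\in W}$. *)

theory Defs
  imports
    "HOL-Analysis.Cartesian_Space"
    "HOL-Library.Poly_Mapping"
    "HOL-Algebra.Elementary_Groups"
    "HOL-Algebra.Group_Action"
    "HOL-Algebra.QuotRing"
begin

text \<open>
  A finite-dimensional simple complex Lie algebra enters through its Cartan matrix: by the
  Cartan--Killing classification and Serre's theorem (in Kac's terms: indecomposable and of finite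
  type), the Cartan matrices of these Lie algebras are exactly the matrices below.
  The index set \<open>I\<close> is a finite type, so the rank is its cardinality.
\<close>

definition simple_cartan_matrix :: "int^'i^'i::finite \<Rightarrow> bool" where
  "simple_cartan_matrix C \<longleftrightarrow>
     (\<forall>i. C $ i $ i = 2) \<and>
     (\<forall>i j. i \<noteq> j \<longrightarrow> C $ i $ j \<le> 0) \<and>
     (\<forall>i j. C $ i $ j = 0 \<longrightarrow> C $ j $ i = 0) \<and>
     (\<forall>J. J \<noteq> {} \<and> J \<noteq> UNIV \<longrightarrow> (\<exists>i\<in>J. \<exists>j\<in>-J. C $ i $ j \<noteq> 0)) \<and>
     (\<exists>D :: 'i \<Rightarrow> real. (\<forall>i. D i > 0) \<and>
        (\<forall>i j. D i * of_int (C $ i $ j) = D j * of_int (C $ j $ i)) \<and>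
        (\<forall>x :: real^'i. x \<noteq> 0 \<longrightarrow> (\<Sum>i\<in>UNIV. \<Sum>j\<in>UNIV. D i * of_int (C $ i $ j) * x $ i * x $ j) > 0))"

text \<open>``Relatively prime'' refers to the whole family, not to pairs (in type \<open>B\<^sub>n\<close> the
  value 2 is repeated).\<close>

definition symmetrizer :: "int^'i^'i::finite \<Rightarrow> ('i \<Rightarrow> nat) \<Rightarrow> bool" where
  "symmetrizer C d \<longleftrightarrow>
     (\<forall>i. d i > 0) \<and> Gcd (range d) = 1 \<and>
     (\<forall>i j. int (d i) * C $ i $ j = int (d j) * C $ j $ i)"


section \<open>Weights, Weyl group and roots\<close>

text \<open>The weight lattice \<open>P\<close> is \<open>int^'i\<close>, in coordinates with respect to the fundamental weights.\<close>

definition fund_weight :: "'i::finite \<Rightarrow> int^'i" where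
  "fund_weight i = axis i 1"

definition simple_root :: "int^'i^'i::finite \<Rightarrow> 'i \<Rightarrow> int^'i" where
  "simple_root C i = (\<Sum>j\<in>UNIV. (C $ j $ i) *s fund_weight j)"

definition Q_plus :: "int^'i^'i::finite \<Rightarrow> (int^'i) set" where
  "Q_plus C = range (\<lambda>k :: 'i \<Rightarrow> nat. \<Sum>i\<in>UNIV. int (k i) *s simple_root C i)"

text \<open>The coordinate \<open>x $ i\<close> is the pairing of \<open>x\<close> with the \<open>i\<close>-th simple coroot.\<close>

definition simple_reflection :: "int^'i^'i::finite \<Rightarrow> 'i \<Rightarrow> int^'i \<Rightarrow> int^'i" where
  "simple_reflection C i x = x - (x $ i) *s simple_root C i"

definition weyl_group :: "int^'i^'i::finite \<Rightarrow> (int^'i \<Rightarrow> int^'i) monoid" where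
  "weyl_group C = subgroup_generated (BijGroup UNIV) (range (simple_reflection C))"

text \<open>In finite type every root is conjugate to a simple root.\<close>

definition roots :: "int^'i^'i::finite \<Rightarrow> (int^'i) set" where
  "roots C = {w (simple_root C i) | w i. w \<in> carrier (weyl_group C)}"

definition pos_roots :: "int^'i^'i::finite \<Rightarrow> (int^'i) set" where
  "pos_roots C = roots C \<inter> Q_plus C"


section \<open>Monomials\<close>

text \<open>The monomial with exponents \<open>u\<close> is the finitely supported map \<open>(i, a) \<mapsto> u\<close>, so
  the group of monomials is written additively. The spectral parameters \<open>a\<close> are nonzero; this is
  imposed by \<open>monomials\<close>, not by the type.\<close>

type_synonym 'i monomial = "('i \<times> complex) \<Rightarrow>\<^sub>0 int"

definition monomials :: "'i monomial set" where
  "monomials = {m. \<forall>(i, a) \<in> Poly_Mapping.keys m. a \<noteq> 0}"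

definition Yvar :: "'i \<Rightarrow> complex \<Rightarrow> 'i monomial" where
  "Yvar i a = Poly_Mapping.single (i, a) 1"

definition weight :: "'i::finite monomial \<Rightarrow> int^'i" where
  "weight m = (\<Sum>(i, a)\<in>Poly_Mapping.keys m. Poly_Mapping.lookup m (i, a) *s fund_weight i)"

definition Avar :: "int^'i^'i::finite \<Rightarrow> ('i \<Rightarrow> nat) \<Rightarrow> complex \<Rightarrow> 'i \<Rightarrow> complex \<Rightarrow> 'i monomial" where
  "Avar C d q i a =
     Yvar i (a * (q ^ d i) powi (-1)) + Yvar i (a * q ^ d i)
     - ((\<Sum>j | C $ j $ i = -1. Yvar j a)
      + (\<Sum>j | C $ j $ i = -2. Yvar j (a * q powi (-1)) + Yvar j (a * q))
      + (\<Sum>j | C $ j $ i = -3. Yvar j (a * q powi (-2)) + Yvar j a + Yvar j (a * q ^ 2)))"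


section \<open>Formal series and completions\<close>

type_synonym 'i series = "'i monomial \<Rightarrow> int"

definition mono_series :: "'i monomial \<Rightarrow> 'i series" where
  "mono_series m = (\<lambda>n. if n = m then 1 else 0)"

text \<open>Coefficientwise sum of a family of series; meaningful when each coefficient is nonzero for
  only finitely many members of the family.\<close>

definition formal_sum :: "'k set \<Rightarrow> ('k \<Rightarrow> 'i series) \<Rightarrow> 'i series" where
  "formal_sum K F = (\<lambda>n. \<Sum>k | k \<in> K \<and> F k n \<noteq> 0. F k n)"

definition completion_carrier ::
    "int^'i^'i::finite \<Rightarrow> (int^'i \<Rightarrow> int^'i) \<Rightarrow> 'i series set" where
  "completion_carrier C w =
     {f. {m. f m \<noteq> 0} \<subseteq> monomials \<and>
         (\<exists>\<Lambda>. finite \<Lambda> \<and> (\<forall>m. f m \<noteq> 0 \<longrightarrow> (\<exists>\<nu>\<in>\<Lambda>. \<exists>\<beta>\<in>Q_plus C. w (weight m) = \<nu> - \<beta>))) \<and>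
         (\<forall>\<mu>. finite {m. f m \<noteq> 0 \<and> weight m = \<mu>})}"

definition completion :: "int^'i^'i::finite \<Rightarrow> (int^'i \<Rightarrow> int^'i) \<Rightarrow> 'i series ring" where
  "completion C w =
     \<lparr>carrier = completion_carrier C w,
      monoid.mult = (\<lambda>f g. formal_sum UNIV (\<lambda>(k, l) n. f k * g l * mono_series (k + l) n)),
      one = mono_series 0,
      zero = (\<lambda>n. 0),
      add = (\<lambda>f g n. f n + g n)\<rparr>"

text \<open>As \<open>W\<close> is finite, the direct sum over \<open>W\<close> is the product.\<close>

definition Pi_ring ::
    "int^'i^'i::finite \<Rightarrow> ((int^'i \<Rightarrow> int^'i) \<Rightarrow> 'i series) ring" where
  "Pi_ring C =
     \<lparr>carrier = (\<Pi>\<^sub>E w\<in>carrier (weyl_group C). carrier (completion C w)),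
      monoid.mult = (\<lambda>f g. \<lambda>w\<in>carrier (weyl_group C). f w \<otimes>\<^bsub>completion C w\<^esub> g w),
      one = (\<lambda>w\<in>carrier (weyl_group C). \<one>\<^bsub>completion C w\<^esub>),
      zero = (\<lambda>w\<in>carrier (weyl_group C). \<zero>\<^bsub>completion C w\<^esub>),
      add = (\<lambda>f g. \<lambda>w\<in>carrier (weyl_group C). f w \<oplus>\<^bsub>completion C w\<^esub> g w)\<rparr>"


section \<open>The operators\<close>

definition Sigma_plus ::
    "int^'i^'i::finite \<Rightarrow> ('i \<Rightarrow> nat) \<Rightarrow> complex \<Rightarrow> 'i \<Rightarrow> complex \<Rightarrow> 'i series" where
  "Sigma_plus C d q i a =
     formal_sum UNIV (\<lambda>k::nat.
       mono_series (\<Sum>j\<in>{0<..k}. - Avar C d q i (a * (q ^ d i) powi (- 2 * int j + 2))))"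

definition Sigma_minus ::
    "int^'i^'i::finite \<Rightarrow> ('i \<Rightarrow> nat) \<Rightarrow> complex \<Rightarrow> 'i \<Rightarrow> complex \<Rightarrow> 'i series" where
  "Sigma_minus C d q i a =
     (\<lambda>n. - formal_sum {0<..} (\<lambda>k::nat.
       mono_series (\<Sum>j\<in>{0<..k}. Avar C d q i (a * (q ^ d i) powi (2 * int j)))) n)"

text \<open>For \<open>w \<in> W\<close> the root \<open>w \<alpha>\<^sub>i\<close> is negative if it is not positive.\<close>

definition Sigma_w ::
    "int^'i^'i::finite \<Rightarrow> ('i \<Rightarrow> nat) \<Rightarrow> complex \<Rightarrow> (int^'i \<Rightarrow> int^'i) \<Rightarrow> 'i \<Rightarrow> complex \<Rightarrow> 'i series" where
  "Sigma_w C d q w i a =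
     (if w (simple_root C i) \<in> pos_roots C then Sigma_plus C d q i a else Sigma_minus C d q i a)"

definition Theta_gen ::
    "int^'i^'i::finite \<Rightarrow> ('i \<Rightarrow> nat) \<Rightarrow> complex \<Rightarrow> 'i \<Rightarrow> (int^'i \<Rightarrow> int^'i) \<Rightarrow> 'i \<Rightarrow> complex \<Rightarrow> 'i series" where
  "Theta_gen C d q i w j a =
     (let v = w \<circ> simple_reflection C i; R = completion C v in
      if j \<noteq> i then mono_series (Yvar j a)
      else mono_series (Yvar i a - Avar C d q i (a * (q ^ d i) powi (-1)))
           \<otimes>\<^bsub>R\<^esub> (Sigma_w C d q v i (a * (q ^ d i) powi (-3))
                \<otimes>\<^bsub>R\<^esub> inv\<^bsub>R\<^esub> (Sigma_w C d q v i (a * (q ^ d i) powi (-1)))))"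

text \<open>The exponent below is an integer, so negative powers are powers of the inverse in the
  target completion.\<close>

definition Theta_mono ::
    "int^'i^'i::finite \<Rightarrow> ('i \<Rightarrow> nat) \<Rightarrow> complex \<Rightarrow> 'i \<Rightarrow> (int^'i \<Rightarrow> int^'i) \<Rightarrow> 'i monomial \<Rightarrow> 'i series" where
  "Theta_mono C d q i w m =
     (let R = completion C (w \<circ> simple_reflection C i) in
      \<Otimes>\<^bsub>R\<^esub>p\<in>Poly_Mapping.keys m. Theta_gen C d q i w (fst p) (snd p) [^]\<^bsub>R\<^esub> Poly_Mapping.lookup m p)"

definition Theta_w ::
    "int^'i^'i::finite \<Rightarrow> ('i \<Rightarrow> nat) \<Rightarrow> complex \<Rightarrow> 'i \<Rightarrow> (int^'i \<Rightarrow> int^'i) \<Rightarrow> 'i series \<Rightarrow> 'i series" where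
  "Theta_w C d q i w f = formal_sum UNIV (\<lambda>m n. f m * Theta_mono C d q i w m n)"

text \<open>Since \<open>s\<^sub>i\<close> is an involution, the component at \<open>v = w s\<^sub>i\<close> comes from \<open>w = v s\<^sub>i\<close>.\<close>

definition Theta ::
    "int^'i^'i::finite \<Rightarrow> ('i \<Rightarrow> nat) \<Rightarrow> complex \<Rightarrow> 'i \<Rightarrow>
     ((int^'i \<Rightarrow> int^'i) \<Rightarrow> 'i series) \<Rightarrow> ((int^'i \<Rightarrow> int^'i) \<Rightarrow> 'i series)" where
  "Theta C d q i =
     (\<lambda>f\<in>carrier (Pi_ring C). \<lambda>v\<in>carrier (weyl_group C).
        Theta_w C d q i (v \<circ> simple_reflection C i) (f (v \<circ> simple_reflection C i)))"

end

theory Submission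
  imports Defs
begin

text \<open>
  Each operator maps a monomial to a series whose weights lie below the reflected weight, so it is a
  ring homomorphism of the completions that is compatible with their filtrations by weight. Consider
  a composite of operators over a word with trivial product in the Weyl group. If every variable is
  the leading term of a Laurent polynomial that is invariant under the operators in the word, then
  the composite fixes all variables, by induction on the filtration, and hence is the identity.
  For the word \<open>i i\<close> the invariants are \<open>Y (1 + A\<^sup>-\<^sup>1)\<close>, which gives the involutions; for words in
  two letters they are the fundamental \<open>q\<close>-characters of the quantum affine algebras of rank two,
  which gives the braid relations. The Coxeter presentation of the Weyl group, proved by the exchange
  property and Matsumoto's argument, then yields the action.
\<close>

section \<open>Roots and the Weyl group\<close>

text \<open>The operators do not act on one ring: \<open>Theta\<close> moves the component at w to
  the component at w s_i, and a monomial that leads in one completion need not lead in another.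
  Invariance is therefore required in every completion at once (\<open>Inv\<close>), while leading
  terms are taken in a single completion v. For the word \<open>i i\<close> this is harmless: either
  Y_i or its quotient by A leads, and together with the other variables each choice generates all
  monomials. For two letters the fundamental q-characters lead with a variable when v makes both
  simple roots positive, so a general v is moved to such a u by a word in i and j; undoing this move
  uses the involutions, which are thus proved before the braid relations. Invariance of a
  q-character under two nodes is reduced to rank one by writing the same polynomial twice as a sum
  of strings, once for each node. An error term is not removed in finitely many rounds: each round
  gains one unit of height for all monomials together, and a term of unbounded depth
  vanishes.\<close>

lemma even_sum_symmetric:
  fixes a :: "'a \<Rightarrow> 'a \<Rightarrow> int"
  assumes "finite S" "\<And>i j. a i j = a j i" "\<And>i. even (a i i)"
  shows "even (\<Sum>i\<in>S. \<Sum>j\<in>S. a i j)"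
  using assms(1)
proof (induction S rule: finite_induct)
  case (insert x F)
  have "(\<Sum>i\<in>insert x F. \<Sum>j\<in>insert x F. a i j)
     = a x x + (\<Sum>j\<in>F. a x j) + ((\<Sum>i\<in>F. a i x) + (\<Sum>i\<in>F. \<Sum>j\<in>F. a i j))"
    using insert.hyps by (simp add: sum.distrib)
  moreover have "(\<Sum>i\<in>F. a i x) = (\<Sum>j\<in>F. a x j)"
    by (intro sum.cong refl) (rule assms(2))
  ultimately show ?case using insert.IH assms(3)[of x] by simp
qed simp

section \<open>Cartan data, coordinates in the simple roots and the invariant form\<close>

locale cartan_datum =
  fixes C :: "int^'i^'i::finite" and d :: "'i \<Rightarrow> nat"
  assumes cartan: "simple_cartan_matrix C"
    and symmetrizer: "symmetrizer C d"
begin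

abbreviation s :: "'i \<Rightarrow> int^'i \<Rightarrow> int^'i" where "s \<equiv> simple_reflection C"
abbreviation \<alpha> :: "'i \<Rightarrow> int^'i" where "\<alpha> \<equiv> simple_root C"
abbreviation W :: "(int^'i \<Rightarrow> int^'i) set" where "W \<equiv> carrier (weyl_group C)"

lemma C_diag [simp]: "C $ i $ i = 2"
  and C_nonpos: "i \<noteq> j \<Longrightarrow> C $ i $ j \<le> 0"
  and C_zero: "C $ i $ j = 0 \<Longrightarrow> C $ j $ i = 0"
  and indecomposable: "J \<noteq> {} \<Longrightarrow> J \<noteq> UNIV \<Longrightarrow> \<exists>i\<in>J. \<exists>j\<in>-J. C $ i $ j \<noteq> 0"
  using cartan unfolding simple_cartan_matrix_def by metis+

lemma d_pos: "d i > 0" and d_gcd: "Gcd (range d) = 1"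
  and d_sym: "int (d i) * C $ i $ j = int (d j) * C $ j $ i"
  using symmetrizer unfolding symmetrizer_def by metis+

lemma simple_root_nth [simp]: "\<alpha> i $ j = C $ j $ i"
  by (simp add: simple_root_def fund_weight_def axis_def if_distrib sum.delta' cong: if_cong)

lemma s_nth: "s i x $ j = x $ j - x $ i * C $ j $ i"
  by (simp add: simple_reflection_def)

text \<open>Elements of the root lattice are handled through their coordinates \<open>k\<close> in the basis of
  simple roots, on which \<open>W\<close> acts by \<open>cs\<close>.\<close>

definition rt :: "('i \<Rightarrow> int) \<Rightarrow> int^'i" where "rt k = (\<Sum>i\<in>UNIV. k i *s \<alpha> i)"

text \<open>The invariant form on the root lattice, normalised so that \<alpha> i has norm 2
  d_i.\<close>

definition bil :: "('i \<Rightarrow> int) \<Rightarrow> ('i \<Rightarrow> int) \<Rightarrow> int" where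
  "bil k l = (\<Sum>i\<in>UNIV. \<Sum>j\<in>UNIV. int (d i) * C $ i $ j * k i * l j)"

definition unit_co :: "'i \<Rightarrow> 'i \<Rightarrow> int" where "unit_co i = (\<lambda>j. if j = i then 1 else 0)"

definition cs :: "'i \<Rightarrow> ('i \<Rightarrow> int) \<Rightarrow> ('i \<Rightarrow> int)" where
  "cs i k = (\<lambda>j. k j - rt k $ i * unit_co i j)"

lemma sum_unit_co: "(\<Sum>j\<in>UNIV. f j * unit_co i j) = f i"
proof -
  have "(\<Sum>j\<in>UNIV. f j * unit_co i j) = (\<Sum>j\<in>UNIV. if j = i then f j else 0)"
    by (intro sum.cong refl) (simp add: unit_co_def)
  then show ?thesis by simp
qed

lemma sum_unit_co_left: "(\<Sum>j\<in>UNIV. f j * unit_co i j * g j) = f i * g i"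
  using sum_unit_co[of "\<lambda>j. f j * g j" i] by (simp add: algebra_simps)

lemma rt_nth: "rt k $ j = (\<Sum>i\<in>UNIV. C $ j $ i * k i)"
  by (simp add: rt_def mult.commute)

lemma rt_unit [simp]: "rt (unit_co i) = \<alpha> i"
  by (simp add: vec_eq_iff rt_nth sum_unit_co)

lemma rt_diff: "rt (\<lambda>j. k j - l j) = rt k - rt l"
  and rt_add: "rt (\<lambda>j. k j + l j) = rt k + rt l"
  and rt_scale: "rt (\<lambda>j. c * k j) = c *s rt k"
  and rt_uminus: "rt (\<lambda>j. - k j) = - rt k"
  and rt_0: "rt (\<lambda>j. 0) = 0"
  by (simp_all add: vec_eq_iff rt_nth algebra_simps sum_subtractf sum.distrib sum_distrib_left sum_negf)

lemma rt_cs: "rt (cs i k) = s i (rt k)"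
  by (simp add: cs_def rt_diff rt_scale simple_reflection_def)

lemma Q_plus_iff: "x \<in> Q_plus C \<longleftrightarrow> (\<exists>k. (\<forall>i. k i \<ge> 0) \<and> x = rt k)"
proof
  assume "x \<in> Q_plus C"
  then obtain k :: "'i \<Rightarrow> nat" where "x = (\<Sum>i\<in>UNIV. int (k i) *s \<alpha> i)"
    unfolding Q_plus_def by auto
  then show "\<exists>k. (\<forall>i. k i \<ge> 0) \<and> x = rt k"
    unfolding rt_def by (intro exI[of _ "\<lambda>i. int (k i)"]) auto
next
  assume "\<exists>k. (\<forall>i. k i \<ge> 0) \<and> x = rt k"
  then obtain k where "\<forall>i. k i \<ge> 0" "x = rt k" by auto
  then show "x \<in> Q_plus C" unfolding Q_plus_def rt_def
    by (intro image_eqI[of _ _ "\<lambda>i. nat (k i)"]) auto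
qed

lemma Q_plus_add: "x \<in> Q_plus C \<Longrightarrow> y \<in> Q_plus C \<Longrightarrow> x + y \<in> Q_plus C"
  unfolding Q_plus_iff by (metis (no_types, lifting) add_nonneg_nonneg rt_add)

lemma Q_plus_0 [simp]: "0 \<in> Q_plus C"
  unfolding Q_plus_iff by (intro exI[of _ "\<lambda>_. 0"]) (simp add: rt_0)

lemma Q_plus_scale: "x \<in> Q_plus C \<Longrightarrow> c \<ge> 0 \<Longrightarrow> c *s x \<in> Q_plus C"
  unfolding Q_plus_iff by (metis (no_types, lifting) mult_nonneg_nonneg rt_scale)

lemma Q_plus_simple_root [simp]: "\<alpha> i \<in> Q_plus C"
proof -
  have "\<forall>j. unit_co i j \<ge> 0" by (simp add: unit_co_def)
  then show ?thesis unfolding Q_plus_iff by (metis rt_unit)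
qed


text \<open>Symmetrizers of an indecomposable matrix are unique up to a scalar: the nodes where
  \<open>D\<close> is r times \<open>d\<close> contain i0 and are closed under adjacency. This
  carries positivity from the unspecified real \<open>D\<close> of
  \<open>simple_cartan_matrix\<close> over to the integral \<open>d\<close>.\<close>

lemma form_proportional:
  assumes D: "\<And>i. D i > (0::real)" "\<And>i j. D i * of_int (C $ i $ j) = D j * of_int (C $ j $ i)"
  shows "\<exists>r>0. \<forall>i. D i = r * real (d i)"
proof -
  fix i0 :: 'i
  define r where "r = D i0 / d i0"
  define J where "J = {i. D i = r * d i}"
  have "i0 \<in> J" using d_pos[of i0] by (simp add: J_def r_def)
  moreover have "j \<in> J" if "i \<in> J" "C $ i $ j \<noteq> 0" for i j
  proof -
    have "real (d i) * of_int (C $ i $ j) = real (d j) * of_int (C $ j $ i)"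
      using arg_cong[OF d_sym[of i j], of real_of_int] by simp
    moreover have "D i * of_int (C $ i $ j) = D j * of_int (C $ j $ i)" by (rule D(2))
    ultimately have "r * real (d j) * of_int (C $ j $ i) = D j * of_int (C $ j $ i)"
      using that(1) by (simp add: J_def mult.assoc)
    moreover have "C $ j $ i \<noteq> 0" using C_zero that(2) by blast
    ultimately show ?thesis by (simp add: J_def)
  qed
  ultimately have "J = UNIV" using indecomposable[of J] by blast
  moreover have "r > 0" using D(1)[of i0] d_pos[of i0] by (simp add: r_def)
  ultimately show ?thesis unfolding J_def by blast
qed

lemma obtain_real_form:
  obtains D :: "'i \<Rightarrow> real" where "\<And>i. D i > (0::real)"
    "\<And>i j. D i * of_int (C $ i $ j) = D j * of_int (C $ j $ i)"
    "\<And>x :: real^'i. x \<noteq> 0 \<Longrightarrow> (\<Sum>i\<in>UNIV. \<Sum>j\<in>UNIV. D i * of_int (C $ i $ j) * x $ i * x $ j) > 0"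
proof -
  obtain D :: "'i \<Rightarrow> real" where D: "(\<forall>i. D i > 0) \<and>
        (\<forall>i j. D i * of_int (C $ i $ j) = D j * of_int (C $ j $ i)) \<and>
        (\<forall>x :: real^'i. x \<noteq> 0 \<longrightarrow> (\<Sum>i\<in>UNIV. \<Sum>j\<in>UNIV. D i * of_int (C $ i $ j) * x $ i * x $ j) > 0)"
    using cartan unfolding simple_cartan_matrix_def by (elim conjE exE) (rule that, (intro conjI; assumption))
  show thesis
    by (rule that[of D]) (use D in \<open>simp_all only: simp_thms\<close>)
qed

lemma bil_pos: assumes "k \<noteq> (\<lambda>_. 0)" shows "bil k k > 0"
proof -
  obtain D :: "'i \<Rightarrow> real" where D: "\<And>i. D i > (0::real)"
    "\<And>i j. D i * of_int (C $ i $ j) = D j * of_int (C $ j $ i)"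
    "\<And>x :: real^'i. x \<noteq> 0 \<Longrightarrow> (\<Sum>i\<in>UNIV. \<Sum>j\<in>UNIV. D i * of_int (C $ i $ j) * x $ i * x $ j) > 0"
    by (rule obtain_real_form) (rule that)
  obtain r where r: "r > 0" "\<And>i. D i = r * real (d i)" using form_proportional[OF D(1,2)] by blast
  define x :: "real^'i" where "x = (\<chi> i. of_int (k i))"
  have "x \<noteq> 0" using assms by (auto simp: x_def vec_eq_iff fun_eq_iff)
  from D(3)[OF this] have "0 < r * of_int (bil k k)"
    by (simp add: bil_def x_def r(2) sum_distrib_left mult.assoc)
  then show ?thesis using r(1) by (simp add: zero_less_mult_iff)
qed

lemma bil_sym: "bil k l = bil l k"
  unfolding bil_def
proof (subst sum.swap, intro sum.cong refl)
  fix i j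
  show "int (d j) * C $ j $ i * k j * l i = int (d i) * C $ i $ j * l i * k j"
    unfolding d_sym[of j i] by simp
qed

lemma bil_diff_left: "bil (\<lambda>i. k i - k' i) l = bil k l - bil k' l"
  and bil_scale_left: "bil (\<lambda>i. c * k i) l = c * bil k l"
  unfolding bil_def by (simp_all add: algebra_simps sum_subtractf sum_distrib_left)

lemma bil_diff_right: "bil l (\<lambda>i. k i - k' i) = bil l k - bil l k'"
  and bil_scale_right: "bil l (\<lambda>i. c * k i) = c * bil l k"
  by (simp_all add: bil_sym[of l] bil_diff_left bil_scale_left)

lemma bil_alt: "bil k l = (\<Sum>i\<in>UNIV. int (d i) * k i * rt l $ i)"
  unfolding bil_def rt_nth by (simp add: sum_distrib_left algebra_simps)

lemma bil_unit_left: "bil (unit_co i) l = int (d i) * rt l $ i"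
  by (simp add: bil_alt sum_unit_co_left)

text \<open>\<open>bil k l\<close> depends on \<open>l\<close> only through \<open>rt l\<close>, so
  a nonzero difference killed by \<open>rt\<close> would have norm zero.\<close>

lemma rt_inj: assumes "rt k = rt l" shows "k = l"
proof (rule ccontr)
  assume "k \<noteq> l"
  then have "(\<lambda>i. k i - l i) \<noteq> (\<lambda>_. 0)" by (auto simp: fun_eq_iff)
  from bil_pos[OF this] show False by (simp add: bil_alt rt_diff assms)
qed

text \<open>Stands in for being a root of norm 2 e. The divisibility says that the coordinates k_j
  d_j / e of the coroot are integers. Both conditions are stable under \<open>cs\<close>.\<close>

definition root_co :: "nat \<Rightarrow> ('i \<Rightarrow> int) \<Rightarrow> bool" where
  "root_co e k \<longleftrightarrow> bil k k = 2 * int e \<and> (\<forall>j. int e dvd k j * int (d j))"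

lemma root_co_unit: "root_co (d i) (unit_co i)"
  unfolding root_co_def
proof (intro conjI allI)
  show "bil (unit_co i) (unit_co i) = 2 * int (d i)" by (simp add: bil_unit_left)
  fix j show "int (d i) dvd unit_co i j * int (d j)" by (cases "j = i") (simp_all add: unit_co_def)
qed

lemma root_co_cs: assumes "root_co e k" shows "root_co e (cs i k)"
  unfolding root_co_def
proof (intro conjI allI)
  let ?n = "rt k $ i"
  have k: "bil k k = 2 * int e" "int e dvd k j * int (d j)" for j
    using assms by (auto simp only: root_co_def)
  have "bil (cs i k) (cs i k) = bil k k - ?n * bil k (unit_co i)
      - ?n * (bil (unit_co i) k - ?n * bil (unit_co i) (unit_co i))"
    by (simp only: cs_def bil_diff_left bil_diff_right bil_scale_left bil_scale_right right_diff_distrib)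
  also have "\<dots> = bil k k"
    by (simp add: bil_sym[of k "unit_co i"] bil_unit_left)
  finally show "bil (cs i k) (cs i k) = 2 * int e" using k(1) by simp
  fix j
  \<comment> \<open>By symmetry of the form, d_i times the pairing with coroot i is a combination of
    the k_l d_l, all divisible by \<open>e\<close>.\<close>
  have eq: "int (d i) * ?n = (\<Sum>l\<in>UNIV. C $ l $ i * (k l * int (d l)))"
    unfolding rt_nth sum_distrib_left
  proof (intro sum.cong refl)
    fix l
    have "int (d i) * (C $ i $ l * k l) = int (d i) * C $ i $ l * k l" by simp
    also have "\<dots> = C $ l $ i * (k l * int (d l))" unfolding d_sym[of i l] by simp
    finally show "int (d i) * (C $ i $ l * k l) = C $ l $ i * (k l * int (d l))" .
  qed
  have "int e dvd int (d i) * ?n" unfolding eq by (intro dvd_sum) (rule dvd_mult[OF k(2)])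
  then have 1: "int e dvd int (d i) * ?n * unit_co i j" by (rule dvd_mult2)
  have "cs i k j * int (d j) = k j * int (d j) - int (d i) * ?n * unit_co i j"
    by (cases "j = i") (simp_all add: cs_def unit_co_def algebra_simps)
  then show "int e dvd cs i k j * int (d j)" using dvd_diff[OF k(2) 1] by simp
qed

text \<open>If \<open>k\<close> had coordinates of both signs, its positive and negative parts would both have norm
  at least \<open>2 e\<close> (the divisibility in \<open>root_co\<close> passes to them), and they pair nonpositively.\<close>

lemma root_co_sign: assumes "root_co e k" "e > 0" shows "(\<forall>i. k i \<ge> 0) \<or> (\<forall>i. k i \<le> 0)"
proof (rule ccontr)
  assume neg: "\<not> ?thesis"
  define p where "p = (\<lambda>i. max (k i) 0)"
  define m where "m = (\<lambda>i. max (- k i) 0)"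
  \<comment> \<open>With x_i d_i = e c_i the norm is e times a sum whose summands c_i C_ij x_j are
    symmetric in i and j with even diagonal, hence a multiple of 2 e.\<close>
  have norm: "2 * int e \<le> bil x x" if "x \<noteq> (\<lambda>_. 0)" "\<And>i. int e dvd x i * int (d i)" for x
  proof -
    have "\<exists>c. x i * int (d i) = int e * c" for i using that(2)[of i] by (auto simp: dvd_def)
    then obtain c where c: "\<And>i. x i * int (d i) = int e * c i" by metis
    have "bil x x = int e * (\<Sum>i\<in>UNIV. \<Sum>j\<in>UNIV. c i * C $ i $ j * x j)"
      unfolding bil_def sum_distrib_left
    proof (intro sum.cong refl)
      fix i j
      have "int (d i) * C $ i $ j * x i * x j = (x i * int (d i)) * (C $ i $ j * x j)" by simp
      then show "int (d i) * C $ i $ j * x i * x j = int e * (c i * C $ i $ j * x j)"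
        unfolding c by simp
    qed
    moreover have "even (\<Sum>i\<in>UNIV. \<Sum>j\<in>UNIV. c i * C $ i $ j * x j)"
    proof (rule even_sum_symmetric)
      fix i j
      have "int e * (c i * C $ i $ j * x j) = x i * x j * (int (d i) * C $ i $ j)"
      proof -
        have "int e * (c i * C $ i $ j * x j) = (x i * int (d i)) * (C $ i $ j * x j)"
          unfolding c by simp
        then show ?thesis by simp
      qed
      also have "\<dots> = (x j * int (d j)) * (C $ j $ i * x i)"
        unfolding d_sym[of i j] by simp
      also have "\<dots> = int e * (c j * C $ j $ i * x i)" unfolding c by simp
      finally show "c i * C $ i $ j * x j = c j * C $ j $ i * x i" using assms(2) by simp
    qed simp_all
    ultimately have "2 * int e dvd bil x x" by (auto elim!: evenE)
    then show ?thesis using bil_pos[OF that(1)] by (rule zdvd_imp_le)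
  qed
  have k: "k = (\<lambda>i. p i - m i)" by (auto simp: p_def m_def)
  have "p \<noteq> (\<lambda>_. 0)" "m \<noteq> (\<lambda>_. 0)" using neg unfolding p_def m_def fun_eq_iff
    by (metis max.cobounded1, metis max.cobounded1 neg_le_0_iff_le)
  moreover have "int e dvd p i * int (d i)" "int e dvd m i * int (d i)" for i
    using assms(1) by (auto simp: p_def m_def root_co_def max_def)
  ultimately have "2 * int e \<le> bil p p" "2 * int e \<le> bil m m" using norm by blast+
  moreover have "bil p m \<le> 0"
    unfolding bil_def
  proof (intro sum_nonpos)
    fix i j
    show "int (d i) * C $ i $ j * p i * m j \<le> 0"
    proof (cases "i = j")
      case False
      then have "int (d i) * C $ i $ j \<le> 0" using C_nonpos by (simp add: mult_nonneg_nonpos)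
      moreover have "p i * m j \<ge> 0" by (simp add: p_def m_def)
      ultimately have "int (d i) * C $ i $ j * (p i * m j) \<le> 0" by (rule mult_nonpos_nonneg)
      then show ?thesis by (simp only: mult.assoc)
    qed (auto simp: p_def m_def max_def)
  qed
  moreover have "bil k k = bil p p + bil m m - 2 * bil p m"
    unfolding k by (simp add: bil_diff_left bil_diff_right bil_sym[of m p])
  ultimately show False using assms by (simp add: root_co_def)
qed

text \<open>The norm gives c^2 d_i = e, while e divides c d_i; hence c divides 1. This is
  reducedness of the root system at a simple root.\<close>

lemma root_co_proportional:
  assumes "root_co e (\<lambda>j. c * unit_co i j)" "e > 0" shows "c * c = 1" "e = d i"
proof -
  have 1: "c * c * int (d i) = int e"
    using assms(1) by (simp add: root_co_def bil_scale_left bil_scale_right bil_unit_left)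
  moreover have "int e dvd c * int (d i)"
    using assms(1) unfolding root_co_def unit_co_def by (auto dest: spec[of _ i])
  ultimately have "(c * int (d i)) * c dvd (c * int (d i)) * 1" by (simp add: mult.assoc mult.commute)
  moreover have "c * int (d i) \<noteq> 0" using 1 assms(2) d_pos[of i] by auto
  ultimately have "c dvd 1" by (simp only: dvd_mult_cancel_left) auto
  then have "\<bar>c\<bar> = 1" by simp
  then show "c * c = 1" by (metis abs_mult_self_eq mult_1)
  with 1 show "e = d i" by simp
qed


subsection \<open>Words in the simple reflections\<close>

definition sw :: "'i list \<Rightarrow> int^'i \<Rightarrow> int^'i" where "sw is = foldr (\<lambda>i f. s i \<circ> f) is id"
definition cw :: "'i list \<Rightarrow> ('i \<Rightarrow> int) \<Rightarrow> 'i \<Rightarrow> int" where "cw is = foldr (\<lambda>i f. cs i \<circ> f) is id"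

lemma sw_Nil [simp]: "sw [] = id" and sw_Cons: "sw (i # is) = s i \<circ> sw is"
  by (simp_all add: sw_def)
lemma cw_Nil [simp]: "cw [] = id" and cw_Cons: "cw (i # is) = cs i \<circ> cw is"
  by (simp_all add: cw_def)

lemma sw_append: "sw (is @ js) = sw is \<circ> sw js"
  by (induction "is") (simp_all add: sw_Cons comp_assoc)

lemma sw_single [simp]: "sw [i] = s i" by (simp add: sw_Cons)

lemma s_add: "s i (x + y) = s i x + s i y"
  and s_scale: "s i (c *s x) = c *s s i x"
  and s_s [simp]: "s i (s i x) = x"
  by (simp_all add: vec_eq_iff s_nth algebra_simps)

lemma s_comp_s [simp]: "s i \<circ> s i = id" by (simp add: fun_eq_iff)

lemma comp_s_s [simp]: "w \<circ> s i \<circ> s i = w" by (simp add: comp_assoc)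

lemma s_simple_root: "s i (\<alpha> i) = - \<alpha> i"
  by (simp add: vec_eq_iff s_nth)

lemma sw_add: "sw is (x + y) = sw is x + sw is y"
  and sw_scale: "sw is (c *s x) = c *s sw is x"
  by (induction "is") (simp_all add: sw_Cons s_add s_scale)

lemma sw_rev: "sw (rev is) (sw is x) = x"
  by (induction "is" arbitrary: x) (simp_all add: sw_Cons sw_append)

lemma rt_cw: "rt (cw is k) = sw is (rt k)"
  by (induction "is") (simp_all add: sw_Cons cw_Cons rt_cs)

lemma root_co_cw: "root_co e k \<Longrightarrow> root_co e (cw is k)"
  by (induction "is") (simp_all add: cw_Cons root_co_cs)

lemma s_Bij: "s i \<in> carrier (BijGroup UNIV)"
  unfolding BijGroup_def Bij_def using o_bij[of "s i" "s i"] by (simp add: extensional_def)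

interpretation B: group "BijGroup (UNIV :: (int^'i) set)" by (rule group_BijGroup)

lemma BijGroup_mult: "f \<in> carrier (BijGroup UNIV) \<Longrightarrow> g \<in> carrier (BijGroup UNIV) \<Longrightarrow>
   f \<otimes>\<^bsub>BijGroup UNIV\<^esub> g = f \<circ> g"
  by (auto simp: BijGroup_def compose_def)

lemma sw_Bij: "sw is \<in> carrier (BijGroup UNIV)"
proof (induction "is")
  case Nil
  have "sw [] = \<one>\<^bsub>BijGroup UNIV\<^esub>" by (simp add: BijGroup_def fun_eq_iff)
  then show ?case by (metis B.one_closed)
next
  case (Cons i "is")
  show ?case using B.m_closed[OF s_Bij Cons, of i] unfolding BijGroup_mult[OF s_Bij Cons] sw_Cons .
qed

text \<open>Simple reflections are involutions, so inverses of generators are again generators and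
  words without inverse letters exhaust the generated subgroup.\<close>

lemma weyl_group_carrier: "W = range sw"
proof -
  have W: "W = generate (BijGroup UNIV) (range s)"
    unfolding weyl_group_def carrier_subgroup_generated using s_Bij by (metis Int_absorb1 image_subsetI)
  have 1: "x \<in> range sw" if "x \<in> generate (BijGroup UNIV) (range s)" for x
    using that
  proof induction
    case one
    have "\<one>\<^bsub>BijGroup UNIV\<^esub> = sw []" by (simp add: BijGroup_def fun_eq_iff)
    then show ?case by blast
  next
    case (incl h) then show ?case by (metis imageE rangeI sw_single)
  next
    case (inv h)
    then obtain i where i: "h = s i" by auto
    have "inv\<^bsub>BijGroup UNIV\<^esub> (s i) = s i"
      by (rule B.inv_equality) (auto simp: s_Bij BijGroup_mult, simp add: BijGroup_def fun_eq_iff)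
    then show ?case using i by (metis rangeI sw_single)
  next
    case (eng h1 h2)
    then obtain a b where "h1 = sw a" "h2 = sw b" by auto
    then show ?case by (simp add: BijGroup_mult sw_Bij sw_append[symmetric])
  qed
  have 2: "sw is \<in> generate (BijGroup UNIV) (range s)" for "is"
  proof (induction "is")
    case Nil
    have "\<one>\<^bsub>BijGroup UNIV\<^esub> = sw []" by (simp add: BijGroup_def fun_eq_iff)
    then show ?case by (metis generate.one)
  next
    case (Cons i "is")
    have "sw (i # is) = s i \<otimes>\<^bsub>BijGroup UNIV\<^esub> sw is"
      by (simp add: BijGroup_mult s_Bij sw_Bij sw_Cons)
    then show ?case using Cons by (metis generate.eng generate.incl rangeI)
  qed
  show ?thesis using W 1 2 by blast
qed

lemma weyl_group_group: "group (weyl_group C)"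
  unfolding weyl_group_def by (rule B.group_subgroup_generated)

lemma weyl_group_mult: "v \<in> W \<Longrightarrow> w \<in> W \<Longrightarrow> v \<otimes>\<^bsub>weyl_group C\<^esub> w = v \<circ> w"
  unfolding weyl_group_carrier using BijGroup_mult[OF sw_Bij sw_Bij]
  by (auto simp: weyl_group_def)

lemma W_comp: "v \<in> W \<Longrightarrow> w \<in> W \<Longrightarrow> v \<circ> w \<in> W"
  unfolding weyl_group_carrier by (auto simp: sw_append[symmetric])

lemma W_s [simp]: "s i \<in> W" and W_id [simp]: "id \<in> W" and W_sw [simp]: "sw is \<in> W"
  unfolding weyl_group_carrier by (metis rangeI sw_single, metis rangeI sw_Nil, blast)

lemma W_comp_s [simp]: "w \<in> W \<Longrightarrow> w \<circ> s i \<in> W" by (simp add: W_comp)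

lemma W_comp_sw [simp]: "w \<in> W \<Longrightarrow> w \<circ> sw is \<in> W" by (simp add: W_comp)

lemma W_add: "w \<in> W \<Longrightarrow> w (x + y) = w x + w y"
  and W_scale: "w \<in> W \<Longrightarrow> w (c *s x) = c *s w x"
  unfolding weyl_group_carrier by (auto simp: sw_add sw_scale)

lemma W_0: "w \<in> W \<Longrightarrow> w 0 = 0" using W_add[of w 0 0] by simp

lemma W_uminus: "w \<in> W \<Longrightarrow> w (- x) = - w x"
  using W_add[of w x "-x"] by (simp add: W_0 eq_neg_iff_add_eq_0 add.commute)

lemma W_diff: "w \<in> W \<Longrightarrow> w (x - y) = w x - w y"
  using W_add[of w x "-y"] by (simp add: W_uminus)

lemma W_inj: "w \<in> W \<Longrightarrow> inj w"
  unfolding weyl_group_carrier using sw_rev by (metis inj_onI rangeE)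

lemma root_dichotomy: "w \<in> W \<Longrightarrow> w (\<alpha> i) \<in> Q_plus C \<or> - w (\<alpha> i) \<in> Q_plus C"
proof -
  assume "w \<in> W"
  then obtain "is" where w: "w = sw is" unfolding weyl_group_carrier by auto
  have "root_co (d i) (cw is (unit_co i))" by (intro root_co_cw root_co_unit)
  from root_co_sign[OF this d_pos]
  show ?thesis
  proof
    assume "\<forall>j. cw is (unit_co i) j \<ge> 0"
    then show ?thesis unfolding Q_plus_iff w
      by (intro disjI1 exI[of _ "cw is (unit_co i)"]) (simp add: rt_cw)
  next
    assume "\<forall>j. cw is (unit_co i) j \<le> 0"
    then show ?thesis unfolding Q_plus_iff w
      by (intro disjI2 exI[of _ "\<lambda>j. - cw is (unit_co i) j"]) (simp add: rt_cw rt_uminus)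
  qed
qed

section \<open>Positive and negative roots, and the exchange condition\<close>

lemma Q_plus_pointed: "x \<in> Q_plus C \<Longrightarrow> - x \<in> Q_plus C \<Longrightarrow> x = 0"
proof -
  assume "x \<in> Q_plus C" "- x \<in> Q_plus C"
  then obtain k l where k: "\<And>i. k i \<ge> 0" "x = rt k" and l: "\<And>i. l i \<ge> 0" "- x = rt l"
    unfolding Q_plus_iff by auto
  have "rt k = - rt l" unfolding k(2)[symmetric] l(2)[symmetric] by simp
  then have "rt k = rt (\<lambda>j. - l j)" by (simp only: rt_uminus)
  then have "k = (\<lambda>j. - l j)" by (rule rt_inj)
  then have "k j = 0" for j using k(1)[of j] l(1)[of j] by simp
  then have "k = (\<lambda>_. 0)" by blast
  then show "x = 0" using k(2) by (simp add: rt_0)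
qed

lemma simple_root_nonzero: "\<alpha> i \<noteq> 0"
proof
  assume "\<alpha> i = 0"
  then have "\<alpha> i $ i = 0" by simp
  then show False by simp
qed

lemma W_simple_root_nonzero: "w \<in> W \<Longrightarrow> w (\<alpha> i) \<noteq> 0"
  using injD[OF W_inj, of w "\<alpha> i" 0] W_0[of w] simple_root_nonzero[of i] by auto

lemma W_pos_neg: "w \<in> W \<Longrightarrow> w (\<alpha> i) \<in> Q_plus C \<Longrightarrow> - w (\<alpha> i) \<notin> Q_plus C"
  using Q_plus_pointed W_simple_root_nonzero by blast

lemma pos_roots_iff: "w \<in> W \<Longrightarrow> w (\<alpha> i) \<in> pos_roots C \<longleftrightarrow> w (\<alpha> i) \<in> Q_plus C"
  unfolding pos_roots_def roots_def by auto

text \<open>The reflection \<open>s j\<close> changes only the coordinate j. If it makes a positive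
  root negative, all other coordinates vanish, and \<open>root_co_proportional\<close> leaves only
  \<alpha> j.\<close>

lemma negative_after_reflection:
  assumes "root_co e k" "e > 0" "rt k \<in> Q_plus C" "- s j (rt k) \<in> Q_plus C"
  shows "k = unit_co j"
proof -
  have kp: "k i \<ge> 0" for i using assms(3) unfolding Q_plus_iff by (auto dest: rt_inj)
  obtain l where l: "\<And>i. l i \<ge> 0" "- s j (rt k) = rt l" using assms(4) unfolding Q_plus_iff by auto
  have "cs j k = (\<lambda>i. - l i)"
    by (rule rt_inj) (use l(2) in \<open>simp add: rt_cs rt_uminus flip: l(2)\<close>)
  then have "k i = 0" if "i \<noteq> j" for i
  proof -
    have "k i = - l i" using fun_cong[OF \<open>cs j k = _\<close>, of i] that by (simp add: cs_def unit_co_def)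
    then show ?thesis using kp[of i] l(1)[of i] by simp
  qed
  then have k: "k = (\<lambda>i. k j * unit_co j i)" by (auto simp: unit_co_def)
  with assms(1) have "root_co e (\<lambda>i. k j * unit_co j i)" by simp
  from root_co_proportional[OF this assms(2)] have "k j * k j = 1" by simp
  then have "k j = 1" using kp[of j] zmult_eq_1_iff[of "k j" "k j"] by auto
  then show ?thesis using k by simp
qed

text \<open>The invariant form between a weight and an element of the root lattice; with \<alpha> j
  it is d_j times the coroot pairing \<open>x $ j\<close>.\<close>

definition pair :: "int^'i \<Rightarrow> ('i \<Rightarrow> int) \<Rightarrow> int" where
  "pair x k = (\<Sum>j\<in>UNIV. x $ j * int (d j) * k j)"

lemma pair_unit: "pair x (unit_co j) = x $ j * int (d j)"
  by (simp add: pair_def sum_unit_co)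

lemma pair_simple_root: "pair (\<alpha> i) k = int (d i) * rt k $ i"
  unfolding pair_def rt_nth sum_distrib_left
  by (intro sum.cong refl) (simp, metis d_sym mult.assoc mult.commute)

lemma pair_invariant_s: "pair (s i x) (cs i k) = pair x k"
proof -
  have 1: "pair (x - c *s y) k = pair x k - c * pair y k" for x y c k
    by (simp add: pair_def algebra_simps sum_subtractf sum_distrib_left)
  have 2: "pair x (\<lambda>j. k j - c * l j) = pair x k - c * pair x l" for x c k l
    by (simp add: pair_def algebra_simps sum_subtractf sum_distrib_left)
  show ?thesis
    unfolding simple_reflection_def cs_def 1 2 pair_simple_root
    by (simp add: pair_unit rt_unit algebra_simps)
qed

lemma pair_invariant: "pair (sw is x) (cw is k) = pair x k"
  by (induction "is") (simp_all add: sw_Cons cw_Cons pair_invariant_s)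

text \<open>The conjugate of \<open>s i\<close> by w is the reflection in w(\<alpha> i). Invariance
  of norms gives d_i = d_j, and invariance of \<open>pair\<close> then identifies coordinate j of
  the image of x with coordinate i of x.\<close>

lemma conjugate_reflection:
  assumes "cw js (unit_co i) = unit_co j" shows "sw js \<circ> s i = s j \<circ> sw js"
proof
  fix x
  have "root_co (d i) (unit_co j)" using root_co_cw[OF root_co_unit[of i], of js] assms by simp
  then have "d i = d j" unfolding root_co_def bil_unit_left by (simp only: rt_unit) simp
  moreover have "pair (sw js x) (unit_co j) = pair x (unit_co i)" using pair_invariant[of js x "unit_co i"] assms by simp
  ultimately have eq: "sw js x $ j = x $ i" using d_pos[of j] by (simp add: pair_unit)
  have "sw js (\<alpha> i) = \<alpha> j" using rt_cw[of js "unit_co i"] assms by simp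
  then show "(sw js \<circ> s i) x = (s j \<circ> sw js) x"
    by (simp add: simple_reflection_def eq W_diff[OF W_sw] sw_scale)
qed

text \<open>Applying the letters from the right, the image of \<alpha> i changes from positive to
  negative at some letter j. Just before this letter it equals \<alpha> j, so moving
  \<open>s i\<close> to the left past the letters on the right of j turns it into
  \<open>s j\<close>, which cancels that letter.\<close>

lemma exchange:
  assumes "- sw js (\<alpha> i) \<in> Q_plus C"
  shows "\<exists>a j b. js = a @ j # b \<and> sw js \<circ> s i = sw (a @ b)"
  using assms
proof (induction js)
  case Nil
  then show ?case using W_pos_neg[OF W_id, of i] by simp
next
  case (Cons j js)
  show ?case
  proof (cases "- sw js (\<alpha> i) \<in> Q_plus C")
    case True
    then obtain a j' b where "js = a @ j' # b" "sw js \<circ> s i = sw (a @ b)" using Cons.IH by blast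
    then have "j # js = (j # a) @ j' # b" "sw (j # js) \<circ> s i = sw ((j # a) @ b)"
      by (simp_all add: sw_Cons comp_assoc)
    then show ?thesis by blast
  next
    case False
    then have "sw js (\<alpha> i) \<in> Q_plus C" using root_dichotomy[OF W_sw] by blast
    then have "cw js (unit_co i) = unit_co j"
      by (intro negative_after_reflection[of "d i"] root_co_cw root_co_unit d_pos)
         (use Cons.prems in \<open>auto simp: rt_cw sw_Cons\<close>)
    from conjugate_reflection[OF this] have "sw (j # js) \<circ> s i = sw ([] @ js)"
      by (simp add: sw_Cons comp_assoc) (simp flip: comp_assoc)
    then show ?thesis by blast
  qed
qed

subsection \<open>Reduced words and the Coxeter presentation\<close>

text \<open>Reducedness expressed without a length function: each letter is appended where its
  simple root is still sent to a positive root. \<open>asc_shortest\<close> identifies these words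
  as shortest ones.\<close>

definition asc :: "'i list \<Rightarrow> bool" where
  "asc is \<longleftrightarrow> (\<forall>a i b. is = a @ i # b \<longrightarrow> sw a (\<alpha> i) \<in> Q_plus C)"

lemma asc_Nil [simp]: "asc []" by (simp add: asc_def)

lemma asc_snoc: "asc (is @ [i]) \<longleftrightarrow> asc is \<and> sw is (\<alpha> i) \<in> Q_plus C"
proof
  assume *: "asc (is @ [i])"
  have "sw a (\<alpha> j) \<in> Q_plus C" if "is = a @ j # b" for a j b
    using * that unfolding asc_def by auto
  moreover have "sw is (\<alpha> i) \<in> Q_plus C" using * unfolding asc_def by blast
  ultimately show "asc is \<and> sw is (\<alpha> i) \<in> Q_plus C" unfolding asc_def by blast
next
  assume *: "asc is \<and> sw is (\<alpha> i) \<in> Q_plus C"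
  have "sw a (\<alpha> j) \<in> Q_plus C" if "is @ [i] = a @ j # b" for a j b
  proof (cases b rule: rev_cases)
    case Nil then show ?thesis using that * by auto
  next
    case (snoc b' x)
    then have "is = a @ j # b'" using that by simp
    then show ?thesis using * unfolding asc_def by blast
  qed
  then show "asc (is @ [i])" unfolding asc_def by blast
qed

lemma sw_snoc: "sw (is @ [i]) = sw is \<circ> s i" by (simp add: sw_append)

text \<open>If appending a letter fails to ascend, \<open>exchange\<close> deletes a letter instead,
  which leaves a shorter word to start again from. The bound on the letters keeps the result inside
  a parabolic subgroup.\<close>

lemma exists_asc: "\<exists>js. asc js \<and> sw js = sw is \<and> set js \<subseteq> set is \<and> length js \<le> length is"
proof (induction "is" rule: length_induct)
  case (1 "is")
  show ?case
  proof (cases "is" rule: rev_cases)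
    case Nil
    then show ?thesis by (intro exI[of _ "[]"]) simp
  next
    case (snoc is' i)
    obtain js where js: "asc js" "sw js = sw is'" "set js \<subseteq> set is'" "length js \<le> length is'"
      using 1 snoc by (metis length_append_singleton lessI)
    show ?thesis
    proof (cases "sw js (\<alpha> i) \<in> Q_plus C")
      case True
      then show ?thesis using js snoc
        by (intro exI[of _ "js @ [i]"]) (auto simp: asc_snoc sw_snoc)
    next
      case False
      then have "- sw js (\<alpha> i) \<in> Q_plus C" using root_dichotomy[OF W_sw] by blast
      from exchange[OF this] obtain a j b where ab: "js = a @ j # b" "sw js \<circ> s i = sw (a @ b)" by blast
      have "length (a @ b) < length is" using ab js(4) snoc by simp
      then obtain ks where "asc ks" "sw ks = sw (a @ b)" "set ks \<subseteq> set (a @ b)"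
        "length ks \<le> length (a @ b)" using 1 by blast
      then show ?thesis using ab js snoc
        by (intro exI[of _ ks]) (auto simp: sw_snoc)
    qed
  qed
qed

text \<open>If the ascending word ends in i, any word for the same element sends \<alpha> i to a
  negative root, so \<open>exchange\<close> removes one of its letters and leaves a word for the
  remaining prefix.\<close>

lemma asc_shortest: "asc is \<Longrightarrow> sw is = sw js \<Longrightarrow> length is \<le> length js"
proof (induction "is" arbitrary: js rule: rev_induct)
  case (snoc i "is")
  then have "asc is" and *: "sw is (\<alpha> i) \<in> Q_plus C" by (simp_all add: asc_snoc)
  have "- sw js (\<alpha> i) \<in> Q_plus C"
    using * snoc.prems(2) by (simp add: sw_snoc s_simple_root W_uminus[OF W_sw] flip: snoc.prems(2))
  from exchange[OF this] obtain a j b where ab: "js = a @ j # b" "sw js \<circ> s i = sw (a @ b)" by blast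
  have "sw is = sw (is @ [i]) \<circ> s i" unfolding sw_snoc by simp
  also have "\<dots> = sw (a @ b)" unfolding snoc.prems(2) by (rule ab(2))
  finally have "sw is = sw (a @ b)" .
  from snoc.IH[OF \<open>asc is\<close> this] show ?case using ab(1) by simp
qed simp

lemma cw_outside: "set b \<subseteq> J \<Longrightarrow> l \<notin> J \<Longrightarrow> cw b k l = k l"
  by (induction b) (auto simp: cw_Cons cs_def unit_co_def)

text \<open>The letters of \<open>b\<close> leave coordinates outside i and j untouched, so a
  positive root of the rank two subsystem is a nonnegative combination of \<alpha> i and \<alpha> j
  alone.\<close>

lemma parabolic_positive:
  assumes u: "u \<in> W" "u (\<alpha> i) \<in> Q_plus C" "u (\<alpha> j) \<in> Q_plus C"
    and b: "set b \<subseteq> {i, j}" "l \<in> {i, j}" "i \<noteq> j" and pos: "sw b (\<alpha> l) \<in> Q_plus C"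
  shows "u (sw b (\<alpha> l)) \<in> Q_plus C"
proof -
  define k where "k = cw b (unit_co l)"
  have rtk: "rt k = sw b (\<alpha> l)" by (simp add: k_def rt_cw)
  obtain k' where "\<forall>m. k' m \<ge> 0" "sw b (\<alpha> l) = rt k'" using pos unfolding Q_plus_iff by auto
  then have kpos: "k m \<ge> 0" for m using rt_inj[of k k'] rtk by simp
  have "k m = 0" if "m \<notin> {i, j}" for m
    using cw_outside[OF b(1) that, of "unit_co l"] that b(2) by (auto simp: k_def unit_co_def)
  then have "k = (\<lambda>m. k i * unit_co i m + k j * unit_co j m)"
    using b(3) by (auto simp: unit_co_def fun_eq_iff)
  then have "rt k = rt (\<lambda>m. k i * unit_co i m + k j * unit_co j m)" by simp
  also have "\<dots> = k i *s \<alpha> i + k j *s \<alpha> j" unfolding rt_add rt_scale rt_unit ..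
  finally have "u (sw b (\<alpha> l)) = k i *s u (\<alpha> i) + k j *s u (\<alpha> j)"
    by (simp add: rtk[symmetric] W_add[OF u(1)] W_scale[OF u(1)])
  then show ?thesis using Q_plus_add Q_plus_scale u kpos by simp
qed

text \<open>Minimal coset representatives: among all factorizations take one with the shortest left
  word. If it made a simple root of \<open>J\<close> negative, \<open>exchange\<close> would shorten
  it at the price of one more letter in \<open>b\<close>.\<close>

lemma parabolic_decomposition:
  assumes "w \<in> W"
  obtains u b where "u \<in> W" "set b \<subseteq> J" "w = u \<circ> sw b" "\<And>i. i \<in> J \<Longrightarrow> u (\<alpha> i) \<in> Q_plus C"
proof -
  define P where "P = (\<lambda>ks. \<exists>b. set b \<subseteq> J \<and> w = sw ks \<circ> sw b)"
  obtain js where "w = sw js" using assms unfolding weyl_group_carrier by auto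
  then have "P js" unfolding P_def by (intro exI[of _ "[]"]) simp
  then obtain ks where ks: "P ks" "\<And>ks'. P ks' \<Longrightarrow> length ks \<le> length ks'"
    using ex_has_least_nat[of P js length] by blast
  then obtain b where b: "set b \<subseteq> J" "w = sw ks \<circ> sw b" unfolding P_def by blast
  have "sw ks (\<alpha> i) \<in> Q_plus C" if "i \<in> J" for i
  proof (rule ccontr)
    assume "sw ks (\<alpha> i) \<notin> Q_plus C"
    then have "- sw ks (\<alpha> i) \<in> Q_plus C" using root_dichotomy[OF W_sw] by blast
    from exchange[OF this] obtain a j c where ac: "ks = a @ j # c" "sw ks \<circ> s i = sw (a @ c)" by blast
    have "sw (a @ c) \<circ> sw (i # b) = w"
      using ac(2)[symmetric] b(2) by (simp add: sw_Cons fun_eq_iff)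
    then have "P (a @ c)" unfolding P_def using b(1) that by (intro exI[of _ "i # b"]) auto
    from ks(2)[OF this] show False using ac(1) by simp
  qed
  with b show ?thesis by (intro that[of "sw ks" b]) auto
qed

lemma asc_append_parabolic:
  assumes "asc ks" "asc b" "set b \<subseteq> {i, j}" "i \<noteq> j"
    and pos: "sw ks (\<alpha> i) \<in> Q_plus C" "sw ks (\<alpha> j) \<in> Q_plus C"
  shows "asc (ks @ b)"
  using assms(2,3)
proof (induction b rule: rev_induct)
  case (snoc l b)
  then have "asc (ks @ b)" "sw b (\<alpha> l) \<in> Q_plus C" "set b \<subseteq> {i, j}" "l \<in> {i, j}" by (simp_all add: asc_snoc)
  with parabolic_positive[OF W_sw pos, of b l] assms(4)
  have "asc ((ks @ b) @ [l])" unfolding asc_snoc by (simp add: sw_append)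
  then show ?case by simp
qed (use assms(1) in simp)

text \<open>Matsumoto's argument: two reduced words for the same element, ending in \<open>i\<close> and in \<open>j\<close>, are
  compared with reduced words through the longest possible suffix in the letters \<open>i, j\<close>.\<close>

lemma word_congruence:
  fixes R :: "'i list \<Rightarrow> 'i list \<Rightarrow> bool"
  assumes refl: "\<And>a. R a a" and sym: "\<And>a b. R a b \<Longrightarrow> R b a"
    and trans: "\<And>a b c. R a b \<Longrightarrow> R b c \<Longrightarrow> R a c"
    and cong: "\<And>a b x y. R a b \<Longrightarrow> R (x @ a @ y) (x @ b @ y)"
    and inv: "\<And>i. R [i, i] []"
    and dihedral: "\<And>i j a b. i \<noteq> j \<Longrightarrow> set a \<subseteq> {i, j} \<Longrightarrow> set b \<subseteq> {i, j} \<Longrightarrow> sw a = sw b \<Longrightarrow> R a b"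
    and eq: "sw is = sw js"
  shows "R is js"
proof -
  have cr: "R (a @ y) (b @ y)" if "R a b" for a b y using cong[OF that, of "[]" y] by simp
  have cl: "R (x @ a) (x @ b)" if "R a b" for a b x using cong[OF that, of x "[]"] by simp
  have unique: "R is js" if "asc is" "asc js" "sw is = sw js" for "is" js
    using that
  proof (induction "length is" arbitrary: "is" js rule: less_induct)
    case less
    have len: "length is = length js"
      using asc_shortest less.prems by (metis order.antisym)
    show ?case
    proof (cases "is = []")
      case True
      with len refl show ?thesis by simp
    next
      case False
      then obtain is' i where i: "is = is' @ [i]" by (metis rev_exhaust)
      obtain js' j where j: "js = js' @ [j]" using False len by (metis length_0_conv rev_exhaust)
      have asc': "asc is'" "asc js'" using less.prems i j by (simp_all add: asc_snoc)
      show ?thesis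
      proof (cases "i = j")
        case True
        have "sw is' = sw js'" using less.prems(3) i j True by (metis comp_s_s sw_snoc)
        then show ?thesis using less.hyps[of is' js'] asc' i j True cr by simp
      next
        case False
        let ?w = "sw is"
        obtain u b where u: "u \<in> W" "set b \<subseteq> {i, j}" "?w = u \<circ> sw b" "u (\<alpha> i) \<in> Q_plus C" "u (\<alpha> j) \<in> Q_plus C"
          using parabolic_decomposition[OF W_sw[of "is"], of "{i, j}"] by (metis insertCI)
        obtain ks where ks: "asc ks" "sw ks = u"
          using u(1) exists_asc unfolding weyl_group_carrier by (metis imageE)
        have last: "- sw (ks @ [l]) (\<alpha> l) \<in> Q_plus C" if "asc (ks @ [l])" for ks l
          using that by (simp add: sw_snoc asc_snoc s_simple_root W_uminus[OF W_sw])
        have neg: "- ?w (\<alpha> i) \<in> Q_plus C" "- ?w (\<alpha> j) \<in> Q_plus C"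
          using last[of is' i] last[of js' j] less.prems by (simp_all flip: i j)
        \<comment> \<open>Both i and j are descents of the whole element, hence of its rank two
          factor \<open>b\<close>; so \<open>b\<close> has a reduced word ending in either
          letter.\<close>
        have ends: "\<exists>c. asc (ks @ c @ [l]) \<and> set c \<subseteq> {i, j} \<and> sw (c @ [l]) = sw b"
          if l: "l \<in> {i, j}" for l
        proof -
          have nb: "sw b (\<alpha> l) \<notin> Q_plus C"
          proof
            assume "sw b (\<alpha> l) \<in> Q_plus C"
            from parabolic_positive[OF u(1,4,5,2) l False this] have "?w (\<alpha> l) \<in> Q_plus C" using u(3) by simp
            then show False using neg l W_pos_neg[OF W_sw] by auto
          qed
          obtain c where c: "asc c" "sw c = sw (b @ [l])" "set c \<subseteq> set (b @ [l])" using exists_asc by blast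
          have "sw c (\<alpha> l) \<in> Q_plus C"
            using nb root_dichotomy[OF W_sw, of b l] c(2)
            by (auto simp: sw_snoc s_simple_root W_uminus[OF W_sw])
          with c have "asc (c @ [l])" "set (c @ [l]) \<subseteq> {i, j}" using u(2) l by (auto simp: asc_snoc)
          from asc_append_parabolic[OF ks(1) this False] ks(2) u(4,5) have "asc (ks @ c @ [l])" by simp
          moreover have "sw (c @ [l]) = sw b" using c(2) by (simp add: sw_snoc)
          ultimately show ?thesis using \<open>set (c @ [l]) \<subseteq> {i, j}\<close> by (intro exI[of _ c]) simp
        qed
        obtain c where c: "asc (ks @ c @ [i])" "set c \<subseteq> {i, j}" "sw (c @ [i]) = sw b" using ends[of i] by auto
        obtain c' where c': "asc (ks @ c' @ [j])" "set c' \<subseteq> {i, j}" "sw (c' @ [j]) = sw b" using ends[of j] by auto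
        have w1: "sw (ks @ c @ [i]) = ?w" using c(3) u(3) ks(2) by (simp add: sw_append)
        have w2: "sw (ks @ c' @ [j]) = sw js" using c'(3) u(3) ks(2) less.prems(3) by (simp add: sw_append)
        have l1: "length (ks @ c @ [i]) = length is" using asc_shortest[OF c(1) w1] asc_shortest[OF less.prems(1) w1[symmetric]] by simp
        have l2: "length (ks @ c' @ [j]) = length js" using asc_shortest[OF c'(1) w2] asc_shortest[OF less.prems(2) w2[symmetric]] by simp
        \<comment> \<open>Both words end in i; with that letter dropped they are shorter and fall
          under the induction hypothesis. The same is done with j below.\<close>
        have "sw (ks @ c) = sw is'" using w1 i by (metis append_assoc comp_s_s sw_snoc)
        moreover have "asc (ks @ c)" using c(1) by (metis append_assoc asc_snoc)
        ultimately have R1: "R is' (ks @ c)" using less.hyps[of is' "ks @ c"] asc'(1) i by simp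
        have "sw (ks @ c') = sw js'" using w2 j by (metis append_assoc comp_s_s sw_snoc)
        moreover have "asc (ks @ c')" using c'(1) by (metis append_assoc asc_snoc)
        ultimately have R2: "R (ks @ c') js'" using less.hyps[of "ks @ c'" js'] asc'(2) l2 len by simp
        have "R (c @ [i]) (c' @ [j])" using dihedral[OF False] c c' by simp
        then have "R (ks @ c @ [i]) (ks @ c' @ [j])" by (rule cl)
        moreover have "R is (ks @ c @ [i])" using cr[OF R1, of "[i]"] i by simp
        moreover have "R (ks @ c' @ [j]) js" using cr[OF R2, of "[j]"] j by simp
        ultimately show ?thesis using trans by blast
      qed
    qed
  qed
  have reduce: "\<exists>js. asc js \<and> sw js = sw is \<and> R is js" for "is"
  proof (induction "is" rule: rev_induct)
    case Nil then show ?case using refl by (intro exI[of _ "[]"]) simp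
  next
    case (snoc i "is")
    then obtain js where js: "asc js" "sw js = sw is" "R is js" by blast
    show ?case
    proof (cases "sw js (\<alpha> i) \<in> Q_plus C")
      case True
      then show ?thesis using js cr
        by (intro exI[of _ "js @ [i]"]) (auto simp: asc_snoc sw_snoc)
    next
      case False
      then have neg: "- sw js (\<alpha> i) \<in> Q_plus C" using root_dichotomy[OF W_sw] by blast
      \<comment> \<open>Appending i to an ascending word \<open>ks\<close> for the shorter element
        ascends again. By uniqueness \<open>js\<close> can be rewritten to end in i, and the two
        letters i cancel.\<close>
      obtain ks where ks: "asc ks" "sw ks = sw (js @ [i])" using exists_asc by blast
      have "asc (ks @ [i])" using ks neg by (simp add: asc_snoc sw_snoc s_simple_root W_uminus[OF W_sw])
      moreover have "sw (ks @ [i]) = sw js" using ks(2) by (simp add: sw_snoc)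
      ultimately have "R js (ks @ [i])" using unique js(1) by metis
      then have "R (js @ [i]) (ks @ [i, i])" using cr[of js "ks @ [i]" "[i]"] by simp
      moreover have "R (ks @ [i, i]) ks" using cl[OF inv, of ks] by simp
      moreover have "R (is @ [i]) (js @ [i])" by (rule cr[OF js(3)])
      ultimately have "R (is @ [i]) ks" using trans by blast
      then show ?thesis using ks js(2) by (intro exI[of _ ks]) (simp add: sw_snoc)
    qed
  qed
  obtain a b where "asc a" "sw a = sw is" "R is a" "asc b" "sw b = sw js" "R js b"
    using reduce by metis
  then show ?thesis using unique[of a b] eq trans sym by metis
qed


subsection \<open>Rank two\<close>

lemma cartan_product_less_4: assumes "i \<noteq> j" shows "C $ i $ j * C $ j $ i < 4"
proof -
  \<comment> \<open>Twice the projection of \<alpha> i orthogonal to \<alpha> j; its norm is 2 d_i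
    (4 - C_ij C_ji).\<close>
  define z where "z = (\<lambda>l. 2 * unit_co i l - C $ j $ i * unit_co j l)"
  have "z i = 2" using assms by (simp add: z_def unit_co_def)
  then have "z \<noteq> (\<lambda>_. 0)" by auto
  from bil_pos[OF this] have "0 < 8 * int (d i) - 4 * (C $ j $ i * (int (d i) * C $ i $ j)) + 2 * (C $ j $ i * (int (d j) * C $ j $ i))"
    unfolding z_def bil_diff_left bil_diff_right bil_scale_left bil_scale_right bil_unit_left rt_unit
    by (simp add: d_sym[of i j])
  then have "0 < 2 * int (d i) * (4 - C $ i $ j * C $ j $ i)"
    unfolding d_sym[of j i] by (simp add: algebra_simps)
  then show ?thesis using d_pos[of i] by (simp add: zero_less_mult_iff)
qed

lemma cartan_pairs:
  assumes "i \<noteq> j"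
  shows "(C $ i $ j, C $ j $ i) \<in> {(0,0), (-1,-1), (-1,-2), (-2,-1), (-1,-3), (-3,-1)}"
proof -
  define a b where "a = - (C $ i $ j)" and "b = - (C $ j $ i)"
  have ab: "a \<ge> 0" "b \<ge> 0" "a * b < 4" "a = 0 \<longleftrightarrow> b = 0"
    using C_nonpos[of i j] C_nonpos[of j i] cartan_product_less_4[of i j] C_zero[of i j] C_zero[of j i] assms
    by (auto simp: a_def b_def)
  have "a * 1 \<le> a * b" "1 * b \<le> a * b" if "a \<noteq> 0"
    using that ab by (auto intro: mult_left_mono mult_right_mono)
  then have "a \<le> 3 \<and> b \<le> 3" using ab by (cases "a = 0") (simp, linarith)
  then have "a \<in> {0,1,2,3}" "b \<in> {0,1,2,3}" using ab(1,2) by auto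
  then have "(a, b) \<in> {(0,0), (1,1), (1,2), (2,1), (1,3), (3,1)}" using ab by auto
  then show ?thesis unfolding a_def b_def by auto
qed

text \<open>If a conjugate of \<alpha> i pairs nontrivially with coroot k but trivially with an
  adjacent coroot l, reflecting it in k makes the pairing with l nonzero. Indecomposability spreads
  this to every node.\<close>

lemma orbit_meets: "\<exists>is. sw is (\<alpha> i) $ j \<noteq> 0"
proof -
  define K where "K = {k. \<exists>is. sw is (\<alpha> i) $ k \<noteq> 0}"
  have "i \<in> K" unfolding K_def by (auto intro!: exI[of _ "[]"])
  moreover have "l \<in> K" if k: "k \<in> K" and "C $ k $ l \<noteq> 0" for k l
  proof -
    obtain js where js: "sw js (\<alpha> i) $ k \<noteq> 0" using k unfolding K_def by blast
    have "C $ l $ k \<noteq> 0" using C_zero that by blast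
    with js have "sw js (\<alpha> i) $ l \<noteq> 0 \<or> sw (k # js) (\<alpha> i) $ l \<noteq> 0" by (auto simp: sw_Cons s_nth)
    then show ?thesis unfolding K_def by blast
  qed
  ultimately have "K = UNIV" using indecomposable[of K] by blast
  then show ?thesis unfolding K_def by blast
qed

text \<open>Take a conjugate of \<alpha> i that is not orthogonal to \<alpha> j. Its two Cartan
  integers n and m against \<alpha> j satisfy d_j n = d_i m, and 0 < n m < 4 unless the two roots
  are proportional.\<close>

lemma d_ratio: assumes "d j \<le> d i" shows "d i \<in> {d j, 2 * d j, 3 * d j}"
proof -
  obtain js where js: "sw js (\<alpha> i) $ j \<noteq> 0" using orbit_meets by blast
  define n where "n = sw js (\<alpha> i) $ j"
  define k where "k = cw js (unit_co i)"
  have k: "root_co (d i) k" unfolding k_def by (intro root_co_cw root_co_unit)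
  have n: "bil (unit_co j) k = int (d j) * n" by (simp add: bil_unit_left k_def rt_cw n_def)
  \<comment> \<open>The coroot condition in \<open>root_co\<close> is what makes the second Cartan
    integer m an integer.\<close>
  have "int (d i) dvd bil k (unit_co j)"
  proof (unfold bil_alt, intro dvd_sum)
    fix l
    have "int (d i) dvd int (d l) * k l" using k unfolding root_co_def by (simp only: mult.commute)
    then show "int (d i) dvd int (d l) * k l * rt (unit_co j) $ l" by (rule dvd_mult2)
  qed
  then obtain m where m: "int (d j) * n = int (d i) * m" unfolding bil_sym[of k] n by (auto simp: dvd_def)
  \<comment> \<open>Again twice the component orthogonal to \<alpha> j, with norm 8 d_i - 2 n^2
    d_j.\<close>
  define z where "z = (\<lambda>l. 2 * k l - n * unit_co j l)"
  show ?thesis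
  proof (cases "z = (\<lambda>_. 0)")
    case True
    then have z0: "2 * k l = n * unit_co j l" for l unfolding z_def by (metis eq_iff_diff_eq_0)
    have "k l = k j * unit_co j l" for l using z0[of l] by (cases "l = j") (simp_all add: unit_co_def)
    then have "k = (\<lambda>l. k j * unit_co j l)" by blast
    with k have "root_co (d i) (\<lambda>l. k j * unit_co j l)" by simp
    from root_co_proportional(2)[OF this d_pos] show ?thesis by simp
  next
    case False
    have "bil k k = 2 * int (d i)" using k by (simp add: root_co_def)
    then have "bil z z = 8 * int (d i) - 2 * (n * (int (d j) * n))"
      unfolding z_def bil_diff_left bil_diff_right bil_scale_left bil_scale_right n
        bil_sym[of k "unit_co j"] by (simp add: bil_unit_left)
    with bil_pos[OF False] have "n * (int (d i) * m) < 4 * int (d i)" unfolding m by linarith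
    then have "int (d i) * (n * m) < int (d i) * 4" by (simp add: algebra_simps)
    then have nm: "n * m < 4" using d_pos[of i] by (simp add: mult_less_cancel_left_pos)
    define N M where "N = nat \<bar>n\<bar>" and "M = nat \<bar>m\<bar>"
    have n0: "n \<noteq> 0" using js by (simp add: n_def)
    have m0: "m \<noteq> 0" using m n0 d_pos[of j] by auto
    have "int (d j) * (n * n) = int (d i) * (n * m)" using m by (metis mult.assoc mult.commute)
    moreover have "int (d j) * (n * n) > 0" using d_pos[of j] n0 by (simp add: zero_less_mult_iff) linarith
    ultimately have "int (d i) * (n * m) > 0" by (simp only:)
    then have "n * m > 0" by (rule zero_less_mult_pos) (simp add: d_pos)
    then have "int N * int M = n * m" by (simp add: N_def M_def flip: abs_mult)
    then have NM: "N * M < 4" using nm by (metis of_nat_less_iff of_nat_mult of_nat_numeral)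
    have "\<bar>int (d j) * n\<bar> = \<bar>int (d i) * m\<bar>" using m by simp
    then have "int (d j * N) = int (d i * M)" by (simp add: abs_mult N_def M_def)
    then have dNM: "d j * N = d i * M" by (simp only: of_nat_eq_iff)
    have N0: "N > 0" "M > 0" using n0 m0 by (simp_all add: N_def M_def)
    show ?thesis
    proof (cases "M = 1")
      case True
      then have "N \<in> {1,2,3}" using NM N0 by auto
      then show ?thesis using dNM True by auto
    next
      case False
      then have "M \<ge> 2" using N0 by simp
      then have "N * 2 \<le> N * M" by simp
      then have "N = 1" using NM N0 by linarith
      then have "d i * 2 \<le> d j" using dNM \<open>M \<ge> 2\<close> by (metis mult.right_neutral mult_le_mono2)
      then show ?thesis using assms d_pos[of i] by simp
    qed
  qed
qed

text \<open>By \<open>d_ratio\<close> every d_i is a multiple of the smallest one, which the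
  condition on the common divisor forces to be 1.\<close>

lemma d_values: "d i \<in> {1, 2, 3}"
proof -
  define m where "m = Min (range d)"
  have m: "m \<in> range d" unfolding m_def by (intro Min_in) auto
  then obtain j where j: "m = d j" by auto
  have le: "m \<le> d i" for i unfolding m_def by simp
  have r: "d i \<in> {m, 2 * m, 3 * m}" for i using d_ratio[of j i] le[of i] j by simp
  then have "m dvd d i" for i by (metis dvd_refl dvd_triv_right insertE singletonD)
  then have "m dvd Gcd (range d)" by (auto intro: Gcd_greatest)
  then have "m = 1" using d_gcd by simp
  then show ?thesis using r[of i] by auto
qed

text \<open>\<open>Avar\<close> uses plain powers of q at a multiple bond. The bound on the d_i
  forces d_j = 1 at the short node, so these shifts are powers of q_j, and d_i is the bond
  multiplicity.\<close>

lemma d_short: assumes "i \<noteq> j" "C $ j $ i = - c" "c \<ge> 2" shows "d j = 1" "int (d i) = c" "C $ i $ j = -1"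
proof -
  show 1: "C $ i $ j = -1" using cartan_pairs[OF assms(1)] assms(2,3) by auto
  have "int (d i) * C $ i $ j = int (d j) * C $ j $ i" by (rule d_sym)
  then have 2: "int (d i) = int (d j) * c" using 1 assms(2) by simp
  show "d j = 1"
  proof (rule ccontr)
    assume "d j \<noteq> 1"
    then have "int (d j) \<ge> 2" using d_pos[of j] by simp
    then have "int (d j) * c \<ge> 2 * 2" using assms(3) by (intro mult_mono) auto
    then show False using 2 d_values[of i] by auto
  qed
  then show "int (d i) = c" using 2 by simp
qed

lemma d_equal: assumes "C $ i $ j = -1" "C $ j $ i = -1" shows "d i = d j"
  using d_sym[of i j] assms by simp

subsection \<open>The height functional\<close>

text \<open>Extends the height from the root lattice to all weights, where it may be fractional;
  hence the real values.\<close>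

definition height :: "int^'i \<Rightarrow> real" where
  "height = (SOME h. (\<forall>x y. h (x + y) = h x + h y) \<and> (\<forall>i. h (\<alpha> i) = 1))"

lemma height_exists: "\<exists>h :: int^'i \<Rightarrow> real. (\<forall>x y. h (x + y) = h x + h y) \<and> (\<forall>i. h (\<alpha> i) = 1)"
proof -
  obtain D :: "'i \<Rightarrow> real" where D: "\<And>i. D i > (0::real)"
    "\<And>i j. D i * of_int (C $ i $ j) = D j * of_int (C $ j $ i)"
    "\<And>x :: real^'i. x \<noteq> 0 \<Longrightarrow> (\<Sum>i\<in>UNIV. \<Sum>j\<in>UNIV. D i * of_int (C $ i $ j) * x $ i * x $ j) > 0"
    by (rule obtain_real_form) (rule that)
  define M :: "real^'i^'i" where "M = (\<chi> i j. of_int (C $ j $ i))"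
  have ker: "x = 0" if "M *v x = 0" for x
  proof (rule ccontr)
    assume x: "x \<noteq> 0"
    \<comment> \<open>Rescaling by \<open>D\<close> turns the transposed Cartan matrix into the
      symmetrized form, so a kernel vector would give an isotropic one.\<close>
    define y :: "real^'i" where "y = (\<chi> j. x $ j / D j)"
    have xy: "x $ j = D j * y $ j" for j using D(1)[of j] by (simp add: y_def)
    have "y \<noteq> 0" using x xy by (auto simp: vec_eq_iff)
    have "(\<Sum>j\<in>UNIV. D i * of_int (C $ i $ j) * y $ j) = 0" for i
    proof -
      have "(M *v x) $ i = (\<Sum>j\<in>UNIV. of_int (C $ j $ i) * (D j * y $ j))"
        by (simp add: matrix_vector_mult_def M_def xy)
      also have "\<dots> = (\<Sum>j\<in>UNIV. D i * of_int (C $ i $ j) * y $ j)"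
        by (intro sum.cong refl) (subst D(2), simp)
      finally show ?thesis using that by simp
    qed
    then have "(\<Sum>i\<in>UNIV. y $ i * (\<Sum>j\<in>UNIV. D i * of_int (C $ i $ j) * y $ j)) = 0" by simp
    then have "(\<Sum>i\<in>UNIV. \<Sum>j\<in>UNIV. D i * of_int (C $ i $ j) * y $ i * y $ j) = 0"
      by (simp add: sum_distrib_left mult_ac)
    then show False using D(3)[OF \<open>y \<noteq> 0\<close>] by simp
  qed
  have lin: "linear ((*v) M)" by simp
  have "inj ((*v) M)"
    unfolding linear_injective_0[OF lin] using ker by blast
  then have "surj ((*v) M)" using linear_injective_imp_surjective[OF lin] by blast
  then obtain x where x: "M *v x = (\<chi> i. 1)" by (metis surjD)
  define h where "h = (\<lambda>y :: int^'i. \<Sum>j\<in>UNIV. x $ j * of_int (y $ j))"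
  have "h (\<alpha> i) = 1" for i
    using arg_cong[OF x, of "\<lambda>v. v $ i"] by (simp add: h_def matrix_vector_mult_def M_def mult.commute)
  moreover have "h (y + z) = h y + h z" for y z by (simp add: h_def algebra_simps sum.distrib)
  ultimately show ?thesis by blast
qed

lemma height_add: "height (x + y) = height x + height y" and height_simple_root [simp]: "height (\<alpha> i) = 1"
  using someI_ex[OF height_exists] unfolding height_def by blast+

lemma height_0 [simp]: "height 0 = 0" using height_add[of 0 0] by simp
lemma height_uminus: "height (- x) = - height x" using height_add[of x "-x"] by simp
lemma height_diff: "height (x - y) = height x - height y" using height_add[of x "-y"] by (simp add: height_uminus)

lemma height_scale_nat: "height (int n *s x) = real n * height x"
  by (induction n) (simp_all add: height_add vector_sadd_rdistrib distrib_right)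

lemma height_rt: assumes "\<And>i. k i \<ge> 0" shows "height (rt k) = (\<Sum>i\<in>UNIV. of_int (k i))"
proof -
  have sum: "height (\<Sum>i\<in>S. f i) = (\<Sum>i\<in>S. height (f i))" if "finite S" for S :: "'i set" and f
    using that by (induction S rule: finite_induct) (simp_all add: height_add)
  have "height (k i *s \<alpha> i) = of_int (k i)" for i
    using height_scale_nat[of "nat (k i)" "\<alpha> i"] assms[of i] by simp
  then show ?thesis unfolding rt_def by (subst sum) simp_all
qed

lemma height_nonneg: "x \<in> Q_plus C \<Longrightarrow> height x \<ge> 0"
  unfolding Q_plus_iff by (auto simp: height_rt sum_nonneg)

lemma height_ge_1: assumes "x \<in> Q_plus C" "x \<noteq> 0" shows "height x \<ge> 1"
proof -
  obtain k where k: "\<And>i. k i \<ge> 0" "x = rt k" using assms(1) unfolding Q_plus_iff by auto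
  have "\<exists>i. k i \<noteq> 0"
  proof (rule ccontr)
    assume "\<not> ?thesis"
    then have "k = (\<lambda>_. 0)" by auto
    then show False using assms(2) k(2) rt_0 by simp
  qed
  then obtain i where "k i \<ge> 1" using k(1) by (metis int_one_le_iff_zero_less order_le_less)
  moreover have "k i \<le> (\<Sum>i\<in>UNIV. k i)" by (rule member_le_sum) (auto simp: k(1))
  ultimately have "(\<Sum>i\<in>UNIV. k i) \<ge> 1" by simp
  then have "real_of_int (\<Sum>i\<in>UNIV. k i) \<ge> 1" by linarith
  then show ?thesis by (simp add: k height_rt)
qed

lemma finite_Q_plus_bounded: "finite {x \<in> Q_plus C. height x \<le> c}"
proof (rule finite_subset)
  let ?F = "PiE UNIV (\<lambda>_ :: 'i. {0..\<lfloor>c\<rfloor>})"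
  show "finite (rt ` ?F)" by (intro finite_imageI finite_PiE) auto
  show "{x \<in> Q_plus C. height x \<le> c} \<subseteq> rt ` ?F"
  proof
    fix x assume "x \<in> {x \<in> Q_plus C. height x \<le> c}"
    then obtain k where k: "\<And>i. k i \<ge> 0" "x = rt k" "height x \<le> c" unfolding Q_plus_iff by auto
    have "k i \<le> \<lfloor>c\<rfloor>" for i
    proof -
      have "k i \<le> (\<Sum>i\<in>UNIV. k i)" by (rule member_le_sum) (auto simp: k(1))
      then have "real_of_int (k i) \<le> real_of_int (\<Sum>i\<in>UNIV. k i)" by (simp only: of_int_le_iff)
      also have "\<dots> \<le> c" using k by (simp add: height_rt)
      finally show ?thesis by linarith
    qed
    then have "k \<in> ?F" using k(1) by (simp add: PiE_def extensional_def)
    then show "x \<in> rt ` ?F" using k(2) by blast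
  qed
qed

end

section \<open>Convolution of series\<close>

text \<open>The product of two series in a single summation index. If infinitely many terms are
  nonzero, the sum is 0 by convention; \<open>conv_finite\<close> excludes this inside
  \<open>nov\<close>.\<close>

definition conv :: "('m::ab_group_add \<Rightarrow> int) \<Rightarrow> ('m \<Rightarrow> int) \<Rightarrow> 'm \<Rightarrow> int" where
  "conv f g n = (\<Sum>k | f k \<noteq> 0 \<and> g (n - k) \<noteq> 0. f k * g (n - k))"

lemma conv_eq_sum:
  assumes "finite S" "\<And>k. f k \<noteq> 0 \<Longrightarrow> g (n - k) \<noteq> 0 \<Longrightarrow> k \<in> S"
  shows "conv f g n = (\<Sum>k\<in>S. f k * g (n - k))"
  unfolding conv_def by (rule sum.mono_neutral_left) (use assms in auto)

lemma conv_comm: "conv f g = conv g f"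
proof
  fix n
  show "conv f g n = conv g f n" unfolding conv_def
    by (rule sum.reindex_bij_witness[of _ "\<lambda>k. n - k" "\<lambda>k. n - k"]) (auto simp: mult.commute)
qed

lemma conv_support: assumes "conv f g n \<noteq> 0" shows "\<exists>k. f k \<noteq> 0 \<and> g (n - k) \<noteq> 0"
proof (rule ccontr)
  assume "\<not> ?thesis"
  then have "{k. f k \<noteq> 0 \<and> g (n - k) \<noteq> 0} = {}" by blast
  then show False using assms unfolding conv_def by (simp only: sum.empty)
qed

lemma conv_eq_sum_right:
  assumes "finite S" "\<And>k. g k \<noteq> 0 \<Longrightarrow> f (n - k) \<noteq> 0 \<Longrightarrow> k \<in> S"
  shows "conv f g n = (\<Sum>k\<in>S. f (n - k) * g k)"
  unfolding conv_comm[of f] by (subst conv_eq_sum[OF assms]) (auto simp: mult.commute)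

lemma conv_mono_series: "conv (mono_series m) f n = f (n - m)"
  by (subst conv_eq_sum[of "{m}"]) (auto simp: mono_series_def split: if_splits)

lemma conv_mono_mono: "conv (mono_series m) (mono_series m') = mono_series (m + m')"
proof
  fix n
  show "conv (mono_series m) (mono_series m') n = mono_series (m + m') n"
    unfolding conv_mono_series by (auto simp: mono_series_def algebra_simps)
qed

text \<open>The elements of \<open>nov\<close> form a Novikov ring.\<close>

locale degree =
  fixes \<delta> :: "'m::ab_group_add \<Rightarrow> real"
  assumes \<delta>_add: "\<delta> (a + b) = \<delta> a + \<delta> b"
begin

lemma \<delta>_diff: "\<delta> (a - b) = \<delta> a - \<delta> b"
  using \<delta>_add[of "a - b" b] by simp

definition nov :: "('m \<Rightarrow> int) set" where
  "nov = {f. \<forall>c. finite {m. f m \<noteq> 0 \<and> \<delta> m \<ge> c}}"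

lemma novD: "f \<in> nov \<Longrightarrow> finite {m. f m \<noteq> 0 \<and> \<delta> m \<ge> c}"
  by (simp add: nov_def)

lemma nov_bounded: assumes "f \<in> nov" obtains B where "\<And>m. f m \<noteq> 0 \<Longrightarrow> \<delta> m \<le> B" "B \<ge> 0"
proof (rule that[of "Max (insert 0 (\<delta> ` {m. f m \<noteq> 0 \<and> \<delta> m \<ge> 0}))"])
  let ?B = "Max (insert 0 (\<delta> ` {m. f m \<noteq> 0 \<and> \<delta> m \<ge> 0}))"
  have fin: "finite (insert 0 (\<delta> ` {m. f m \<noteq> 0 \<and> \<delta> m \<ge> 0}))" using novD[OF assms, of 0] by simp
  show "?B \<ge> 0" using fin by (intro Max_ge) auto
  fix m assume "f m \<noteq> 0"
  show "\<delta> m \<le> ?B"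
  proof (cases "\<delta> m \<ge> 0")
    case True
    with \<open>f m \<noteq> 0\<close> fin show ?thesis by (intro Max_ge) auto
  qed (use \<open>?B \<ge> 0\<close> in linarith)
qed

lemma conv_finite: assumes "f \<in> nov" "g \<in> nov" shows "finite {k. f k \<noteq> 0 \<and> g (n - k) \<noteq> 0}"
proof -
  obtain B where B: "\<And>m. g m \<noteq> 0 \<Longrightarrow> \<delta> m \<le> B" using nov_bounded[OF assms(2)] by blast
  have "{k. f k \<noteq> 0 \<and> g (n - k) \<noteq> 0} \<subseteq> {k. f k \<noteq> 0 \<and> \<delta> k \<ge> \<delta> n - B}"
    using B by (force simp: \<delta>_diff)
  then show ?thesis by (rule finite_subset) (rule novD[OF assms(1)])
qed

lemma conv_nov: assumes "f \<in> nov" "g \<in> nov" shows "conv f g \<in> nov"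
  unfolding nov_def
proof (intro CollectI allI)
  fix c
  obtain A where A: "\<And>m. f m \<noteq> 0 \<Longrightarrow> \<delta> m \<le> A" using nov_bounded[OF assms(1)] by blast
  obtain B where B: "\<And>m. g m \<noteq> 0 \<Longrightarrow> \<delta> m \<le> B" using nov_bounded[OF assms(2)] by blast
  let ?F = "{k. f k \<noteq> 0 \<and> \<delta> k \<ge> c - B}" and ?G = "{k. g k \<noteq> 0 \<and> \<delta> k \<ge> c - A}"
  have "{n. conv f g n \<noteq> 0 \<and> \<delta> n \<ge> c} \<subseteq> (\<lambda>(k, l). k + l) ` (?F \<times> ?G)"
  proof
    fix n assume n: "n \<in> {n. conv f g n \<noteq> 0 \<and> \<delta> n \<ge> c}"
    then obtain k where k: "f k \<noteq> 0" "g (n - k) \<noteq> 0" using conv_support by blast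
    with n A[OF k(1)] B[OF k(2)] show "n \<in> (\<lambda>(k, l). k + l) ` (?F \<times> ?G)"
      by (intro image_eqI[of _ _ "(k, n - k)"]) (auto simp: \<delta>_diff)
  qed
  then show "finite {n. conv f g n \<noteq> 0 \<and> \<delta> n \<ge> c}"
    by (rule finite_subset) (intro finite_imageI finite_cartesian_product novD assms)
qed

lemma nov_add: assumes "f \<in> nov" "g \<in> nov" shows "(\<lambda>n. f n + g n) \<in> nov"
  unfolding nov_def
proof (intro CollectI allI)
  fix c
  have "{m. f m + g m \<noteq> 0 \<and> \<delta> m \<ge> c} \<subseteq> {m. f m \<noteq> 0 \<and> \<delta> m \<ge> c} \<union> {m. g m \<noteq> 0 \<and> \<delta> m \<ge> c}" by auto
  then show "finite {m. f m + g m \<noteq> 0 \<and> \<delta> m \<ge> c}"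
    by (rule finite_subset) (intro finite_UnI novD assms)
qed

lemma nov_uminus: "f \<in> nov \<Longrightarrow> (\<lambda>n. - f n) \<in> nov" by (simp add: nov_def)

lemma nov_finite_support: "finite {m. f m \<noteq> 0} \<Longrightarrow> f \<in> nov"
  unfolding nov_def by (auto elim: rev_finite_subset)

lemma conv_add_left:
  assumes "f \<in> nov" "f' \<in> nov" "g \<in> nov"
  shows "conv (\<lambda>n. f n + f' n) g = (\<lambda>n. conv f g n + conv f' g n)"
proof
  fix n
  let ?S = "{k. f k \<noteq> 0 \<and> g (n - k) \<noteq> 0} \<union> {k. f' k \<noteq> 0 \<and> g (n - k) \<noteq> 0}"
  have fin: "finite ?S" using conv_finite assms by simp
  have "conv (\<lambda>n. f n + f' n) g n = (\<Sum>k\<in>?S. (f k + f' k) * g (n - k))"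
    by (rule conv_eq_sum[OF fin]) auto
  also have "\<dots> = (\<Sum>k\<in>?S. f k * g (n - k)) + (\<Sum>k\<in>?S. f' k * g (n - k))"
    by (simp add: distrib_right sum.distrib)
  also have "\<dots> = conv f g n + conv f' g n"
    by (subst (1 2) conv_eq_sum[OF fin]) auto
  finally show "conv (\<lambda>n. f n + f' n) g n = conv f g n + conv f' g n" .
qed

lemma conv_uminus_left: "conv (\<lambda>n. - f n) g = (\<lambda>n. - conv f g n)"
  by (simp add: fun_eq_iff conv_def sum_negf)

lemma conv_add_right:
  "f \<in> nov \<Longrightarrow> g \<in> nov \<Longrightarrow> g' \<in> nov \<Longrightarrow> conv f (\<lambda>n. g n + g' n) = (\<lambda>n. conv f g n + conv f g' n)"
  unfolding conv_comm[of f] by (rule conv_add_left)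

lemma conv_diff_left:
  assumes "f \<in> nov" "f' \<in> nov" "g \<in> nov"
  shows "conv (\<lambda>n. f n - f' n) g = (\<lambda>n. conv f g n - conv f' g n)"
  using conv_add_left[OF assms(1) nov_uminus[OF assms(2)] assms(3)]
  by (simp add: conv_uminus_left)

lemma conv_assoc:
  assumes "f \<in> nov" "g \<in> nov" "h \<in> nov"
  shows "conv (conv f g) h = conv f (conv g h)"
proof
  fix p
  obtain A where A: "\<And>m. f m \<noteq> 0 \<Longrightarrow> \<delta> m \<le> A" using nov_bounded[OF assms(1)] by blast
  obtain B where B: "\<And>m. g m \<noteq> 0 \<Longrightarrow> \<delta> m \<le> B" using nov_bounded[OF assms(2)] by blast
  obtain D where D: "\<And>m. h m \<noteq> 0 \<Longrightarrow> \<delta> m \<le> D" using nov_bounded[OF assms(3)] by blast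
  \<comment> \<open>Finite sets holding every first and every third index that can contribute at
    \<open>p\<close>; both iterated convolutions become the same finite double sum.\<close>
  define F where "F = {k. f k \<noteq> 0 \<and> \<delta> k \<ge> \<delta> p - B - D}"
  define H where "H = {l. h l \<noteq> 0 \<and> \<delta> l \<ge> \<delta> p - A - B}"
  have fin: "finite F" "finite H" unfolding F_def H_def using novD assms by auto
  have inF: "k \<in> F" if "f k \<noteq> 0" "g r \<noteq> 0" "h l \<noteq> 0" "k + r + l = p" for k r l
    using that B[of r] D[of l] by (auto simp: F_def \<delta>_add simp flip: that(4))
  have inH: "l \<in> H" if "f k \<noteq> 0" "g r \<noteq> 0" "h l \<noteq> 0" "k + r + l = p" for k r l
    using that A[of k] B[of r] by (auto simp: H_def \<delta>_add simp flip: that(4))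
  have "conv (conv f g) h p = (\<Sum>l\<in>H. conv f g (p - l) * h l)"
  proof (rule conv_eq_sum_right[OF fin(2)])
    fix l assume "h l \<noteq> 0" "conv f g (p - l) \<noteq> 0"
    then obtain k where "f k \<noteq> 0" "g (p - l - k) \<noteq> 0" using conv_support by blast
    then show "l \<in> H" using \<open>h l \<noteq> 0\<close> by (intro inH[of k "p - l - k"]) auto
  qed
  also have "\<dots> = (\<Sum>l\<in>H. (\<Sum>k\<in>F. f k * g (p - l - k)) * h l)"
  proof (intro sum.cong refl)
    fix l assume "l \<in> H"
    then have "h l \<noteq> 0" by (simp add: H_def)
    then have "conv f g (p - l) = (\<Sum>k\<in>F. f k * g (p - l - k))"
      by (intro conv_eq_sum[OF fin(1)] inF[of _ "p - l - _" l]) auto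
    then show "conv f g (p - l) * h l = (\<Sum>k\<in>F. f k * g (p - l - k)) * h l" by simp
  qed
  also have "\<dots> = (\<Sum>k\<in>F. f k * (\<Sum>l\<in>H. g (p - k - l) * h l))"
    unfolding sum_distrib_left sum_distrib_right by (subst sum.swap) (simp add: mult.assoc diff_diff_add add.commute)
  also have "\<dots> = (\<Sum>k\<in>F. f k * conv g h (p - k))"
  proof (intro sum.cong refl)
    fix k assume "k \<in> F"
    then have "f k \<noteq> 0" by (simp add: F_def)
    then have "conv g h (p - k) = (\<Sum>l\<in>H. g (p - k - l) * h l)"
      by (intro conv_eq_sum_right[OF fin(2)] inH[of k "p - k - _"]) auto
    then show "f k * (\<Sum>l\<in>H. g (p - k - l) * h l) = f k * conv g h (p - k)" by simp
  qed
  also have "\<dots> = conv f (conv g h) p"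
  proof (rule conv_eq_sum[OF fin(1), symmetric])
    fix k assume "f k \<noteq> 0" "conv g h (p - k) \<noteq> 0"
    then obtain r where "g r \<noteq> 0" "h (p - k - r) \<noteq> 0" using conv_support by blast
    then show "k \<in> F" using \<open>f k \<noteq> 0\<close> by (intro inF[of k r "p - k - r"]) auto
  qed
  finally show "conv (conv f g) h p = conv f (conv g h) p" .
qed

end


section \<open>The completions\<close>

lemma monomials_iff: "m \<in> monomials \<longleftrightarrow> (\<forall>i. Poly_Mapping.lookup m (i, 0) = 0)"
  by (auto simp: monomials_def in_keys_iff)

lemma monomials_add: "m \<in> monomials \<Longrightarrow> n \<in> monomials \<Longrightarrow> m + n \<in> monomials"
  and monomials_diff: "m \<in> monomials \<Longrightarrow> n \<in> monomials \<Longrightarrow> m - n \<in> monomials"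
  and monomials_uminus: "m \<in> monomials \<Longrightarrow> - m \<in> monomials"
  and monomials_0: "0 \<in> monomials"
  by (simp_all add: monomials_iff lookup_add lookup_minus)

lemma monomials_sum: "(\<And>x. x \<in> S \<Longrightarrow> f x \<in> monomials) \<Longrightarrow> sum f S \<in> monomials"
  by (simp add: monomials_iff lookup_sum)

lemma monomials_Yvar: "a \<noteq> 0 \<Longrightarrow> Yvar i a \<in> monomials"
  by (simp add: monomials_iff Yvar_def lookup_single when_def)

lemma weight_eq_sum:
  assumes "finite S" "Poly_Mapping.keys m \<subseteq> S"
  shows "weight m = (\<Sum>p\<in>S. Poly_Mapping.lookup m p *s fund_weight (fst p))"
  unfolding weight_def
  by (rule sum.mono_neutral_cong_left) (use assms in \<open>auto simp: in_keys_iff split: prod.splits\<close>)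

lemma weight_add: "weight (m + n) = weight m + weight n"
proof -
  let ?S = "Poly_Mapping.keys m \<union> Poly_Mapping.keys n"
  have "weight (m + n) = (\<Sum>p\<in>?S. Poly_Mapping.lookup (m + n) p *s fund_weight (fst p))"
    by (rule weight_eq_sum) (auto dest: subsetD[OF Poly_Mapping.keys_add])
  also have "\<dots> = (\<Sum>p\<in>?S. Poly_Mapping.lookup m p *s fund_weight (fst p))
      + (\<Sum>p\<in>?S. Poly_Mapping.lookup n p *s fund_weight (fst p))"
    by (simp add: lookup_add vector_sadd_rdistrib sum.distrib)
  also have "\<dots> = weight m + weight n"
    by (subst (1 2) weight_eq_sum[of ?S]) auto
  finally show ?thesis .
qed

lemma weight_0 [simp]: "weight 0 = 0" by (simp add: weight_def)
lemma weight_uminus: "weight (- m) = - weight m"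
  using weight_add[of m "-m"] by (simp add: eq_neg_iff_add_eq_0 add.commute)
lemma weight_diff: "weight (m - n) = weight m - weight n"
  using weight_add[of m "-n"] by (simp add: weight_uminus)
lemma weight_sum: "weight (sum f S) = (\<Sum>x\<in>S. weight (f x))"
  by (induction S rule: infinite_finite_induct) (simp_all add: weight_add)
lemma weight_Yvar [simp]: "weight (Yvar i a) = fund_weight i"
  by (simp add: weight_def Yvar_def)

lemma mono_series_nonzero [simp]: "mono_series m n \<noteq> 0 \<longleftrightarrow> n = m"
  by (simp add: mono_series_def)

lemma completion_sel:
  "carrier (completion C w) = completion_carrier C w"
  "\<one>\<^bsub>completion C w\<^esub> = mono_series 0"
  "\<zero>\<^bsub>completion C w\<^esub> = (\<lambda>n. 0)"
  "f \<oplus>\<^bsub>completion C w\<^esub> g = (\<lambda>n. f n + g n)"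
  by (simp_all add: completion_def)

lemma completion_mult: "f \<otimes>\<^bsub>completion C w\<^esub> g = conv f g"
proof
  fix n
  let ?F = "\<lambda>p. f (fst p) * g (snd p) * mono_series (fst p + snd p) n"
  have "(f \<otimes>\<^bsub>completion C w\<^esub> g) n = (\<Sum>p | ?F p \<noteq> 0. ?F p)"
    by (simp add: completion_def formal_sum_def case_prod_beta)
  also have "\<dots> = conv f g n" unfolding conv_def
    by (rule sum.reindex_bij_witness[of _ "\<lambda>k. (k, n - k)" fst])
      (auto simp: mono_series_def split: if_splits)
  finally show "(f \<otimes>\<^bsub>completion C w\<^esub> g) n = conv f g n" .
qed

context cartan_datum
begin

abbreviation deg :: "(int^'i \<Rightarrow> int^'i) \<Rightarrow> 'i monomial \<Rightarrow> real" where
  "deg w m \<equiv> height (w (weight m))"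

lemma degree_deg: "w \<in> W \<Longrightarrow> degree (deg w)"
  by unfold_locales (simp add: weight_add W_add height_add)

definition bounded_weights :: "(int^'i \<Rightarrow> int^'i) \<Rightarrow> 'i series \<Rightarrow> bool" where
  "bounded_weights w f \<longleftrightarrow>
     (\<exists>\<Lambda>. finite \<Lambda> \<and> (\<forall>m. f m \<noteq> 0 \<longrightarrow> (\<exists>\<nu>\<in>\<Lambda>. \<nu> - w (weight m) \<in> Q_plus C)))"

lemma bounded_weightsE:
  assumes "bounded_weights w f"
  obtains \<Lambda> where "finite \<Lambda>" "\<And>m. f m \<noteq> 0 \<Longrightarrow> \<exists>\<nu>\<in>\<Lambda>. \<nu> - w (weight m) \<in> Q_plus C"
  using assms unfolding bounded_weights_def by (elim exE conjE) (rule that, auto)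

text \<open>Below finitely many weights only finitely many weights have height at least c, so
  finiteness over each single weight upgrades to finiteness above each degree. The completion
  thereby becomes a subset of the Novikov ring for the degree \<open>deg w\<close>.\<close>

lemma completion_carrier_iff:
  assumes w: "w \<in> W"
  shows "f \<in> completion_carrier C w \<longleftrightarrow>
    {m. f m \<noteq> 0} \<subseteq> monomials \<and> bounded_weights w f \<and> f \<in> degree.nov (deg w)"
proof -
  interpret degree "deg w" by (rule degree_deg[OF w])
  have 1: "(\<exists>\<beta>\<in>Q_plus C. x = \<nu> - \<beta>) \<longleftrightarrow> \<nu> - x \<in> Q_plus C" for x \<nu>
  proof
    assume "\<nu> - x \<in> Q_plus C"
    then show "\<exists>\<beta>\<in>Q_plus C. x = \<nu> - \<beta>" by (intro bexI[of _ "\<nu> - x"]) simp_all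
  qed auto
  have 2: "f \<in> nov \<longleftrightarrow> (\<forall>\<mu>. finite {m. f m \<noteq> 0 \<and> weight m = \<mu>})" if bw: "bounded_weights w f"
  proof
    assume f: "f \<in> nov"
    show "\<forall>\<mu>. finite {m. f m \<noteq> 0 \<and> weight m = \<mu>}"
    proof
      fix \<mu>
      show "finite {m. f m \<noteq> 0 \<and> weight m = \<mu>}"
        by (rule finite_subset[OF _ novD[OF f, of "height (w \<mu>)"]]) auto
    qed
  next
    assume fib: "\<forall>\<mu>. finite {m. f m \<noteq> 0 \<and> weight m = \<mu>}"
    obtain \<Lambda> where \<Lambda>: "finite \<Lambda>" "\<And>m. f m \<noteq> 0 \<Longrightarrow> \<exists>\<nu>\<in>\<Lambda>. \<nu> - w (weight m) \<in> Q_plus C"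
      by (rule bounded_weightsE[OF bw]) (rule that)
    show "f \<in> nov" unfolding nov_def
    proof (intro CollectI allI)
      fix c
      define M where "M = (\<Union>\<nu>\<in>\<Lambda>. (\<lambda>\<beta>. \<nu> - \<beta>) ` {\<beta> \<in> Q_plus C. height \<beta> \<le> height \<nu> - c})"
      have "finite M" unfolding M_def by (intro finite_UN_I finite_imageI finite_Q_plus_bounded \<Lambda>(1))
      then have "finite {\<mu>. w \<mu> \<in> M}" using finite_vimageI[OF _ W_inj[OF w], of M] by (simp add: vimage_def)
      then have "finite (\<Union>\<mu>\<in>{\<mu>. w \<mu> \<in> M}. {m. f m \<noteq> 0 \<and> weight m = \<mu>})" using fib by (intro finite_UN_I) auto
      moreover have "{m. f m \<noteq> 0 \<and> deg w m \<ge> c} \<subseteq> (\<Union>\<mu>\<in>{\<mu>. w \<mu> \<in> M}. {m. f m \<noteq> 0 \<and> weight m = \<mu>})"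
      proof
        fix m assume m: "m \<in> {m. f m \<noteq> 0 \<and> deg w m \<ge> c}"
        then obtain \<nu> where \<nu>: "\<nu> \<in> \<Lambda>" "\<nu> - w (weight m) \<in> Q_plus C" using \<Lambda>(2) by blast
        have "w (weight m) \<in> M" unfolding M_def
          using \<nu> m by (intro UN_I[of \<nu>] image_eqI[of _ _ "\<nu> - w (weight m)"]) (auto simp: height_diff)
        then show "m \<in> (\<Union>\<mu>\<in>{\<mu>. w \<mu> \<in> M}. {m. f m \<noteq> 0 \<and> weight m = \<mu>})" using m by simp
      qed
      ultimately show "finite {m. f m \<noteq> 0 \<and> deg w m \<ge> c}" by (rule rev_finite_subset)
    qed
  qed
  show ?thesis unfolding completion_carrier_def mem_Collect_eq 1
    unfolding bounded_weights_def[symmetric] using 2 by blast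
qed

section \<open>Weight bounds and the depth filtration\<close>

lemma bounded_weights_add: assumes "bounded_weights w f" "bounded_weights w g"
  shows "bounded_weights w (\<lambda>n. f n + g n)"
proof -
  obtain \<Lambda> where L1: "finite \<Lambda>" "\<And>m. f m \<noteq> 0 \<Longrightarrow> \<exists>\<nu>\<in>\<Lambda>. \<nu> - w (weight m) \<in> Q_plus C"
    by (rule bounded_weightsE[OF assms(1)]) (rule that)
  obtain M where L2: "finite M" "\<And>m. g m \<noteq> 0 \<Longrightarrow> \<exists>\<nu>\<in>M. \<nu> - w (weight m) \<in> Q_plus C"
    by (rule bounded_weightsE[OF assms(2)]) (rule that)
  show ?thesis unfolding bounded_weights_def
  proof (intro exI[of _ "\<Lambda> \<union> M"] conjI allI impI)
    fix m assume "f m + g m \<noteq> 0"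
    then consider "f m \<noteq> 0" | "g m \<noteq> 0" by fastforce
    then show "\<exists>\<nu>\<in>\<Lambda> \<union> M. \<nu> - w (weight m) \<in> Q_plus C" using L1(2) L2(2) by cases blast+
  qed (use L1 L2 in simp)
qed

lemma bounded_weights_conv: assumes "w \<in> W" "bounded_weights w f" "bounded_weights w g"
  shows "bounded_weights w (conv f g)"
proof -
  obtain \<Lambda> where L1: "finite \<Lambda>" "\<And>m. f m \<noteq> 0 \<Longrightarrow> \<exists>\<nu>\<in>\<Lambda>. \<nu> - w (weight m) \<in> Q_plus C"
    by (rule bounded_weightsE[OF assms(2)]) (rule that)
  obtain M where L2: "finite M" "\<And>m. g m \<noteq> 0 \<Longrightarrow> \<exists>\<nu>\<in>M. \<nu> - w (weight m) \<in> Q_plus C"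
    by (rule bounded_weightsE[OF assms(3)]) (rule that)
  note L = L1 L2
  show ?thesis unfolding bounded_weights_def
  proof (intro exI[of _ "(\<lambda>(x, y). x + y) ` (\<Lambda> \<times> M)"] conjI allI impI)
    show "finite ((\<lambda>(x, y). x + y) ` (\<Lambda> \<times> M))" using L by simp
    fix n assume "conv f g n \<noteq> 0"
    then obtain k where "f k \<noteq> 0" "g (n - k) \<noteq> 0" using conv_support by blast
    then obtain \<nu> \<mu> where \<nu>: "\<nu> \<in> \<Lambda>" "\<nu> - w (weight k) \<in> Q_plus C"
      and \<mu>: "\<mu> \<in> M" "\<mu> - w (weight (n - k)) \<in> Q_plus C"
      using L(2)[of k] L(4)[of "n - k"] by blast
    have eq: "(\<nu> + \<mu>) - w (weight n) = (\<nu> - w (weight k)) + (\<mu> - w (weight (n - k)))"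
      by (simp add: weight_diff W_diff[OF assms(1)])
    have "(\<nu> + \<mu>) - w (weight n) \<in> Q_plus C" unfolding eq by (rule Q_plus_add[OF \<nu>(2) \<mu>(2)])
    moreover have "\<nu> + \<mu> \<in> (\<lambda>(x, y). x + y) ` (\<Lambda> \<times> M)" using \<nu>(1) \<mu>(1) by force
    ultimately show "\<exists>\<nu>\<in>(\<lambda>(x, y). x + y) ` (\<Lambda> \<times> M). \<nu> - w (weight n) \<in> Q_plus C" by blast
  qed
qed

text \<open>The filtration of the proof. Membership in the cone below \<nu> yields
  \<open>bounded_weights\<close>; the number n measures depth in the cone and records the order of
  an error term.\<close>

definition lower :: "(int^'i \<Rightarrow> int^'i) \<Rightarrow> real \<Rightarrow> int^'i \<Rightarrow> 'i series set" where
  "lower w n \<nu> = {f. \<forall>p. f p \<noteq> 0 \<longrightarrow> \<nu> - w (weight p) \<in> Q_plus C \<and> n \<le> height (\<nu> - w (weight p))}"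

lemma lower_add: "f \<in> lower w n \<nu> \<Longrightarrow> g \<in> lower w n \<nu> \<Longrightarrow> (\<lambda>n. f n + g n) \<in> lower w n \<nu>"
  unfolding lower_def by force

lemma lower_uminus: "f \<in> lower w n \<nu> \<Longrightarrow> (\<lambda>n. - f n) \<in> lower w n \<nu>"
  by (simp add: lower_def)

lemma lower_zero: "(\<lambda>_. 0) \<in> lower w n \<nu>" by (simp add: lower_def)

lemma lower_mono: "f \<in> lower w n \<nu> \<Longrightarrow> n' \<le> n \<Longrightarrow> f \<in> lower w n' \<nu>"
  by (auto simp: lower_def)

lemma lower_trans: assumes "f \<in> lower w n \<nu>" "\<mu> - \<nu> \<in> Q_plus C" "n' = n + height (\<mu> - \<nu>)"
  shows "f \<in> lower w n' \<mu>"
  unfolding lower_def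
proof (intro CollectI allI impI)
  fix p assume "f p \<noteq> 0"
  then have "\<nu> - w (weight p) \<in> Q_plus C" "n \<le> height (\<nu> - w (weight p))" using assms(1) by (auto simp: lower_def)
  then show "\<mu> - w (weight p) \<in> Q_plus C \<and> n' \<le> height (\<mu> - w (weight p))"
    using Q_plus_add[OF assms(2), of "\<nu> - w (weight p)"] assms(3) by (simp add: height_diff)
qed

lemma lower_conv:
  assumes "w \<in> W" "f \<in> lower w n \<nu>" "g \<in> lower w n' \<nu>'" shows "conv f g \<in> lower w (n + n') (\<nu> + \<nu>')"
  unfolding lower_def
proof (intro CollectI allI impI)
  fix p assume "conv f g p \<noteq> 0"
  then obtain k where k: "f k \<noteq> 0" "g (p - k) \<noteq> 0" using conv_support by blast
  have eq: "(\<nu> + \<nu>') - w (weight p) = (\<nu> - w (weight k)) + (\<nu>' - w (weight (p - k)))"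
    by (simp add: weight_diff W_diff[OF assms(1)])
  show "\<nu> + \<nu>' - w (weight p) \<in> Q_plus C \<and> n + n' \<le> height (\<nu> + \<nu>' - w (weight p))"
    unfolding eq height_add using k assms(2,3) by (force simp: lower_def intro: Q_plus_add)
qed

lemma lower_mono_series: "mono_series m \<in> lower w 0 (w (weight m))"
  by (auto simp: lower_def)

lemma lower_bounded_weights: "f \<in> lower w n \<nu> \<Longrightarrow> bounded_weights w f"
  unfolding lower_def bounded_weights_def by (intro exI[of _ "{\<nu>}"]) auto

section \<open>The ring structure of one completion, and its units with a leading weight\<close>

context
  fixes w assumes w: "w \<in> W"
begin

interpretation degree "deg w" by (rule degree_deg[OF w])

lemma completion_monomials: "f \<in> completion_carrier C w \<Longrightarrow> f m \<noteq> 0 \<Longrightarrow> m \<in> monomials"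
  unfolding completion_carrier_iff[OF w] by auto

lemma completion_nov: "f \<in> completion_carrier C w \<Longrightarrow> f \<in> nov"
  unfolding completion_carrier_iff[OF w] by auto

lemma completion_conv: assumes "f \<in> completion_carrier C w" "g \<in> completion_carrier C w"
  shows "conv f g \<in> completion_carrier C w"
  unfolding completion_carrier_iff[OF w]
proof (intro conjI)
  show "{m. conv f g m \<noteq> 0} \<subseteq> monomials"
  proof
    fix m assume "m \<in> {m. conv f g m \<noteq> 0}"
    then obtain k where "f k \<noteq> 0" "g (m - k) \<noteq> 0" using conv_support by blast
    then show "m \<in> monomials"
      using monomials_add[of k "m - k"] completion_monomials assms by force
  qed
qed (use assms in \<open>auto simp: completion_carrier_iff[OF w] intro: bounded_weights_conv[OF w] conv_nov\<close>)

lemma completion_add: assumes "f \<in> completion_carrier C w" "g \<in> completion_carrier C w"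
  shows "(\<lambda>n. f n + g n) \<in> completion_carrier C w"
  unfolding completion_carrier_iff[OF w]
proof (intro conjI)
  show "{m. f m + g m \<noteq> 0} \<subseteq> monomials"
  proof
    fix m assume "m \<in> {m. f m + g m \<noteq> 0}"
    then consider "f m \<noteq> 0" | "g m \<noteq> 0" by fastforce
    then show "m \<in> monomials" using completion_monomials assms by cases blast+
  qed
qed (use assms in \<open>auto simp: completion_carrier_iff[OF w] intro: bounded_weights_add nov_add\<close>)

lemma completion_uminus: assumes "f \<in> completion_carrier C w"
  shows "(\<lambda>n. - f n) \<in> completion_carrier C w"
  using assms unfolding completion_carrier_iff[OF w]
  by (auto simp: bounded_weights_def intro: nov_uminus)

lemma completion_diff: assumes "f \<in> completion_carrier C w" "g \<in> completion_carrier C w"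
  shows "(\<lambda>n. f n - g n) \<in> completion_carrier C w"
  using completion_add[OF assms(1) completion_uminus[OF assms(2)]] by simp

lemma completion_finite_support:
  assumes "finite {m. f m \<noteq> 0}" "\<And>m. f m \<noteq> 0 \<Longrightarrow> m \<in> monomials" shows "f \<in> completion_carrier C w"
  unfolding completion_carrier_iff[OF w]
proof (intro conjI)
  show "bounded_weights w f" unfolding bounded_weights_def
    by (intro exI[of _ "(\<lambda>m. w (weight m)) ` {m. f m \<noteq> 0}"]) (use assms(1) in force)
qed (use assms nov_finite_support in auto)

lemma completion_mono: "m \<in> monomials \<Longrightarrow> mono_series m \<in> completion_carrier C w"
  by (rule completion_finite_support) auto

lemma completion_zero: "(\<lambda>_. 0) \<in> completion_carrier C w"
  by (rule completion_finite_support) auto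

lemma cring_completion: "cring (completion C w)"
proof (rule cringI)
  show "abelian_group (completion C w)"
    by (rule abelian_groupI)
      (auto simp: completion_sel completion_add completion_zero algebra_simps
        intro!: bexI[of _ "\<lambda>n. - _ n"] completion_uminus)
  show "comm_monoid (completion C w)"
  proof (rule comm_monoidI; unfold completion_mult completion_sel)
    show "conv (mono_series 0) f = f" for f by (auto simp: conv_mono_series)
  qed (auto simp: completion_conv completion_mono monomials_0 conv_assoc completion_nov intro: conv_comm[THEN fun_cong])
qed (auto simp: completion_sel completion_mult conv_add_left completion_nov)

interpretation R: cring "completion C w" by (rule cring_completion)

text \<open>Units that behave like a monomial of weight \<nu>: the bound on the inverse as well
  makes the notion multiplicative for all integer exponents, so values on the variables determine
  the bound on every monomial.\<close>

definition unit_below :: "int^'i \<Rightarrow> 'i series set" where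
  "unit_below \<nu> = {f \<in> Units (completion C w). f \<in> lower w 0 \<nu> \<and> inv\<^bsub>completion C w\<^esub> f \<in> lower w 0 (- \<nu>)}"

lemma unit_belowI:
  assumes "f \<in> completion_carrier C w" "g \<in> completion_carrier C w" "conv f g = mono_series 0"
    "f \<in> lower w 0 \<nu>" "g \<in> lower w 0 (- \<nu>)"
  shows "f \<in> unit_below \<nu>"
proof -
  have "inv\<^bsub>completion C w\<^esub> f = g"
    by (rule R.comm_inv_char) (use assms in \<open>auto simp: completion_sel completion_mult\<close>)
  moreover have "f \<in> Units (completion C w)"
    unfolding Units_def using assms
    by (auto simp: completion_sel completion_mult conv_comm[of g f] intro!: bexI[of _ g])
  ultimately show ?thesis using assms by (simp add: unit_below_def)
qed

lemma unit_below_mult: assumes "f \<in> unit_below \<nu>" "g \<in> unit_below \<mu>" shows "conv f g \<in> unit_below (\<nu> + \<mu>)"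
proof -
  have u: "f \<in> Units (completion C w)" "g \<in> Units (completion C w)" using assms by (auto simp: unit_below_def)
  have "inv\<^bsub>completion C w\<^esub> (f \<otimes>\<^bsub>completion C w\<^esub> g) = inv\<^bsub>completion C w\<^esub> f \<otimes>\<^bsub>completion C w\<^esub> inv\<^bsub>completion C w\<^esub> g"
  proof (rule R.comm_inv_char)
    let ?i = "m_inv (completion C w)" and ?m = "monoid.mult (completion C w)"
    note cl = R.Units_closed[OF u(1)] R.Units_closed[OF u(2)] R.Units_inv_closed[OF u(1)] R.Units_inv_closed[OF u(2)]
    have "?m (?m f g) (?m (?i f) (?i g)) = ?m (?m f (?i f)) (?m g (?i g))"
      using cl by (simp add: R.m_ac)
    then show "?m (?m f g) (?m (?i f) (?i g)) = \<one>\<^bsub>completion C w\<^esub>" using u by simp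
  qed (use u R.Units_closed in simp_all)
  moreover have "f \<otimes>\<^bsub>completion C w\<^esub> g \<in> Units (completion C w)" using u by simp
  ultimately show ?thesis
    using lower_conv[OF w, of f 0 \<nu> g 0 \<mu>] lower_conv[OF w, of "inv\<^bsub>completion C w\<^esub> f" 0 "-\<nu>" "inv\<^bsub>completion C w\<^esub> g" 0 "-\<mu>"] assms
    by (simp add: unit_below_def completion_mult)
qed

lemma unit_below_inv: "f \<in> unit_below \<nu> \<Longrightarrow> inv\<^bsub>completion C w\<^esub> f \<in> unit_below (- \<nu>)"
  by (simp add: unit_below_def)

lemma unit_below_mono: "m \<in> monomials \<Longrightarrow> mono_series m \<in> unit_below (w (weight m))"
  using lower_mono_series[of m w] lower_mono_series[of "- m" w]
  by (intro unit_belowI[of _ "mono_series (- m)"])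
    (auto simp: completion_mono monomials_uminus conv_mono_mono weight_uminus W_uminus[OF w])

lemma unit_below_one: "mono_series 0 \<in> unit_below 0"
  using unit_below_mono[OF monomials_0] by (simp add: W_0[OF w])

lemma unit_below_uminus: assumes "f \<in> unit_below \<nu>" shows "(\<lambda>n. - f n) \<in> unit_below \<nu>"
proof (rule unit_belowI)
  let ?g = "inv\<^bsub>completion C w\<^esub> f"
  have f: "f \<in> Units (completion C w)" "f \<in> lower w 0 \<nu>" "?g \<in> lower w 0 (- \<nu>)" using assms by (auto simp: unit_below_def)
  then show "(\<lambda>n. - f n) \<in> lower w 0 \<nu>" "(\<lambda>n. - ?g n) \<in> lower w 0 (- \<nu>)" by (auto intro: lower_uminus)
  have c: "f \<in> completion_carrier C w" "?g \<in> completion_carrier C w"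
    using f(1) R.Units_closed R.Units_inv_closed by (auto simp: completion_sel)
  then show "(\<lambda>n. - f n) \<in> completion_carrier C w" "(\<lambda>n. - ?g n) \<in> completion_carrier C w"
    by (auto intro: completion_uminus)
  have "conv f ?g = mono_series 0" using R.Units_r_inv[OF f(1)] by (simp add: completion_mult completion_sel)
  then show "conv (\<lambda>n. - f n) (\<lambda>n. - ?g n) = mono_series 0"
    by (simp add: conv_uminus_left conv_comm[of f "\<lambda>n. - ?g n"] conv_comm[of ?g])
qed

text \<open>The inverse of \<open>1 - x\<close> is the geometric series; at a monomial of degree \<open>\<delta>\<close> only the
  powers of \<open>x\<close> with exponent at most \<open>- \<delta>\<close> contribute.\<close>

lemma unit_below_geometric:
  assumes x: "x \<in> completion_carrier C w" "x \<in> lower w 1 0"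
  shows "(\<lambda>n. mono_series 0 n - x n) \<in> unit_below 0"
proof -
  define P where "P = (\<lambda>k::nat. (conv x ^^ k) (mono_series 0))"
  have P0: "P 0 = mono_series 0" and PS: "P (Suc k) = conv x (P k)" for k by (simp_all add: P_def)
  have Pc: "P k \<in> completion_carrier C w" for k
    by (induction k) (auto simp: P0 PS completion_mono monomials_0 intro: completion_conv x)
  have Pl: "P k \<in> lower w (real k) 0" for k
  proof (induction k)
    case 0 show ?case using lower_mono_series[of 0 w] by (simp add: P0 W_0[OF w])
  next
    case (Suc k) show ?case using lower_conv[OF w x(2) Suc] by (simp add: PS add.commute)
  qed
  define S where "S = (\<lambda>K n. \<Sum>k\<le>K. P k n)"
  have SS: "S (Suc K) = (\<lambda>n. S K n + P (Suc K) n)" for K by (simp add: S_def)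
  have S0: "S 0 = P 0" by (simp add: S_def)
  have Sc: "S K \<in> completion_carrier C w" for K
    by (induction K) (auto simp: S0 SS Pc intro: completion_add)
  let ?y = "\<lambda>n. mono_series 0 n - x n"
  have yc: "?y \<in> completion_carrier C w" using completion_diff[OF completion_mono[OF monomials_0] x(1)] .
  have yP: "conv ?y (P k) = (\<lambda>n. P k n - P (Suc k) n)" for k
    using conv_diff_left[OF completion_nov[OF completion_mono[OF monomials_0]] completion_nov[OF x(1)] completion_nov[OF Pc[of k]]]
    by (simp add: PS conv_mono_series)
  have yS: "conv ?y (S K) = (\<lambda>n. mono_series 0 n - P (Suc K) n)" for K
  proof (induction K)
    case 0 show ?case using yP[of 0] by (simp add: S0 P0)
  next
    case (Suc K)
    have "conv ?y (S (Suc K)) = (\<lambda>n. conv ?y (S K) n + conv ?y (P (Suc K)) n)"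
      unfolding SS by (rule conv_add_right) (auto intro: completion_nov yc Sc Pc)
    then show ?case unfolding Suc yP by simp
  qed
  have Pdeg: "deg w p \<le> - real k" if "P k p \<noteq> 0" for k p
    using that Pl[of k] by (auto simp: lower_def height_uminus)
  define g where "g = (\<lambda>p. S (nat \<lceil>- deg w p\<rceil>) p)"
  have gS: "g p = S K p" if "real K \<ge> - deg w p" for K p
  proof -
    have 1: "P k p = 0" if "k > nat \<lceil>- deg w p\<rceil>" for k using Pdeg[of k p] that by linarith
    have 2: "nat \<lceil>- deg w p\<rceil> \<le> K" using that by linarith
    show ?thesis unfolding g_def S_def by (rule sum.mono_neutral_left) (use 1 2 in auto)
  qed
  have gP: "\<exists>k. P k p \<noteq> 0" if "g p \<noteq> 0" for p
  proof (rule ccontr)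
    assume "\<not> ?thesis"
    then have "g p = 0" unfolding g_def S_def by simp
    with that show False by simp
  qed
  have gl: "g \<in> lower w 0 0" using gP Pl unfolding lower_def by (force simp: height_nonneg)
  have gnov: "g \<in> nov" unfolding nov_def
  proof (intro CollectI allI)
    fix c
    have "{m. g m \<noteq> 0 \<and> deg w m \<ge> c} \<subseteq> {m. S (nat \<lceil>- c\<rceil>) m \<noteq> 0 \<and> deg w m \<ge> c}"
    proof
      fix m assume m: "m \<in> {m. g m \<noteq> 0 \<and> deg w m \<ge> c}"
      then have "real (nat \<lceil>- c\<rceil>) \<ge> - deg w m" by simp linarith
      from gS[OF this] m show "m \<in> {m. S (nat \<lceil>- c\<rceil>) m \<noteq> 0 \<and> deg w m \<ge> c}" by simp
    qed
    then show "finite {m. g m \<noteq> 0 \<and> deg w m \<ge> c}" by (rule finite_subset) (rule novD[OF completion_nov[OF Sc]])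
  qed
  have gc: "g \<in> completion_carrier C w" unfolding completion_carrier_iff[OF w]
    using gP gnov lower_bounded_weights[OF gl] completion_monomials[OF Pc] by blast
  have "conv ?y g p = mono_series 0 p" for p
  proof -
    define K where "K = nat \<lceil>- deg w p\<rceil>"
    have K: "real K \<ge> - deg w p" unfolding K_def by linarith
    have ydeg: "deg w k \<le> 0" if "?y k \<noteq> 0" for k
    proof (cases "k = 0")
      case False
      then have "x k \<noteq> 0" using that by (simp add: mono_series_def)
      then show ?thesis using x(2) by (force simp: lower_def height_uminus)
    qed (simp add: W_0[OF w])
    \<comment> \<open>\<open>?y\<close> has only monomials of nonpositive degree, so the coefficient
      at \<open>p\<close> reads \<open>g\<close> in degrees at least that of \<open>p\<close>, where
      one partial sum serves for all.\<close>
    have eq: "g (p - k) = S K (p - k)" if "?y k \<noteq> 0" for k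
      by (rule gS) (use K ydeg[OF that] in \<open>simp add: \<delta>_diff\<close>)
    have "conv ?y g p = conv ?y (S K) p" unfolding conv_def
      by (rule sum.cong) (use eq in force)+
    also have "\<dots> = mono_series 0 p - P (Suc K) p" unfolding yS ..
    also have "P (Suc K) p = 0" using Pdeg[of "Suc K" p] K by fastforce
    finally show ?thesis by simp
  qed
  then have "conv ?y g = mono_series 0" by blast
  moreover have "?y \<in> lower w 0 0"
    using lower_add[OF lower_mono_series[of 0 w, unfolded weight_0 W_0[OF w]] lower_uminus[OF lower_mono[OF x(2), of 0]]] by simp
  ultimately show ?thesis using yc gc gl by (intro unit_belowI[of _ g]) auto
qed

end

end

section \<open>Extending maps from monomials to series\<close>

definition linear_ext :: "('i monomial \<Rightarrow> 'i series) \<Rightarrow> 'i series \<Rightarrow> 'i series" where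
  "linear_ext M f = formal_sum UNIV (\<lambda>m n. f m * M m n)"

lemma linear_ext_eq_sum:
  assumes "finite S" "\<And>m. f m \<noteq> 0 \<Longrightarrow> M m n \<noteq> 0 \<Longrightarrow> m \<in> S"
  shows "linear_ext M f n = (\<Sum>m\<in>S. f m * M m n)"
  unfolding linear_ext_def formal_sum_def by (rule sum.mono_neutral_left) (use assms in auto)

lemma linear_ext_support: assumes "linear_ext M f n \<noteq> 0" shows "\<exists>m. f m \<noteq> 0 \<and> M m n \<noteq> 0"
proof (rule ccontr)
  assume "\<not> ?thesis"
  then have "linear_ext M f n = (\<Sum>m\<in>{}. f m * M m n)" by (intro linear_ext_eq_sum) auto
  with assms show False by simp
qed

lemma linear_ext_mono: "linear_ext M (mono_series m) = M m"
  by (rule ext, subst linear_ext_eq_sum[of "{m}"]) (auto simp: mono_series_def split: if_splits)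

context cartan_datum
begin

context
  fixes w v and M :: "'i monomial \<Rightarrow> 'i series"
  assumes wW: "w \<in> W" and vW: "v \<in> W"
    and M_carrier: "\<And>m. m \<in> monomials \<Longrightarrow> M m \<in> completion_carrier C v"
    and M_lower: "\<And>m. m \<in> monomials \<Longrightarrow> M m \<in> lower v 0 (w (weight m))"
    and M_add: "\<And>m n. m \<in> monomials \<Longrightarrow> n \<in> monomials \<Longrightarrow> M (m + n) = conv (M m) (M n)"
begin

interpretation w: degree "deg w" by (rule degree_deg[OF wW])
interpretation v: degree "deg v" by (rule degree_deg[OF vW])

lemma M_below: "m \<in> monomials \<Longrightarrow> M m n \<noteq> 0 \<Longrightarrow> w (weight m) - v (weight n) \<in> Q_plus C"
  using M_lower[of m] by (simp add: lower_def)

lemma M_deg: "m \<in> monomials \<Longrightarrow> M m n \<noteq> 0 \<Longrightarrow> deg v n \<le> deg w m"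
  using height_nonneg[OF M_below] by (simp add: height_diff)

lemma linear_ext_below:
  assumes "f \<in> completion_carrier C w" "linear_ext M f n \<noteq> 0"
  shows "\<exists>m. f m \<noteq> 0 \<and> w (weight m) - v (weight n) \<in> Q_plus C"
  using linear_ext_support[OF assms(2)] M_below completion_monomials[OF wW assms(1)] by blast

text \<open>\<open>M m\<close> lies below w(weight m), so a lower bound on the target degree leaves
  finitely many m, each contributing finitely many monomials. The weights bounding \<open>f\<close>
  bound its image too.\<close>

lemma linear_ext_carrier: assumes f: "f \<in> completion_carrier C w" shows "linear_ext M f \<in> completion_carrier C v"
  unfolding completion_carrier_iff[OF vW]
proof (intro conjI)
  show "{n. linear_ext M f n \<noteq> 0} \<subseteq> monomials"
    using linear_ext_support M_carrier completion_monomials[OF wW f] completion_monomials[OF vW] by blast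
  have "bounded_weights w f" using f unfolding completion_carrier_iff[OF wW] by simp
  then obtain \<Lambda> where \<Lambda>: "finite \<Lambda>" "\<And>m. f m \<noteq> 0 \<Longrightarrow> \<exists>\<nu>\<in>\<Lambda>. \<nu> - w (weight m) \<in> Q_plus C"
    by (rule bounded_weightsE) (rule that)
  show "bounded_weights v (linear_ext M f)" unfolding bounded_weights_def
  proof (intro exI[of _ \<Lambda>] conjI allI impI \<Lambda>(1))
    fix n assume "linear_ext M f n \<noteq> 0"
    from linear_ext_below[OF f this] obtain m where m: "f m \<noteq> 0" "w (weight m) - v (weight n) \<in> Q_plus C" by blast
    from \<Lambda>(2)[OF m(1)] obtain \<nu> where \<nu>: "\<nu> \<in> \<Lambda>" "\<nu> - w (weight m) \<in> Q_plus C" by blast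
    have "\<nu> - v (weight n) \<in> Q_plus C" using Q_plus_add[OF \<nu>(2) m(2)] by simp
    with \<nu>(1) show "\<exists>\<nu>\<in>\<Lambda>. \<nu> - v (weight n) \<in> Q_plus C" by blast
  qed
  show "linear_ext M f \<in> v.nov" unfolding v.nov_def
  proof (intro CollectI allI)
    fix c
    have "{n. linear_ext M f n \<noteq> 0 \<and> deg v n \<ge> c}
      \<subseteq> (\<Union>m\<in>{m. f m \<noteq> 0 \<and> deg w m \<ge> c}. {n. M m n \<noteq> 0 \<and> deg v n \<ge> c})"
    proof
      fix n assume n: "n \<in> {n. linear_ext M f n \<noteq> 0 \<and> deg v n \<ge> c}"
      then obtain m where m: "f m \<noteq> 0" "M m n \<noteq> 0" using linear_ext_support by blast
      have "deg v n \<le> deg w m" using M_deg[OF completion_monomials[OF wW f m(1)] m(2)] .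
      with n m show "n \<in> (\<Union>m\<in>{m. f m \<noteq> 0 \<and> deg w m \<ge> c}. {n. M m n \<noteq> 0 \<and> deg v n \<ge> c})" by force
    qed
    moreover have "finite (\<Union>m\<in>{m. f m \<noteq> 0 \<and> deg w m \<ge> c}. {n. M m n \<noteq> 0 \<and> deg v n \<ge> c})"
    proof (intro finite_UN_I)
      show "finite {m. f m \<noteq> 0 \<and> deg w m \<ge> c}" by (rule w.novD[OF completion_nov[OF wW f]])
      fix m assume "m \<in> {m. f m \<noteq> 0 \<and> deg w m \<ge> c}"
      then have "m \<in> monomials" using completion_monomials[OF wW f] by simp
      then show "finite {n. M m n \<noteq> 0 \<and> deg v n \<ge> c}" by (rule v.novD[OF completion_nov[OF vW M_carrier]])
    qed
    ultimately show "finite {n. linear_ext M f n \<noteq> 0 \<and> deg v n \<ge> c}" by (rule finite_subset)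
  qed
qed

lemma linear_ext_sum:
  assumes f: "f \<in> completion_carrier C w" and c: "c \<le> deg v n"
  shows "linear_ext M f n = (\<Sum>m | f m \<noteq> 0 \<and> deg w m \<ge> c. f m * M m n)"
proof (rule linear_ext_eq_sum)
  show "finite {m. f m \<noteq> 0 \<and> deg w m \<ge> c}" by (rule w.novD[OF completion_nov[OF wW f]])
  fix m assume "f m \<noteq> 0" "M m n \<noteq> 0"
  then show "m \<in> {m. f m \<noteq> 0 \<and> deg w m \<ge> c}"
    using M_deg[OF completion_monomials[OF wW f]] c by force
qed

lemma linear_ext_add:
  assumes f: "f \<in> completion_carrier C w" and g: "g \<in> completion_carrier C w"
  shows "linear_ext M (\<lambda>n. f n + g n) = (\<lambda>n. linear_ext M f n + linear_ext M g n)"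
proof
  fix n
  let ?S = "{m. f m \<noteq> 0 \<and> deg w m \<ge> deg v n} \<union> {m. g m \<noteq> 0 \<and> deg w m \<ge> deg v n}"
  have fin: "finite ?S" by (intro finite_UnI w.novD completion_nov[OF wW] f g)
  have mem: "m \<in> ?S" if "f m \<noteq> 0 \<or> g m \<noteq> 0" "M m n \<noteq> 0" for m
  proof -
    have "m \<in> monomials" using that(1) completion_monomials[OF wW f] completion_monomials[OF wW g] by blast
    from M_deg[OF this that(2)] show ?thesis using that(1) by blast
  qed
  have "linear_ext M (\<lambda>n. f n + g n) n = (\<Sum>m\<in>?S. (f m + g m) * M m n)"
    by (rule linear_ext_eq_sum[OF fin], rule mem) auto
  also have "\<dots> = (\<Sum>m\<in>?S. f m * M m n) + (\<Sum>m\<in>?S. g m * M m n)"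
    by (simp add: distrib_right sum.distrib)
  also have "(\<Sum>m\<in>?S. f m * M m n) = linear_ext M f n"
    by (rule linear_ext_eq_sum[OF fin, symmetric], rule mem) auto
  also have "(\<Sum>m\<in>?S. g m * M m n) = linear_ext M g n"
    by (rule linear_ext_eq_sum[OF fin, symmetric], rule mem) auto
  finally show "linear_ext M (\<lambda>n. f n + g n) n = linear_ext M f n + linear_ext M g n" .
qed

text \<open>Multiplicativity is given on monomials. The degree bounds A and B cut both sides down to
  the same finite sum over \<open>F\<close> and \<open>G\<close>, where \<open>M_add\<close> applies
  term by term.\<close>

lemma linear_ext_conv:
  assumes f: "f \<in> completion_carrier C w" and g: "g \<in> completion_carrier C w"
  shows "linear_ext M (conv f g) = conv (linear_ext M f) (linear_ext M g)"
proof
  fix p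
  note fm = completion_monomials[OF wW f] and gm = completion_monomials[OF wW g]
  obtain A where A: "\<And>m. f m \<noteq> 0 \<Longrightarrow> deg w m \<le> A" "A \<ge> 0" by (rule w.nov_bounded[OF completion_nov[OF wW f]]) (rule that)
  obtain B where B: "\<And>m. g m \<noteq> 0 \<Longrightarrow> deg w m \<le> B" "B \<ge> 0" by (rule w.nov_bounded[OF completion_nov[OF wW g]]) (rule that)
  define F where "F = {k. f k \<noteq> 0 \<and> deg w k \<ge> deg v p - B}"
  define G where "G = {k. g k \<noteq> 0 \<and> deg w k \<ge> deg v p - A}"
  have fin: "finite F" "finite G" unfolding F_def G_def by (intro w.novD completion_nov[OF wW] f g)+
  have mon: "k \<in> monomials" if "k \<in> F" for k using that fm by (simp add: F_def)
  have mon': "k \<in> monomials" if "k \<in> G" for k using that gm by (simp add: G_def)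
  have pair: "k \<in> F \<and> l \<in> G" if "f k \<noteq> 0" "g l \<noteq> 0" "deg v p \<le> deg w k + deg w l" for k l
    using that A(1)[of k] B(1)[of l] by (simp add: F_def G_def)

  have "linear_ext M (conv f g) p = (\<Sum>n\<in>(\<lambda>(k, l). k + l) ` (F \<times> G). conv f g n * M n p)"
  proof (rule linear_ext_eq_sum)
    fix n assume n: "conv f g n \<noteq> 0" "M n p \<noteq> 0"
    then obtain k where k: "f k \<noteq> 0" "g (n - k) \<noteq> 0" using conv_support by blast
    have "n \<in> monomials" using monomials_add[OF fm[OF k(1)] gm[OF k(2)]] by simp
    from M_deg[OF this n(2)] have "k \<in> F \<and> n - k \<in> G" by (intro pair k) (simp add: w.\<delta>_diff)
    then show "n \<in> (\<lambda>(k, l). k + l) ` (F \<times> G)" by (intro image_eqI[of _ _ "(k, n - k)"]) auto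
  qed (use fin in simp)
  \<comment> \<open>Group the pairs by their product \<open>n\<close>. The expansion of
    \<open>conv f g n\<close> over \<open>F\<close> and \<open>G\<close> is established where
    \<open>M n p\<close> is nonzero, since the degree bound comes from there; elsewhere both sides
    vanish.\<close>
  also have "\<dots> = (\<Sum>n\<in>(\<lambda>(k, l). k + l) ` (F \<times> G). \<Sum>x | x \<in> F \<times> G \<and> (case x of (k, l) \<Rightarrow> k + l) = n.
      case x of (k, l) \<Rightarrow> f k * g l * M (k + l) p)"
  proof (intro sum.cong refl)
    fix n assume "n \<in> (\<lambda>(k, l). k + l) ` (F \<times> G)"
    then obtain k0 l0 where kl: "n = k0 + l0" "k0 \<in> F" "l0 \<in> G" by auto
    have nmon: "n \<in> monomials" using kl mon mon' monomials_add by blast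
    have 1: "(\<Sum>x | x \<in> F \<times> G \<and> (case x of (k, l) \<Rightarrow> k + l) = n. case x of (k, l) \<Rightarrow> f k * g l * M (k + l) p)
      = (\<Sum>k | k \<in> F \<and> n - k \<in> G. f k * g (n - k) * M n p)"
      by (rule sum.reindex_bij_witness[of _ "\<lambda>k. (k, n - k)" fst]) auto
    show "conv f g n * M n p = (\<Sum>x | x \<in> F \<times> G \<and> (case x of (k, l) \<Rightarrow> k + l) = n.
        case x of (k, l) \<Rightarrow> f k * g l * M (k + l) p)"
    proof (cases "M n p = 0")
      case False
      have "conv f g n = (\<Sum>k | k \<in> F \<and> n - k \<in> G. f k * g (n - k))"
      proof (rule conv_eq_sum)
        show "finite {k \<in> F. n - k \<in> G}" using fin by simp
        fix k assume "f k \<noteq> 0" "g (n - k) \<noteq> 0"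
        with M_deg[OF nmon False] show "k \<in> {k \<in> F. n - k \<in> G}"
          using pair[of k "n - k"] by (simp add: w.\<delta>_diff)
      qed
      then show ?thesis unfolding 1 by (simp add: sum_distrib_right)
    qed (simp add: 1)
  qed
  also have "\<dots> = (\<Sum>x\<in>F \<times> G. case x of (k, l) \<Rightarrow> f k * g l * M (k + l) p)"
    by (rule sum.image_gen[symmetric]) (use fin in simp)
  also have "\<dots> = (\<Sum>k\<in>F. \<Sum>l\<in>G. f k * g l * conv (M k) (M l) p)"
    unfolding sum.cartesian_product[symmetric]
    by (intro sum.cong refl) (simp add: M_add mon mon')
  finally have L: "linear_ext M (conv f g) p = (\<Sum>k\<in>F. \<Sum>l\<in>G. f k * g l * conv (M k) (M l) p)" .

  \<comment> \<open>Holds every monomial in the image of \<open>f\<close> that can occur as the left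
    factor of \<open>p\<close>.\<close>
  define R where "R = (\<Union>k\<in>F. {r. M k r \<noteq> 0 \<and> deg v r \<ge> deg v p - B})"
  have finR: "finite R" unfolding R_def
    by (intro finite_UN_I fin v.novD completion_nov[OF vW] M_carrier mon)
  have Mf: "linear_ext M f r = (\<Sum>k\<in>F. f k * M k r)" if "deg v r \<ge> deg v p - B" for r
    unfolding F_def by (rule linear_ext_sum[OF f that])
  have Mg: "linear_ext M g r = (\<Sum>l\<in>G. g l * M l r)" if "deg v r \<ge> deg v p - A" for r
    unfolding G_def by (rule linear_ext_sum[OF g that])
  have bf: "deg v r \<le> A" if "linear_ext M f r \<noteq> 0" for r
  proof -
    obtain m where "f m \<noteq> 0" "M m r \<noteq> 0" using linear_ext_support[OF \<open>linear_ext M f r \<noteq> 0\<close>] by blast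
    then show ?thesis using M_deg[OF fm] A(1) by fastforce
  qed
  have bg: "deg v r \<le> B" if "linear_ext M g r \<noteq> 0" for r
  proof -
    obtain m where "g m \<noteq> 0" "M m r \<noteq> 0" using linear_ext_support[OF \<open>linear_ext M g r \<noteq> 0\<close>] by blast
    then show ?thesis using M_deg[OF gm] B(1) by fastforce
  qed
  have "conv (linear_ext M f) (linear_ext M g) p = (\<Sum>r\<in>R. linear_ext M f r * linear_ext M g (p - r))"
  proof (rule conv_eq_sum[OF finR])
    fix r assume r: "linear_ext M f r \<noteq> 0" "linear_ext M g (p - r) \<noteq> 0"
    have d: "deg v r \<ge> deg v p - B" using bg[OF r(2)] by (simp add: v.\<delta>_diff)
    have "\<exists>k\<in>F. M k r \<noteq> 0"
    proof (rule ccontr)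
      assume "\<not> ?thesis"
      then have "linear_ext M f r = 0" unfolding Mf[OF d] by simp
      with r(1) show False by simp
    qed
    then show "r \<in> R" using d by (auto simp: R_def)
  qed
  also have "\<dots> = (\<Sum>r\<in>R. (\<Sum>k\<in>F. f k * M k r) * (\<Sum>l\<in>G. g l * M l (p - r)))"
  proof (intro sum.cong refl)
    fix r assume "r \<in> R"
    then obtain k where k: "k \<in> F" "M k r \<noteq> 0" and d: "deg v r \<ge> deg v p - B" unfolding R_def by auto
    have "deg v r \<le> deg w k" by (rule M_deg[OF mon[OF k(1)] k(2)])
    also have "\<dots> \<le> A" using k(1) A(1) by (simp add: F_def)
    finally have "deg v (p - r) \<ge> deg v p - A" by (simp add: v.\<delta>_diff)
    from Mf[OF d] Mg[OF this]
    show "linear_ext M f r * linear_ext M g (p - r) = (\<Sum>k\<in>F. f k * M k r) * (\<Sum>l\<in>G. g l * M l (p - r))"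
      by simp
  qed
  also have "\<dots> = (\<Sum>r\<in>R. \<Sum>k\<in>F. \<Sum>l\<in>G. f k * g l * (M k r * M l (p - r)))"
    unfolding sum_product by (simp add: mult_ac)
  also have "\<dots> = (\<Sum>k\<in>F. \<Sum>r\<in>R. \<Sum>l\<in>G. f k * g l * (M k r * M l (p - r)))" by (rule sum.swap)
  also have "\<dots> = (\<Sum>k\<in>F. \<Sum>l\<in>G. \<Sum>r\<in>R. f k * g l * (M k r * M l (p - r)))"
    by (rule sum.cong[OF refl], rule sum.swap)
  also have "\<dots> = (\<Sum>k\<in>F. \<Sum>l\<in>G. f k * g l * conv (M k) (M l) p)"
  proof (intro sum.cong refl)
    fix k l assume k: "k \<in> F" and l: "l \<in> G"
    have "conv (M k) (M l) p = (\<Sum>r\<in>R. M k r * M l (p - r))"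
    proof (rule conv_eq_sum[OF finR])
      fix r assume r: "M k r \<noteq> 0" "M l (p - r) \<noteq> 0"
      have "deg v (p - r) \<le> deg w l" by (rule M_deg[OF mon'[OF l] r(2)])
      also have "\<dots> \<le> B" using l B(1) by (simp add: G_def)
      finally show "r \<in> R" using r(1) k by (auto simp: R_def v.\<delta>_diff)
    qed
    then show "(\<Sum>r\<in>R. f k * g l * (M k r * M l (p - r))) = f k * g l * conv (M k) (M l) p"
      by (simp add: sum_distrib_left)
  qed
  finally show "linear_ext M (conv f g) p = conv (linear_ext M f) (linear_ext M g) p" using L by simp
qed

end


subsection \<open>Monomial maps with prescribed unit values\<close>

context
  fixes v assumes vW: "v \<in> W"
begin

interpretation R: cring "completion C v" by (rule cring_completion[OF vW])
interpretation U: comm_group "units_of (completion C v)" by (rule R.units_comm_group)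

text \<open>The addition law for integer exponents is a law of groups, while powers in
  \<open>Theta_mono\<close> are taken in the ring; the unit group mediates.\<close>

lemma units_int_pow:
  assumes "x \<in> Units (completion C v)"
  shows "x [^]\<^bsub>units_of (completion C v)\<^esub> (z::int) = x [^]\<^bsub>completion C v\<^esub> z"
proof -
  have "x [^]\<^bsub>completion C v\<^esub> (n::nat) \<in> Units (completion C v)" for n
    using assms by (induction n) simp_all
  then show ?thesis using assms unfolding int_pow_def2
    by (simp add: R.units_of_pow R.units_of_inv del: pow_nat)
qed

lemma unit_below_nat_pow:
  assumes "x \<in> unit_below v \<nu>"
  shows "x [^]\<^bsub>completion C v\<^esub> (n::nat) \<in> unit_below v (int n *s \<nu>)"
proof (induction n)
  case 0 then show ?case using unit_below_one[OF vW] by (simp add: completion_sel)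
next
  case (Suc n)
  have "x [^]\<^bsub>completion C v\<^esub> Suc n = conv (x [^]\<^bsub>completion C v\<^esub> n) x" by (simp add: completion_mult)
  then show ?case using unit_below_mult[OF vW Suc assms] by (simp add: vector_sadd_rdistrib add.commute)
qed

lemma unit_below_int_pow:
  assumes "x \<in> unit_below v \<nu>"
  shows "x [^]\<^bsub>completion C v\<^esub> (z::int) \<in> unit_below v (z *s \<nu>)"
proof (cases "z < 0")
  case True
  then have "- (int (nat (- z)) *s \<nu>) = z *s \<nu>" by (simp add: vec_eq_iff)
  then show ?thesis using unit_below_inv[OF vW unit_below_nat_pow[OF assms, of "nat (- z)"]] True
    unfolding int_pow_def2 by (simp del: pow_nat)
next
  case False
  then show ?thesis using unit_below_nat_pow[OF assms, of "nat z"]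
    unfolding int_pow_def2 by (simp del: pow_nat)
qed

lemma unit_below_Units: "x \<in> unit_below v \<nu> \<Longrightarrow> x \<in> Units (completion C v)"
  and unit_below_carrier: "x \<in> unit_below v \<nu> \<Longrightarrow> x \<in> completion_carrier C v"
  and unit_below_lower: "x \<in> unit_below v \<nu> \<Longrightarrow> x \<in> lower v 0 \<nu>"
  using R.Units_closed by (auto simp: unit_below_def[OF vW] completion_sel)

lemma unit_below_conv_inv: "x \<in> unit_below v \<nu> \<Longrightarrow> conv x (inv\<^bsub>completion C v\<^esub> x) = mono_series 0"
  using R.Units_r_inv[OF unit_below_Units] by (simp add: completion_mult completion_sel)

context
  fixes X :: "'i \<times> complex \<Rightarrow> 'i series" and \<kappa> :: "'i \<Rightarrow> int^'i"
  assumes X: "\<And>p. snd p \<noteq> 0 \<Longrightarrow> X p \<in> unit_below v (\<kappa> (fst p))"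
begin

definition mono_map :: "'i monomial \<Rightarrow> 'i series" where
  "mono_map m = (\<Otimes>\<^bsub>completion C v\<^esub>p\<in>Poly_Mapping.keys m. X p [^]\<^bsub>completion C v\<^esub> Poly_Mapping.lookup m p)"

lemma keys_monomials: "m \<in> monomials \<Longrightarrow> p \<in> Poly_Mapping.keys m \<Longrightarrow> snd p \<noteq> 0"
  by (cases p) (auto simp: monomials_iff in_keys_iff)

lemma X_pow_carrier: "snd p \<noteq> 0 \<Longrightarrow> X p [^]\<^bsub>completion C v\<^esub> (z::int) \<in> carrier (completion C v)"
  using unit_below_carrier[OF unit_below_int_pow[OF X]] by (simp add: completion_sel)

lemma mono_map_superset:
  assumes "finite S" "\<And>p. p \<in> S \<Longrightarrow> snd p \<noteq> 0" "Poly_Mapping.keys m \<subseteq> S"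
  shows "mono_map m = (\<Otimes>\<^bsub>completion C v\<^esub>p\<in>S. X p [^]\<^bsub>completion C v\<^esub> Poly_Mapping.lookup m p)"
  unfolding mono_map_def
  by (rule R.finprod_mono_neutral_cong_left) (use assms X_pow_carrier in \<open>auto simp: in_keys_iff\<close>)

lemma mono_map_add:
  assumes "m \<in> monomials" "n \<in> monomials"
  shows "mono_map (m + n) = conv (mono_map m) (mono_map n)"
proof -
  let ?S = "Poly_Mapping.keys m \<union> Poly_Mapping.keys n"
  have S1: "finite ?S" by simp
  have S2: "\<And>p. p \<in> ?S \<Longrightarrow> snd p \<noteq> 0"
    using keys_monomials[OF assms(1)] keys_monomials[OF assms(2)] by (elim UnE)
  note S = S1 S2
  have "mono_map (m + n) = (\<Otimes>\<^bsub>completion C v\<^esub>p\<in>?S. X p [^]\<^bsub>completion C v\<^esub> Poly_Mapping.lookup (m + n) p)"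
    by (rule mono_map_superset[OF S]) (auto dest: subsetD[OF Poly_Mapping.keys_add])
  also have "\<dots> = (\<Otimes>\<^bsub>completion C v\<^esub>p\<in>?S. X p [^]\<^bsub>completion C v\<^esub> Poly_Mapping.lookup m p
      \<otimes>\<^bsub>completion C v\<^esub> X p [^]\<^bsub>completion C v\<^esub> Poly_Mapping.lookup n p)"
  proof (rule R.finprod_cong')
    fix p assume "p \<in> ?S"
    then have u: "X p \<in> Units (completion C v)" using unit_below_Units[OF X] S(2) by blast
    show "X p [^]\<^bsub>completion C v\<^esub> Poly_Mapping.lookup (m + n) p = X p [^]\<^bsub>completion C v\<^esub> Poly_Mapping.lookup m p
      \<otimes>\<^bsub>completion C v\<^esub> X p [^]\<^bsub>completion C v\<^esub> Poly_Mapping.lookup n p"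
      using U.int_pow_mult[of "X p" "Poly_Mapping.lookup m p" "Poly_Mapping.lookup n p"] u
      by (simp add: units_of_carrier units_of_mult units_int_pow lookup_add)
  qed (use S X_pow_carrier in auto)
  also have "\<dots> = (\<Otimes>\<^bsub>completion C v\<^esub>p\<in>?S. X p [^]\<^bsub>completion C v\<^esub> Poly_Mapping.lookup m p)
      \<otimes>\<^bsub>completion C v\<^esub> (\<Otimes>\<^bsub>completion C v\<^esub>p\<in>?S. X p [^]\<^bsub>completion C v\<^esub> Poly_Mapping.lookup n p)"
    by (rule R.finprod_multf) (use S X_pow_carrier in auto)
  also have "\<dots> = conv (mono_map m) (mono_map n)"
    by (subst (1 2) mono_map_superset[OF S]) (auto simp: completion_mult)
  finally show ?thesis .
qed

lemma mono_map_unit_below: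
  assumes "m \<in> monomials"
  shows "mono_map m \<in> unit_below v (\<Sum>p\<in>Poly_Mapping.keys m. Poly_Mapping.lookup m p *s \<kappa> (fst p))"
proof -
  have "(\<Otimes>\<^bsub>completion C v\<^esub>p\<in>S. X p [^]\<^bsub>completion C v\<^esub> Poly_Mapping.lookup m p)
      \<in> unit_below v (\<Sum>p\<in>S. Poly_Mapping.lookup m p *s \<kappa> (fst p))"
    if "finite S" "\<And>p. p \<in> S \<Longrightarrow> snd p \<noteq> 0" for S
    using that
  proof (induction S rule: finite_induct)
    case empty then show ?case using unit_below_one[OF vW] by (simp add: completion_sel)
  next
    case (insert p S)
    have "(\<Otimes>\<^bsub>completion C v\<^esub>p\<in>insert p S. X p [^]\<^bsub>completion C v\<^esub> Poly_Mapping.lookup m p)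
      = X p [^]\<^bsub>completion C v\<^esub> Poly_Mapping.lookup m p \<otimes>\<^bsub>completion C v\<^esub>
          (\<Otimes>\<^bsub>completion C v\<^esub>p\<in>S. X p [^]\<^bsub>completion C v\<^esub> Poly_Mapping.lookup m p)"
      by (rule R.finprod_insert) (use insert X_pow_carrier in auto)
    moreover have "X p [^]\<^bsub>completion C v\<^esub> Poly_Mapping.lookup m p \<in> unit_below v (Poly_Mapping.lookup m p *s \<kappa> (fst p))"
      using unit_below_int_pow[OF X] insert.prems by simp
    ultimately show ?case using unit_below_mult[OF vW] insert by (simp add: completion_mult)
  qed
  then show ?thesis unfolding mono_map_def using keys_monomials[OF assms] by simp
qed

lemma mono_map_single: assumes "snd p \<noteq> 0"
  shows "mono_map (Poly_Mapping.single p z) = X p [^]\<^bsub>completion C v\<^esub> z"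
  by (subst mono_map_superset[of "{p}"]) (use assms X_pow_carrier in \<open>auto simp: R.finprod_singleton\<close>)

end

end

end

section \<open>The operators\<close>

lemma formal_sum_mono_series:
  assumes "inj_on f K"
  shows "formal_sum K (\<lambda>k. mono_series (f k)) n = of_bool (n \<in> f ` K)"
proof (cases "n \<in> f ` K")
  case True
  then obtain k where k: "k \<in> K" "n = f k" by auto
  have "{l \<in> K. mono_series (f l) n \<noteq> 0} = {k}" using k assms by (auto simp: inj_on_def)
  then show ?thesis using k by (simp add: formal_sum_def mono_series_def)
next
  case False
  then have "{l \<in> K. mono_series (f l) n \<noteq> 0} = {}" by auto
  then show ?thesis using False by (simp only: formal_sum_def sum.empty) simp
qed

lemma sum_greaterThanAtMost_shift:
  "(\<Sum>j\<in>{0<..Suc k}. f j) = f 1 + (\<Sum>j\<in>{0<..k}. f (Suc j))" for f :: "nat \<Rightarrow> 'a::comm_monoid_add"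
proof -
  have eq: "{0<..Suc k} = insert 1 (Suc ` {0<..k})"
    by (auto simp: image_iff) (metis Suc_le_mono Suc_pred gr0_conv_Suc greaterThanAtMost_iff neq0_conv)
  show ?thesis unfolding eq by (subst sum.insert) (auto simp: sum.reindex)
qed

locale weyl_action = cartan_datum C d for C :: "int^'i^'i::finite" and d :: "'i \<Rightarrow> nat" +
  fixes q :: complex
  assumes q_nonzero: "q \<noteq> 0"
begin

abbreviation A :: "'i \<Rightarrow> complex \<Rightarrow> 'i monomial" where "A \<equiv> Avar C d q"
abbreviation qq :: "'i \<Rightarrow> complex" where "qq i \<equiv> q ^ d i"

text \<open>The contribution of the neighbours of i to \<open>A i a\<close>, with inverted sign. It
  contains no variable of node i and is therefore fixed by the operator of i.\<close>

definition K :: "'i \<Rightarrow> complex \<Rightarrow> 'i monomial" where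
  "K i a = (\<Sum>j | C $ j $ i = -1. Yvar j a)
      + (\<Sum>j | C $ j $ i = -2. Yvar j (a * q powi (-1)) + Yvar j (a * q))
      + (\<Sum>j | C $ j $ i = -3. Yvar j (a * q powi (-2)) + Yvar j a + Yvar j (a * q ^ 2))"

lemma A_eq: "A i a = Yvar i (a / qq i) + Yvar i (a * qq i) - K i a"
  by (simp add: Avar_def K_def power_int_minus divide_inverse)

lemma qq_nonzero [simp]: "qq i \<noteq> 0" using q_nonzero by simp

lemma K_monomials: "a \<noteq> 0 \<Longrightarrow> K i a \<in> monomials"
  unfolding K_def by (intro monomials_add monomials_sum monomials_Yvar) (auto simp: q_nonzero)

lemma A_monomials: "a \<noteq> 0 \<Longrightarrow> A i a \<in> monomials"
  unfolding A_eq by (intro monomials_add monomials_diff monomials_Yvar K_monomials) (auto simp: q_nonzero)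

lemma fund_weight_nth: "fund_weight i $ j = of_bool (j = i)"
  by (simp add: fund_weight_def axis_def)

lemma weight_A: "weight (A i a) = \<alpha> i"
proof (subst vec_eq_iff, intro allI)
  fix l
  have s: "(\<Sum>j | P j. of_bool (l = j) :: int) = of_bool (P l)" for P :: "'i \<Rightarrow> bool"
    by (simp add: of_bool_def sum.delta')
  have c: "C $ l $ i \<in> {0, -1, -2, -3}" if "l \<noteq> i"
    using cartan_pairs[OF that] by auto
  show "weight (A i a) $ l = \<alpha> i $ l"
    unfolding A_eq K_def
    by (simp add: weight_diff weight_add weight_sum fund_weight_nth sum.distrib s)
       (use c in auto)
qed

section \<open>The series Sigma and their q-difference equation\<close>

abbreviation S :: "(int^'i \<Rightarrow> int^'i) \<Rightarrow> 'i \<Rightarrow> complex \<Rightarrow> 'i series" where "S \<equiv> Sigma_w C d q"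

definition plus_mono :: "'i \<Rightarrow> complex \<Rightarrow> nat \<Rightarrow> 'i monomial" where
  "plus_mono i a k = (\<Sum>j\<in>{0<..k}. - A i (a * qq i powi (- 2 * int j + 2)))"

definition minus_mono :: "'i \<Rightarrow> complex \<Rightarrow> nat \<Rightarrow> 'i monomial" where
  "minus_mono i a k = (\<Sum>j\<in>{0<..k}. A i (a * qq i powi (2 * int j)))"

lemma weight_plus_mono: "weight (plus_mono i a k) = - (int k *s \<alpha> i)"
  and weight_minus_mono: "weight (minus_mono i a k) = int k *s \<alpha> i"
proof -
  have sum: "(\<Sum>j\<in>{0<..k}. x) = int k *s x" for x :: "int^'i"
    by (induction k) (simp_all add: sum_greaterThanAtMost_shift vector_sadd_rdistrib del: sum_constant)
  then have "(\<Sum>j\<in>{0<..k}. \<alpha> i) = int k *s \<alpha> i" "(\<Sum>j\<in>{0<..k}. - \<alpha> i) = - (int k *s \<alpha> i)"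
    by (simp_all only: sum vector_smult_rneg)
  then show "weight (plus_mono i a k) = - (int k *s \<alpha> i)" "weight (minus_mono i a k) = int k *s \<alpha> i"
    by (simp_all add: plus_mono_def minus_mono_def weight_sum weight_uminus weight_A)
qed

lemma scale_simple_root_inj: "int k *s \<alpha> i = int l *s \<alpha> i \<Longrightarrow> k = l"
  by (drule arg_cong[of _ _ "\<lambda>x. x $ i"]) simp

lemma inj_plus_mono: "inj (plus_mono i a)" and inj_minus_mono: "inj (minus_mono i a)"
  by (rule injI, drule arg_cong[of _ _ weight],
      simp only: weight_plus_mono weight_minus_mono neg_equal_iff_equal, erule scale_simple_root_inj)+

lemma Sigma_plus_eq: "Sigma_plus C d q i a n = of_bool (n \<in> range (plus_mono i a))"
  unfolding Sigma_plus_def plus_mono_def[symmetric]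
  by (rule formal_sum_mono_series) (rule inj_plus_mono)

lemma Sigma_minus_eq: "Sigma_minus C d q i a n = - of_bool (n \<in> minus_mono i a ` {0<..})"
  unfolding Sigma_minus_def minus_mono_def[symmetric]
  by (subst formal_sum_mono_series) (auto intro: inj_on_subset[OF inj_minus_mono])

lemma plus_mono_0: "plus_mono i a 0 = 0" and minus_mono_0: "minus_mono i a 0 = 0"
  by (simp_all add: plus_mono_def minus_mono_def)

lemma plus_mono_Suc: "plus_mono i a (Suc k) = plus_mono i (a / (qq i)\<^sup>2) k - A i a"
proof -
  have "a * qq i powi (- 2 * int (Suc j) + 2) = a / (qq i)\<^sup>2 * qq i powi (- 2 * int j + 2)" for j
  proof -
    have "qq i powi (- 2 * int (Suc j) + 2) = qq i powi ((- 2 * int j + 2) - 2)" by (simp add: algebra_simps)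
    also have "\<dots> = qq i powi (- 2 * int j + 2) / qq i powi 2" by (rule power_int_diff) (simp add: q_nonzero)
    finally show ?thesis by (simp add: q_nonzero)
  qed
  then show ?thesis unfolding plus_mono_def sum_greaterThanAtMost_shift by simp
qed

lemma minus_mono_Suc: "minus_mono i (a / (qq i)\<^sup>2) (Suc k) = A i a + minus_mono i a k"
proof -
  have "a / (qq i)\<^sup>2 * qq i powi (2 * int (Suc j)) = a * qq i powi (2 * int j)" for j
  proof -
    have "qq i powi (2 * int (Suc j)) = qq i powi (2 * int j + 2)" by (simp add: algebra_simps)
    also have "\<dots> = qq i powi (2 * int j) * qq i powi 2" by (rule power_int_add) (simp add: q_nonzero)
    finally show ?thesis by (simp add: q_nonzero)
  qed
  note eq = this
  have "a / (qq i)\<^sup>2 * qq i powi (2 * int 1) = a" by (simp add: q_nonzero)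
  with eq show ?thesis unfolding minus_mono_def sum_greaterThanAtMost_shift by simp
qed

lemma range_Suc_split: "range f = insert (f 0) (range (\<lambda>k. f (Suc k)))"
proof -
  have "(UNIV :: nat set) = insert 0 (range Suc)" by (auto simp: image_iff) (metis not0_implies_Suc)
  then show ?thesis by (metis image_image image_insert)
qed

text \<open>Both Sigma^+ and Sigma^- solve this first order q-difference equation, being its
  expansions in opposite directions. Using only the equation, later computations avoid a case
  distinction on the sign of v(\<alpha> i).\<close>

lemma Sigma_difference:
  "S v i a = (\<lambda>n. mono_series 0 n + conv (mono_series (- A i a)) (S v i (a / (qq i)\<^sup>2)) n)"
proof
  fix n
  have 1: "Sigma_plus C d q i a n = mono_series 0 n + Sigma_plus C d q i (a / (qq i)\<^sup>2) (n + A i a)"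
  proof -
    let ?f = "plus_mono i a" and ?g = "plus_mono i (a / (qq i)\<^sup>2)"
    have "n \<in> range ?f \<longleftrightarrow> n = 0 \<or> n \<in> range (\<lambda>k. ?f (Suc k))"
      by (subst range_Suc_split) (simp add: plus_mono_0)
    moreover have "n \<in> range (\<lambda>k. ?f (Suc k)) \<longleftrightarrow> n + A i a \<in> range ?g"
      unfolding plus_mono_Suc image_iff by (auto simp: algebra_simps)
    moreover have "0 \<notin> range (\<lambda>k. ?f (Suc k))"
    proof
      assume "0 \<in> range (\<lambda>k. ?f (Suc k))"
      then obtain k where "?f (Suc k) = ?f 0" by (auto simp: plus_mono_0)
      then show False using injD[OF inj_plus_mono] by blast
    qed
    ultimately show ?thesis unfolding Sigma_plus_eq by (auto simp: mono_series_def)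
  qed
  have 2: "Sigma_minus C d q i a n = mono_series 0 n + Sigma_minus C d q i (a / (qq i)\<^sup>2) (n + A i a)"
  proof -
    let ?f = "minus_mono i a" and ?g = "minus_mono i (a / (qq i)\<^sup>2)"
    have g: "?g ` {0<..} = range (\<lambda>k. ?g (Suc k))" by (auto simp: gr0_conv_Suc)
    have "n + A i a \<in> ?g ` {0<..} \<longleftrightarrow> n \<in> range ?f"
      unfolding g minus_mono_Suc image_iff by (auto simp: algebra_simps)
    moreover have "n \<in> range ?f \<longleftrightarrow> n = 0 \<or> n \<in> ?f ` {0<..}"
    proof -
      have "range ?f = insert (?f 0) (?f ` {0<..})"
        unfolding image_insert[symmetric] by (rule arg_cong[of _ _ "(`) ?f"]) auto
      then show ?thesis by (simp add: minus_mono_0)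
    qed
    moreover have "0 \<notin> ?f ` {0<..}"
    proof
      assume "0 \<in> ?f ` {0<..}"
      then obtain k where "k > 0" "?f k = ?f 0" by (auto simp: minus_mono_0)
      then show False using injD[OF inj_minus_mono] by blast
    qed
    ultimately show ?thesis unfolding Sigma_minus_eq by (auto simp: mono_series_def)
  qed
  show "S v i a n = mono_series 0 n + conv (mono_series (- A i a)) (S v i (a / (qq i)\<^sup>2)) n"
    unfolding Sigma_w_def conv_mono_series using 1 2 by simp
qed

lemma lower_completion:
  assumes "v \<in> W" "f \<in> lower v n \<nu>" "\<And>m. f m \<noteq> 0 \<Longrightarrow> m \<in> monomials"
    "\<And>\<mu>. finite {m. f m \<noteq> 0 \<and> weight m = \<mu>}"
  shows "f \<in> completion_carrier C v"
  unfolding completion_carrier_def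
proof (intro CollectI conjI allI)
  show "\<exists>\<Lambda>. finite \<Lambda> \<and> (\<forall>m. f m \<noteq> 0 \<longrightarrow> (\<exists>\<nu>\<in>\<Lambda>. \<exists>\<beta>\<in>Q_plus C. v (weight m) = \<nu> - \<beta>))"
  proof (intro exI[of _ "{\<nu>}"] conjI allI impI)
    fix m assume "f m \<noteq> 0"
    then have "\<nu> - v (weight m) \<in> Q_plus C" using assms(2) by (simp add: lower_def)
    then show "\<exists>\<nu>\<in>{\<nu>}. \<exists>\<beta>\<in>Q_plus C. v (weight m) = \<nu> - \<beta>"
      by (intro bexI[of _ \<nu>] bexI[of _ "\<nu> - v (weight m)"]) simp_all
  qed simp
qed (use assms in auto)

lemma at_most_one_finite: "(\<And>x y. P x \<Longrightarrow> P y \<Longrightarrow> x = y) \<Longrightarrow> finite {x. P x}"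
proof -
  assume *: "\<And>x y. P x \<Longrightarrow> P y \<Longrightarrow> x = y"
  show ?thesis
  proof (cases "\<exists>x. P x")
    case True
    then obtain x where "P x" by blast
    then have "{x. P x} \<subseteq> {x}" using * by blast
    then show ?thesis by (rule finite_subset) simp
  qed simp
qed

lemma plus_mono_monomials: "a \<noteq> 0 \<Longrightarrow> plus_mono i a k \<in> monomials"
  and minus_mono_monomials: "a \<noteq> 0 \<Longrightarrow> minus_mono i a k \<in> monomials"
  unfolding plus_mono_def minus_mono_def
  by (intro monomials_sum monomials_uminus A_monomials; simp add: q_nonzero power_int_eq_0_iff)+

lemma height_W_simple_root:
  assumes "v \<in> W" "v (\<alpha> i) \<in> Q_plus C" shows "height (v (\<alpha> i)) \<ge> 1"
    using height_ge_1 W_simple_root_nonzero assms by blast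

lemma lower_from_steps:
  assumes "\<gamma> \<in> Q_plus C" "height \<gamma> \<ge> 1" "\<And>p. f p \<noteq> 0 \<Longrightarrow> \<exists>k>0. - v (weight p) = int k *s \<gamma>"
  shows "f \<in> lower v 1 0"
  unfolding lower_def
proof (intro CollectI allI impI)
  fix p assume "f p \<noteq> 0"
  then obtain k where k: "k > 0" "- v (weight p) = int k *s \<gamma>" using assms(3) by blast
  have "1 * 1 \<le> real k * height \<gamma>" using k(1) assms(2) by (intro mult_mono) auto
  then show "0 - v (weight p) \<in> Q_plus C \<and> 1 \<le> height (0 - v (weight p))"
    using k(2) assms(1) by (simp add: height_scale_nat Q_plus_scale)
qed

text \<open>For a positive root the series is 1 plus terms of depth at least 1. For a negative root
  its leading term is -A_{i, a q_i^2}; after splitting that off, the same geometric series argument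
  applies.\<close>

lemma Sigma_unit_below:
  assumes v: "v \<in> W" and a: "a \<noteq> 0"
  shows "S v i a \<in> unit_below v (if v (\<alpha> i) \<in> Q_plus C then 0 else v (\<alpha> i))"
proof (cases "v (\<alpha> i) \<in> Q_plus C")
  case True
  define x where "x = (\<lambda>n. mono_series 0 n - Sigma_plus C d q i a n)"
  have supp: "\<exists>k>0. p = plus_mono i a k" if "x p \<noteq> 0" for p
  proof -
    have "p \<in> range (plus_mono i a)" "p \<noteq> 0"
      using that plus_mono_0[of i a] unfolding x_def Sigma_plus_eq mono_series_def
      by (auto split: if_splits)
    then show ?thesis using plus_mono_0[of i a] by (metis gr0I rangeE)
  qed
  have low: "x \<in> lower v 1 0"
  proof (rule lower_from_steps[OF True height_W_simple_root[OF v True]])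
    fix p assume "x p \<noteq> 0"
    then obtain k where "k > 0" "p = plus_mono i a k" using supp by blast
    then show "\<exists>k>0. - v (weight p) = int k *s v (\<alpha> i)"
      by (intro exI[of _ k]) (simp add: weight_plus_mono W_uminus[OF v] W_scale[OF v])
  qed
  have "x \<in> completion_carrier C v"
  proof (rule lower_completion[OF v low])
    show "m \<in> monomials" if "x m \<noteq> 0" for m using supp[OF that] plus_mono_monomials[OF a] by blast
    fix \<mu>
    show "finite {m. x m \<noteq> 0 \<and> weight m = \<mu>}"
    proof (rule at_most_one_finite)
      fix m m' assume "x m \<noteq> 0 \<and> weight m = \<mu>" "x m' \<noteq> 0 \<and> weight m' = \<mu>"
      then obtain k k' where "m = plus_mono i a k" "m' = plus_mono i a k'"
        "weight (plus_mono i a k) = weight (plus_mono i a k')" using supp by metis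
      then show "m = m'" unfolding weight_plus_mono neg_equal_iff_equal
        using scale_simple_root_inj by blast
    qed
  qed
  from unit_below_geometric[OF v this low] have "Sigma_plus C d q i a \<in> unit_below v 0" by (simp add: x_def)
  then show ?thesis using True by (simp add: Sigma_w_def pos_roots_iff[OF v])
next
  case False
  then have neg: "- v (\<alpha> i) \<in> Q_plus C" using root_dichotomy[OF v] by blast
  \<comment> \<open>The difference equation read at a q_i^2 gives Sigma_a = -A_{a'} (1 -
    Sigma_{a'}), with the leading monomial in front.\<close>
  define a' where "a' = a * (qq i)\<^sup>2"
  have a': "a' \<noteq> 0" "a' / (qq i)\<^sup>2 = a" using a q_nonzero by (simp_all add: a'_def)
  define x where "x = Sigma_minus C d q i a'"
  have S: "S v i b = Sigma_minus C d q i b" for b using False by (simp add: Sigma_w_def pos_roots_iff[OF v])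
  have supp: "\<exists>k>0. p = minus_mono i a' k" if "x p \<noteq> 0" for p
    using that unfolding x_def Sigma_minus_eq by (auto split: if_splits)
  have h: "height (- v (\<alpha> i)) \<ge> 1"
    using height_ge_1[OF neg] W_simple_root_nonzero[OF v] by simp
  have low: "x \<in> lower v 1 0"
  proof (rule lower_from_steps[OF neg h])
    fix p assume "x p \<noteq> 0"
    then obtain k where "k > 0" "p = minus_mono i a' k" using supp by blast
    then show "\<exists>k>0. - v (weight p) = int k *s - v (\<alpha> i)"
      by (intro exI[of _ k]) (simp add: weight_minus_mono W_scale[OF v] vector_smult_rneg)
  qed
  have "x \<in> completion_carrier C v"
  proof (rule lower_completion[OF v low])
    show "m \<in> monomials" if "x m \<noteq> 0" for m using supp[OF that] minus_mono_monomials[OF a'(1)] by blast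
    fix \<mu>
    show "finite {m. x m \<noteq> 0 \<and> weight m = \<mu>}"
    proof (rule at_most_one_finite)
      fix m m' assume "x m \<noteq> 0 \<and> weight m = \<mu>" "x m' \<noteq> 0 \<and> weight m' = \<mu>"
      then obtain k k' where "m = minus_mono i a' k" "m' = minus_mono i a' k'"
        "weight (minus_mono i a' k) = weight (minus_mono i a' k')" using supp by metis
      then show "m = m'" unfolding weight_minus_mono using scale_simple_root_inj by blast
    qed
  qed
  from unit_below_geometric[OF v this low]
  have 1: "(\<lambda>n. mono_series 0 n - x n) \<in> unit_below v 0" .
  have "S v i a = (\<lambda>n. - conv (mono_series (A i a')) (\<lambda>n. mono_series 0 n - x n) n)"
  proof
    fix n
    have "x (n - A i a') = mono_series 0 (n - A i a') + S v i a n"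
      using fun_cong[OF Sigma_difference[of v i a'], of "n - A i a'"]
      by (simp add: a'(2) conv_mono_series x_def S)
    then show "S v i a n = - conv (mono_series (A i a')) (\<lambda>n. mono_series 0 n - x n) n"
      by (simp add: conv_mono_series)
  qed
  moreover have "(\<lambda>n. - conv (mono_series (A i a')) (\<lambda>n. mono_series 0 n - x n) n) \<in> unit_below v (v (\<alpha> i) + 0)"
    using unit_below_uminus[OF v unit_below_mult[OF v unit_below_mono[OF v A_monomials[OF a'(1)]] 1]]
    by (simp add: weight_A)
  ultimately show ?thesis using False by simp
qed

end

text \<open>Lets invariants be computed in the ring of finitely supported maps, whose arithmetic
  does not involve w, and only then be read as series.\<close>

lemma lookup_times_conv:
  fixes F G :: "'m::ab_group_add \<Rightarrow>\<^sub>0 int"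
  shows "Poly_Mapping.lookup (F * G) = conv (Poly_Mapping.lookup F) (Poly_Mapping.lookup G)"
proof
  fix n
  have "Poly_Mapping.lookup (F * G) n
    = (\<Sum>l. Poly_Mapping.lookup F l * (\<Sum>q. Poly_Mapping.lookup G q when n = l + q))"
    by (rule lookup_mult)
  also have "(\<lambda>l. Poly_Mapping.lookup F l * (\<Sum>q. Poly_Mapping.lookup G q when n = l + q))
    = (\<lambda>l. Poly_Mapping.lookup F l * Poly_Mapping.lookup G (n - l))"
  proof
    fix l
    have eq: "(\<lambda>q. Poly_Mapping.lookup G q when n = l + q) = (\<lambda>q. Poly_Mapping.lookup G q when q = n - l)"
      by (auto simp: fun_eq_iff algebra_simps when_def)
    show "Poly_Mapping.lookup F l * (\<Sum>q. Poly_Mapping.lookup G q when n = l + q)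
      = Poly_Mapping.lookup F l * Poly_Mapping.lookup G (n - l)" unfolding eq by simp
  qed
  also have "(\<Sum>l. Poly_Mapping.lookup F l * Poly_Mapping.lookup G (n - l))
    = conv (Poly_Mapping.lookup F) (Poly_Mapping.lookup G) n"
    unfolding Sum_any.expand_set conv_def by (rule sum.cong) auto
  finally show "Poly_Mapping.lookup (F * G) n = conv (Poly_Mapping.lookup F) (Poly_Mapping.lookup G) n" .
qed

lemma lookup_single_mono_series: "Poly_Mapping.lookup (Poly_Mapping.single m 1) = mono_series m"
  by (auto simp: fun_eq_iff lookup_single mono_series_def when_def)

text \<open>The two identities behind the invariance of \<open>Y\<^sub>i\<^sub>,\<^sub>a (1 + A\<^sub>i\<^sub>,\<^sub>a\<^sub>q\<^sup>-\<^sup>1)\<close>. Here \<open>S1\<close>, \<open>S2\<close>,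
  \<open>S3\<close> are three consecutive values of \<open>\<Sigma>\<close> and \<open>Z\<close> is the inverse of \<open>S1\<close>.\<close>

lemma (in cring) theta_identity_1:
  assumes "Y \<in> carrier R" "B \<in> carrier R" "S3 \<in> carrier R" "S1 \<in> carrier R" "Z \<in> carrier R"
    and "S1 = \<one> \<oplus> B \<otimes> S3" "S1 \<otimes> Z = \<one>"
  shows "(Y \<otimes> B) \<otimes> (S3 \<otimes> Z) \<oplus> Y \<otimes> Z = Y"
proof -
  have "(Y \<otimes> B) \<otimes> (S3 \<otimes> Z) \<oplus> Y \<otimes> Z = Y \<otimes> ((\<one> \<oplus> B \<otimes> S3) \<otimes> Z)"
    using assms(1-3,5) by (simp add: l_distr r_distr m_ac a_ac)
  also have "\<dots> = Y" using assms by simp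
  finally show ?thesis .
qed

lemma (in cring) theta_identity_2:
  assumes "Y \<in> carrier R" "B \<in> carrier R" "A \<in> carrier R" "S1 \<in> carrier R" "S2 \<in> carrier R"
    and "Z \<in> carrier R" "K \<in> carrier R" "P \<in> carrier R"
    and "S2 = \<one> \<oplus> B \<otimes> S1" "S1 \<otimes> Z = \<one>" "A \<otimes> B = \<one>" "K \<otimes> (P \<otimes> A) = Y"
  shows "K \<otimes> ((P \<otimes> A) \<otimes> (S2 \<otimes> Z)) = Y \<otimes> Z \<oplus> K \<otimes> P"
proof -
  have "K \<otimes> ((P \<otimes> A) \<otimes> (S2 \<otimes> Z)) = (K \<otimes> (P \<otimes> A)) \<otimes> Z \<oplus> (K \<otimes> P) \<otimes> ((A \<otimes> B) \<otimes> (S1 \<otimes> Z))"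
    unfolding assms(9) using assms(2-4,6-8) by (simp add: l_distr r_distr m_ac)
  also have "\<dots> = Y \<otimes> Z \<oplus> K \<otimes> P" unfolding assms(10-12) using assms by simp
  finally show ?thesis .
qed

section \<open>The operators on a single completion\<close>

context weyl_action
begin

abbreviation gen :: "'i \<Rightarrow> (int^'i \<Rightarrow> int^'i) \<Rightarrow> 'i \<Rightarrow> complex \<Rightarrow> 'i series" where "gen \<equiv> Theta_gen C d q"
abbreviation Th :: "'i \<Rightarrow> (int^'i \<Rightarrow> int^'i) \<Rightarrow> 'i series \<Rightarrow> 'i series" where "Th \<equiv> Theta_w C d q"

lemma gen_other: "j \<noteq> i \<Longrightarrow> gen i w j a = mono_series (Yvar j a)"
  by (simp add: Theta_gen_def Let_def)

lemma gen_same: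
  "gen i w i a = conv (mono_series (Yvar i a - A i (a / qq i)))
     (conv (S (w \<circ> s i) i (a / qq i ^ 3)) (inv\<^bsub>completion C (w \<circ> s i)\<^esub> (S (w \<circ> s i) i (a / qq i))))"
  by (simp add: Theta_gen_def Let_def completion_mult power_int_minus divide_inverse)

text \<open>The two Sigma factors have the same leading weight, 0 or v(\<alpha> i), which cancels in
  the quotient. What remains is Y_i A^{-1} of weight \<open>s i (fund_weight i)\<close>, and the
  reflection is absorbed in passing from w s_i to w.\<close>

lemma gen_unit_below:
  assumes w: "w \<in> W" and a: "a \<noteq> 0"
  shows "gen i w j a \<in> unit_below (w \<circ> s i) (w (fund_weight j))"
proof (cases "j = i")
  case False
  have "(w \<circ> s i) (weight (Yvar j a)) = w (fund_weight j)"
    using False by (simp add: simple_reflection_def fund_weight_nth)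
  then show ?thesis using unit_below_mono[OF W_comp_s[OF w, of i] monomials_Yvar[OF a, of j]] False
    by (simp add: gen_other)
next
  case True
  let ?v = "w \<circ> s i"
  have v: "?v \<in> W" using w by simp
  have nz: "a / qq i \<noteq> 0" "a / qq i ^ 3 \<noteq> 0" using a q_nonzero by simp_all
  have "s i (weight (Yvar i a - A i (a / qq i))) = fund_weight i"
    by (simp add: weight_diff weight_A vec_eq_iff s_nth fund_weight_nth)
  then have "mono_series (Yvar i a - A i (a / qq i)) \<in> unit_below ?v (w (fund_weight i))"
    using unit_below_mono[OF v, of "Yvar i a - A i (a / qq i)"]
      monomials_diff[OF monomials_Yvar[OF a] A_monomials[OF nz(1)]] by simp
  from unit_below_mult[OF v this unit_below_mult[OF v Sigma_unit_below[OF v nz(2), of i]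
      unit_below_inv[OF v Sigma_unit_below[OF v nz(1), of i]]]]
  show ?thesis using True by (simp add: gen_same)
qed

abbreviation Mm :: "'i \<Rightarrow> (int^'i \<Rightarrow> int^'i) \<Rightarrow> 'i monomial \<Rightarrow> 'i series" where
  "Mm i w \<equiv> mono_map (w \<circ> s i) (\<lambda>p. gen i w (fst p) (snd p))"

context
  fixes w and i :: 'i assumes w: "w \<in> W"
begin

lemma gen_ub: "snd p \<noteq> 0 \<Longrightarrow> gen i w (fst p) (snd p) \<in> unit_below (w \<circ> s i) (w (fund_weight (fst p)))"
  by (rule gen_unit_below[OF w])

lemmas mono_facts = mono_map_def[where X = "\<lambda>p. gen i w (fst p) (snd p)" and \<kappa> = "\<lambda>j. w (fund_weight j)",
    OF W_comp_s[OF w] gen_ub] mono_map_add[where X = "\<lambda>p. gen i w (fst p) (snd p)" and \<kappa> = "\<lambda>j. w (fund_weight j)",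
    OF W_comp_s[OF w] gen_ub]
  mono_map_unit_below[where X = "\<lambda>p. gen i w (fst p) (snd p)" and \<kappa> = "\<lambda>j. w (fund_weight j)",
    OF W_comp_s[OF w] gen_ub] mono_map_single[where X = "\<lambda>p. gen i w (fst p) (snd p)" and \<kappa> = "\<lambda>j. w (fund_weight j)",
    OF W_comp_s[OF w] gen_ub]

lemma Th_eq: "Th i w = linear_ext (Mm i w)"
  by (rule ext) (simp add: Theta_w_def linear_ext_def Theta_mono_def Let_def mono_facts(1))

lemma Mm_unit_below:
  assumes "m \<in> monomials" shows "Mm i w m \<in> unit_below (w \<circ> s i) (w (weight m))"
proof -
  have "w (weight m) = (\<Sum>p\<in>Poly_Mapping.keys m. Poly_Mapping.lookup m p *s w (fund_weight (fst p)))"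
  proof -
    have "w (\<Sum>p\<in>T. f p) = (\<Sum>p\<in>T. w (f p))" if "finite T" for T and f :: "'i \<times> complex \<Rightarrow> int^'i"
      using that by (induction T rule: finite_induct) (simp_all add: W_0[OF w] W_add[OF w])
    then show ?thesis by (subst weight_eq_sum[of "Poly_Mapping.keys m"]) (simp_all add: W_scale[OF w])
  qed
  then show ?thesis using mono_facts(3)[OF _ assms] by simp
qed

lemma Mm_carrier: "m \<in> monomials \<Longrightarrow> Mm i w m \<in> completion_carrier C (w \<circ> s i)"
  using unit_below_carrier[OF W_comp_s[OF w] Mm_unit_below] .

lemma Mm_lower: "m \<in> monomials \<Longrightarrow> Mm i w m \<in> lower (w \<circ> s i) 0 (w (weight m))"
  using unit_below_lower[OF W_comp_s[OF w] Mm_unit_below] .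

lemma Mm_add: "m \<in> monomials \<Longrightarrow> n \<in> monomials \<Longrightarrow> Mm i w (m + n) = conv (Mm i w m) (Mm i w n)"
  by (rule mono_facts(2))

lemmas ext_facts = w W_comp_s[OF w] Mm_carrier Mm_lower Mm_add

lemma Th_carrier: "f \<in> completion_carrier C w \<Longrightarrow> Th i w f \<in> completion_carrier C (w \<circ> s i)"
  unfolding Th_eq by (rule linear_ext_carrier[OF ext_facts])

lemma Th_add: "f \<in> completion_carrier C w \<Longrightarrow> g \<in> completion_carrier C w \<Longrightarrow>
    Th i w (\<lambda>n. f n + g n) = (\<lambda>n. Th i w f n + Th i w g n)"
  unfolding Th_eq by (rule linear_ext_add[OF ext_facts])

lemma Th_conv: "f \<in> completion_carrier C w \<Longrightarrow> g \<in> completion_carrier C w \<Longrightarrow>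
    Th i w (conv f g) = conv (Th i w f) (Th i w g)"
  unfolding Th_eq by (rule linear_ext_conv[OF ext_facts])

lemma Th_below: "f \<in> completion_carrier C w \<Longrightarrow> Th i w f n \<noteq> 0 \<Longrightarrow>
    \<exists>m. f m \<noteq> 0 \<and> w (weight m) - (w \<circ> s i) (weight n) \<in> Q_plus C"
  unfolding Th_eq by (rule linear_ext_below[OF ext_facts])

lemma Th_mono: "Th i w (mono_series m) = Mm i w m"
  unfolding Th_eq by (rule linear_ext_mono)

lemma Th_Y: "a \<noteq> 0 \<Longrightarrow> Th i w (mono_series (Yvar j a)) = gen i w j a"
proof -
  assume a: "a \<noteq> 0"
  interpret R: cring "completion C (w \<circ> s i)" by (rule cring_completion[OF W_comp_s[OF w]])
  have "gen i w j a \<in> carrier (completion C (w \<circ> s i))"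
    using unit_below_carrier[OF W_comp_s[OF w] gen_unit_below[OF w a]] by (simp add: completion_sel)
  then have "gen i w j a [^]\<^bsub>completion C (w \<circ> s i)\<^esub> (1::int) = gen i w j a"
    by (simp add: int_pow_def2 del: pow_nat)
  then show ?thesis unfolding Th_mono Yvar_def using mono_facts(4)[of "(j, a)" 1] a by simp
qed

lemma Th_one: "Th i w (mono_series 0) = mono_series 0"
proof -
  interpret R: cring "completion C (w \<circ> s i)" by (rule cring_completion[OF W_comp_s[OF w]])
  have "Mm i w 0 = \<one>\<^bsub>completion C (w \<circ> s i)\<^esub>" by (simp add: mono_facts(1))
  then show ?thesis by (simp add: Th_mono completion_sel)
qed

lemma Th_fixed_add:
  assumes "m \<in> monomials" "n \<in> monomials" "Th i w (mono_series m) = mono_series m" "Th i w (mono_series n) = mono_series n"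
  shows "Th i w (mono_series (m + n)) = mono_series (m + n)"
  using assms unfolding Th_mono by (simp add: Mm_add conv_mono_mono)

lemma Th_uminus_monomial:
  assumes "m \<in> monomials" "conv (Th i w (mono_series m)) g = mono_series 0"
    and g: "g \<in> completion_carrier C (w \<circ> s i)"
  shows "Th i w (mono_series (- m)) = g"
proof -
  interpret degree "deg (w \<circ> s i)" by (rule degree_deg[OF W_comp_s[OF w]])
  let ?h = "Th i w (mono_series (- m))" and ?f = "Th i w (mono_series m)"
  have c: "mono_series m \<in> completion_carrier C w" "mono_series (- m) \<in> completion_carrier C w"
    by (intro completion_mono[OF w] assms monomials_uminus)+
  note nov = completion_nov[OF W_comp_s[OF w]]
  have "conv ?h ?f = mono_series 0"
    using Th_conv[OF c(2,1)] by (simp add: conv_mono_mono Th_one)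
  then have "g = conv (conv ?h ?f) g" by (auto simp: conv_mono_series)
  also have "\<dots> = conv ?h (conv ?f g)" by (intro conv_assoc nov Th_carrier c g)
  also have "\<dots> = ?h" unfolding assms(2) conv_comm[of ?h] by (auto simp: conv_mono_series)
  finally show ?thesis by simp
qed

lemma Th_fixed_uminus:
  assumes "m \<in> monomials" "Th i w (mono_series m) = mono_series m"
  shows "Th i w (mono_series (- m)) = mono_series (- m)"
  by (rule Th_uminus_monomial)
    (use assms in \<open>auto simp: conv_mono_mono intro: completion_mono[OF W_comp_s[OF w]] monomials_uminus\<close>)

lemma Th_other: "j \<noteq> i \<Longrightarrow> a \<noteq> 0 \<Longrightarrow> Th i w (mono_series (Yvar j a)) = mono_series (Yvar j a)"
  by (simp add: Th_Y gen_other)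

lemma Th_sum_fixed:
  assumes "\<And>x. x \<in> T \<Longrightarrow> f x \<in> monomials \<and> Th i w (mono_series (f x)) = mono_series (f x)"
  shows "Th i w (mono_series (sum f T)) = mono_series (sum f T)"
  using assms
proof (induction T rule: infinite_finite_induct)
  case (insert x T)
  then show ?case using Th_fixed_add[of "f x" "sum f T"] monomials_sum[of T f] by simp
qed (simp_all add: Th_one)

lemma Th_K: assumes a: "a \<noteq> 0" shows "Th i w (mono_series (K i a)) = mono_series (K i a)"
proof -
  have Y: "Yvar j b \<in> monomials \<and> Th i w (mono_series (Yvar j b)) = mono_series (Yvar j b)"
    if "C $ j $ i < 0" "b \<noteq> 0" for j b
  proof -
    have "j \<noteq> i" using that(1) by auto
    then show ?thesis using that monomials_Yvar Th_other by simp
  qed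
  have plus: "m + n \<in> monomials \<and> Th i w (mono_series (m + n)) = mono_series (m + n)"
    if "m \<in> monomials \<and> Th i w (mono_series m) = mono_series m"
      "n \<in> monomials \<and> Th i w (mono_series n) = mono_series n" for m n
    using that monomials_add[of m n] Th_fixed_add[of m n] by blast
  have sum: "sum f T \<in> monomials \<and> Th i w (mono_series (sum f T)) = mono_series (sum f T)"
    if "\<And>x. x \<in> T \<Longrightarrow> f x \<in> monomials \<and> Th i w (mono_series (f x)) = mono_series (f x)"
    for f :: "'i \<Rightarrow> 'i monomial" and T
    using Th_sum_fixed[of T f] monomials_sum[of T f] that by simp
  have "K i a \<in> monomials \<and> Th i w (mono_series (K i a)) = mono_series (K i a)"
    unfolding K_def by (intro plus sum) (auto intro!: Y simp: a q_nonzero)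
  then show ?thesis by simp
qed

lemma Y_minus_A: "Yvar i a - A i (a * qq i) = K i (a * qq i) + (- Yvar i (a * (qq i)\<^sup>2))"
  by (simp add: A_eq q_nonzero power2_eq_square mult.assoc)

text \<open>Let Z be the inverse of Sigma at a q_i^{-1}. The operator changes the first summand Y by
  -Y Z and the second by +Y Z, so the sum is unchanged.\<close>

lemma Th_string:
  assumes a: "a \<noteq> 0"
  shows "Th i w (\<lambda>n. mono_series (Yvar i a) n + mono_series (Yvar i a - A i (a * qq i)) n)
    = (\<lambda>n. mono_series (Yvar i a) n + mono_series (Yvar i a - A i (a * qq i)) n)"
proof -
  define v where "v = w \<circ> s i"
  have v: "v \<in> W" using w by (simp add: v_def)
  interpret R: cring "completion C v" by (rule cring_completion[OF v])
  let ?b = "a * qq i" and ?a2 = "a * (qq i)\<^sup>2"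
  define S3 S1 S2 where "S3 = S v i (a / qq i ^ 3)" and "S1 = S v i (a / qq i)" and "S2 = S v i ?b"
  define Z Z2 where "Z = inv\<^bsub>completion C v\<^esub> S1" and "Z2 = inv\<^bsub>completion C v\<^esub> S2"
  have nz: "a / qq i ^ 3 \<noteq> 0" "a / qq i \<noteq> 0" "?b \<noteq> 0" "?a2 \<noteq> 0" using a q_nonzero by simp_all
  note [simp] = completion_sel(1-2) completion_mult
  note mono = completion_mono[OF v]
  have Scar: "S3 \<in> completion_carrier C v" "S1 \<in> completion_carrier C v" "S2 \<in> completion_carrier C v"
    unfolding S3_def S1_def S2_def by (intro unit_below_carrier[OF v Sigma_unit_below[OF v]] nz)+
  have Zcar: "Z \<in> completion_carrier C v" "Z2 \<in> completion_carrier C v"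
    unfolding Z_def Z2_def S1_def S2_def
    by (intro unit_below_carrier[OF v unit_below_inv[OF v Sigma_unit_below[OF v]]] nz)+
  have Z: "conv S1 Z = mono_series 0" "conv S2 Z2 = mono_series 0" unfolding Z_def Z2_def S1_def S2_def
    by (intro unit_below_conv_inv[OF v Sigma_unit_below[OF v]] nz)+
  have S1: "S1 = (\<lambda>n. mono_series 0 n + conv (mono_series (- A i (a / qq i))) S3 n)"
    unfolding S1_def S3_def by (subst Sigma_difference) (simp add: power2_eq_square power3_eq_cube mult.assoc)
  have S2: "S2 = (\<lambda>n. mono_series 0 n + conv (mono_series (- A i ?b)) S1 n)"
    unfolding S1_def S2_def by (subst Sigma_difference) (simp add: power2_eq_square q_nonzero)
  have Ymon: "Yvar i a \<in> monomials" "Yvar i ?a2 \<in> monomials" using a nz by (simp_all add: monomials_Yvar)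
  have Amon: "A i (a / qq i) \<in> monomials" "A i ?b \<in> monomials" using nz by (simp_all add: A_monomials)
  have Kmon: "K i ?b \<in> monomials" using nz by (simp add: K_monomials)
  have x: "Th i w (mono_series (Yvar i a)) = conv (conv (mono_series (Yvar i a)) (mono_series (- A i (a / qq i)))) (conv S3 Z)"
    unfolding Th_Y[OF a] gen_same v_def[symmetric] S3_def S1_def Z_def by (simp add: conv_mono_mono)
  have 1: "(\<lambda>n. Th i w (mono_series (Yvar i a)) n + conv (mono_series (Yvar i a)) Z n) = mono_series (Yvar i a)"
    using R.theta_identity_1[of "mono_series (Yvar i a)" "mono_series (- A i (a / qq i))" S3 S1 Z] S1 Z Scar Zcar
    by (simp add: x mono Ymon Amon monomials_uminus completion_sel)
  let ?P = "mono_series (- Yvar i ?a2)" and ?A = "mono_series (A i ?b)" and ?B = "mono_series (- A i ?b)"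
  \<comment> \<open>The image of Y_{i, a q_i^2} contains the quotient S1/S2, so its inverse contains
    S2/S1; \<open>?X\<close> is this candidate for the image of the inverse variable.\<close>
  let ?X = "conv (conv ?P ?A) (conv S2 Z)"
  have e: "?a2 / qq i ^ 3 = a / qq i" "?a2 / qq i = ?b"
    using q_nonzero by (simp_all add: field_simps power2_eq_square power3_eq_cube)
  have x2: "Th i w (mono_series (Yvar i ?a2)) = conv (conv (mono_series (Yvar i ?a2)) ?B) (conv S1 Z2)"
    unfolding Th_Y[OF nz(4)] gen_same v_def[symmetric] S1_def S2_def Z2_def e by (simp add: conv_mono_mono)
  have Xcar: "?X \<in> completion_carrier C v"
    by (intro completion_conv[OF v] mono monomials_uminus Ymon Amon Scar Zcar)
  have inv: "conv (Th i w (mono_series (Yvar i ?a2))) ?X = mono_series 0"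
  proof -
    let ?m = "monoid.mult (completion C v)"
    have cc: "mono_series (Yvar i ?a2) \<in> carrier (completion C v)" "?B \<in> carrier (completion C v)"
      "?P \<in> carrier (completion C v)" "?A \<in> carrier (completion C v)" "S1 \<in> carrier (completion C v)"
      "S2 \<in> carrier (completion C v)" "Z \<in> carrier (completion C v)" "Z2 \<in> carrier (completion C v)"
      using Scar Zcar by (simp_all add: mono monomials_uminus Ymon Amon)
    have "?m (?m (?m (mono_series (Yvar i ?a2)) ?B) (?m S1 Z2)) (?m (?m ?P ?A) (?m S2 Z))
      = ?m (?m (?m (mono_series (Yvar i ?a2)) ?P) (?m ?A ?B)) (?m (?m S1 Z) (?m S2 Z2))"
      using cc by (simp only: R.m_ac R.m_closed)
    then show ?thesis unfolding x2 by (simp add: Z conv_mono_mono)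
  qed
  have x2i: "Th i w (mono_series (- Yvar i ?a2)) = ?X"
    by (rule Th_uminus_monomial[OF Ymon(2) inv Xcar[unfolded v_def]])
  have KPA: "conv (mono_series (K i ?b)) (conv ?P ?A) = mono_series (Yvar i a)"
    unfolding conv_mono_mono using Y_minus_A[of a] by (intro arg_cong[of _ _ mono_series]) (simp add: algebra_simps)
  have 2: "conv (mono_series (K i ?b)) ?X
      = (\<lambda>n. conv (mono_series (Yvar i a)) Z n + conv (mono_series (K i ?b)) ?P n)"
    using R.theta_identity_2[of "mono_series (Yvar i a)" ?B ?A S1 S2 Z "mono_series (K i ?b)" ?P] S2 Z Scar Zcar KPA
    by (simp add: mono Ymon Amon Kmon monomials_uminus completion_sel conv_mono_mono)
  have c: "mono_series (Yvar i a) \<in> completion_carrier C w" "mono_series (K i ?b) \<in> completion_carrier C w"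
     "mono_series (- Yvar i ?a2) \<in> completion_carrier C w"
    by (intro completion_mono[OF w] Ymon Kmon monomials_uminus)+
  have "Th i w (\<lambda>n. mono_series (Yvar i a) n + mono_series (Yvar i a - A i ?b) n)
    = (\<lambda>n. Th i w (mono_series (Yvar i a)) n + conv (mono_series (K i ?b)) ?X n)"
    unfolding Y_minus_A using Th_add[OF c(1) completion_conv[OF w c(2,3)]] Th_conv[OF c(2,3)] Th_K[OF nz(3)] x2i
    by (simp add: conv_mono_mono)
  also have "\<dots> = (\<lambda>n. (Th i w (mono_series (Yvar i a)) n + conv (mono_series (Yvar i a)) Z n)
      + conv (mono_series (K i ?b)) ?P n)" unfolding 2 by (simp add: add.assoc)
  also have "\<dots> = (\<lambda>n. mono_series (Yvar i a) n + mono_series (Yvar i a - A i ?b) n)"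
    unfolding fun_cong[OF 1] Y_minus_A conv_mono_mono ..
  finally show ?thesis .
qed

end


section \<open>Invariant Laurent polynomials\<close>

text \<open>Invariance is required for all w at once, because the composite along a word passes
  through several completions; a Laurent polynomial lies in each of them.\<close>

definition Inv :: "'i \<Rightarrow> ('i monomial \<Rightarrow>\<^sub>0 int) set" where
  "Inv i = {F. Poly_Mapping.keys F \<subseteq> monomials \<and>
     (\<forall>w\<in>W. Th i w (Poly_Mapping.lookup F) = Poly_Mapping.lookup F)}"

lemma polynomial_carrier: "w \<in> W \<Longrightarrow> Poly_Mapping.keys F \<subseteq> monomials \<Longrightarrow> Poly_Mapping.lookup F \<in> completion_carrier C w"
  by (rule completion_finite_support) (auto simp: in_keys_iff)

lemma Inv_add: assumes "F \<in> Inv i" "G \<in> Inv i" shows "F + G \<in> Inv i"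
proof -
  have l: "Poly_Mapping.lookup (F + G) = (\<lambda>n. Poly_Mapping.lookup F n + Poly_Mapping.lookup G n)"
    by (simp add: fun_eq_iff lookup_add)
  have k: "Poly_Mapping.keys (F + G) \<subseteq> monomials"
    using subset_trans[OF Poly_Mapping.keys_add[of F G]] assms unfolding Inv_def by blast
  have "Th i w (Poly_Mapping.lookup (F + G)) = Poly_Mapping.lookup (F + G)" if w: "w \<in> W" for w
    using Th_add[OF w polynomial_carrier[OF w] polynomial_carrier[OF w], of F G i] assms w
    unfolding l by (simp add: Inv_def)
  with k show ?thesis by (simp add: Inv_def)
qed

lemma Inv_mult: assumes "F \<in> Inv i" "G \<in> Inv i" shows "F * G \<in> Inv i"
proof -
  have k: "Poly_Mapping.keys (F * G) \<subseteq> monomials"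
    using Poly_Mapping.keys_mult[of F G] assms monomials_add unfolding Inv_def by blast
  have "Th i w (Poly_Mapping.lookup (F * G)) = Poly_Mapping.lookup (F * G)" if w: "w \<in> W" for w
    using Th_conv[OF w polynomial_carrier[OF w] polynomial_carrier[OF w], of F G i] assms w
    unfolding lookup_times_conv by (simp add: Inv_def)
  with k show ?thesis by (simp add: Inv_def)
qed

lemma Inv_single:
  assumes "m \<in> monomials" "\<And>w. w \<in> W \<Longrightarrow> Th i w (mono_series m) = mono_series m"
  shows "Poly_Mapping.single m 1 \<in> Inv i"
  using assms by (simp add: Inv_def lookup_single_mono_series del: lookup_frag_of)

lemma Inv_uminus: assumes "F \<in> Inv i" shows "- F \<in> Inv i"
proof -
  have m: "Poly_Mapping.single 0 (-1) \<in> Inv i"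
  proof -
    have "Th i w (\<lambda>n. - mono_series 0 n) = (\<lambda>n. - mono_series 0 n)" if w: "w \<in> W" for w
    proof
      fix n
      have c: "mono_series 0 \<in> completion_carrier C w" by (rule completion_mono[OF w monomials_0])
      have "Th i w (\<lambda>_. 0) = (\<lambda>_. 0)"
        using Th_add[OF w completion_zero[OF w] completion_zero[OF w], of i] by (simp add: fun_eq_iff)
      then show "Th i w (\<lambda>n. - mono_series 0 n) n = - mono_series 0 n"
        using fun_cong[OF Th_add[OF w c completion_uminus[OF w c], of i], of n] Th_one[OF w, of i] by simp
    qed
    moreover have "Poly_Mapping.lookup (Poly_Mapping.single 0 (-1)) = (\<lambda>n. - mono_series (0 :: 'i monomial) n)"
      by (auto simp: fun_eq_iff lookup_single mono_series_def when_def)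
    ultimately show ?thesis using monomials_0 by (simp add: Inv_def)
  qed
  have "Poly_Mapping.single 0 (-1) * F = - F" by (simp add: single_uminus)
  then show ?thesis using Inv_mult[OF m assms] by simp
qed

lemma Inv_diff: "F \<in> Inv i \<Longrightarrow> G \<in> Inv i \<Longrightarrow> F - G \<in> Inv i"
  using Inv_add[OF _ Inv_uminus, of F i G] by simp

lemma Inv_string: assumes "a \<noteq> 0"
  shows "Poly_Mapping.single (Yvar i a) 1 + Poly_Mapping.single (Yvar i a - A i (a * qq i)) 1 \<in> Inv i"
proof -
  have m: "Yvar i a \<in> monomials" "Yvar i a - A i (a * qq i) \<in> monomials"
    using assms q_nonzero by (simp_all add: monomials_Yvar monomials_diff A_monomials)
  have l: "Poly_Mapping.lookup (Poly_Mapping.single (Yvar i a) 1 + Poly_Mapping.single (Yvar i a - A i (a * qq i)) 1)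
     = (\<lambda>n. mono_series (Yvar i a) n + mono_series (Yvar i a - A i (a * qq i)) n)"
    by (rule ext) (simp only: lookup_add lookup_single_mono_series)
  show ?thesis unfolding Inv_def
  proof (intro CollectI conjI ballI)
    show "Poly_Mapping.keys (Poly_Mapping.single (Yvar i a) 1 + Poly_Mapping.single (Yvar i a - A i (a * qq i)) 1) \<subseteq> monomials"
      by (rule subset_trans[OF Poly_Mapping.keys_add]) (use m in simp)
  qed (unfold l, rule Th_string[OF _ assms])
qed

section \<open>Words in the operators\<close>

text \<open>The argument v is the target component; the source is \<open>v \<circ> sw is\<close>.
  Indexing by the target matches \<open>Theta\<close>, whose v-component reads the component v
  s_i.\<close>

fun TW :: "'i list \<Rightarrow> (int^'i \<Rightarrow> int^'i) \<Rightarrow> 'i series \<Rightarrow> 'i series" where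
  "TW [] v f = f"
| "TW (i # is) v f = Th i (v \<circ> s i) (TW is (v \<circ> s i) f)"

lemma comp_sw_Cons: "v \<circ> s i \<circ> sw is = v \<circ> sw (i # is)"
  by (simp add: sw_Cons comp_assoc)

lemma TW_carrier: "v \<in> W \<Longrightarrow> f \<in> completion_carrier C (v \<circ> sw is) \<Longrightarrow> TW is v f \<in> completion_carrier C v"
proof (induction "is" arbitrary: v)
  case (Cons i "is")
  have "TW is (v \<circ> s i) f \<in> completion_carrier C (v \<circ> s i)"
    by (rule Cons.IH) (use Cons.prems in \<open>simp_all only: comp_sw_Cons W_comp_s\<close>)
  from Th_carrier[OF _ this, of i] show ?case using Cons.prems(1) by (simp only: comp_s_s W_comp_s TW.simps)
qed simp

lemma TW_append: "TW (is @ js) v f = TW is v (TW js (v \<circ> sw is) f)"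
  by (induction "is" arbitrary: v) (simp_all only: TW.simps append_Cons append_Nil sw_Nil comp_id comp_sw_Cons)

lemma TW_add:
  "v \<in> W \<Longrightarrow> f \<in> completion_carrier C (v \<circ> sw is) \<Longrightarrow> g \<in> completion_carrier C (v \<circ> sw is) \<Longrightarrow>
    TW is v (\<lambda>n. f n + g n) = (\<lambda>n. TW is v f n + TW is v g n)"
proof (induction "is" arbitrary: v)
  case (Cons i "is")
  have v: "v \<circ> s i \<in> W" using Cons.prems(1) by (rule W_comp_s)
  have c: "f \<in> completion_carrier C (v \<circ> s i \<circ> sw is)" "g \<in> completion_carrier C (v \<circ> s i \<circ> sw is)"
    using Cons.prems(2,3) by (simp_all only: comp_sw_Cons)
  show ?case using Cons.IH[OF v c] Th_add[OF v TW_carrier[OF v c(1)] TW_carrier[OF v c(2)], of i]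
    by (simp only: TW.simps)
qed simp

lemma TW_conv:
  "v \<in> W \<Longrightarrow> f \<in> completion_carrier C (v \<circ> sw is) \<Longrightarrow> g \<in> completion_carrier C (v \<circ> sw is) \<Longrightarrow>
    TW is v (conv f g) = conv (TW is v f) (TW is v g)"
proof (induction "is" arbitrary: v)
  case (Cons i "is")
  have v: "v \<circ> s i \<in> W" using Cons.prems(1) by (rule W_comp_s)
  have c: "f \<in> completion_carrier C (v \<circ> s i \<circ> sw is)" "g \<in> completion_carrier C (v \<circ> s i \<circ> sw is)"
    using Cons.prems(2,3) by (simp_all only: comp_sw_Cons)
  show ?case using Cons.IH[OF v c] Th_conv[OF v TW_carrier[OF v c(1)] TW_carrier[OF v c(2)], of i]
    by (simp only: TW.simps)
qed simp

lemma TW_one: "v \<in> W \<Longrightarrow> TW is v (mono_series 0) = mono_series 0"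
  by (induction "is" arbitrary: v) (simp_all add: Th_one)

lemma TW_below:
  "v \<in> W \<Longrightarrow> f \<in> completion_carrier C (v \<circ> sw is) \<Longrightarrow> TW is v f n \<noteq> 0 \<Longrightarrow>
    \<exists>m. f m \<noteq> 0 \<and> (v \<circ> sw is) (weight m) - v (weight n) \<in> Q_plus C"
proof (induction "is" arbitrary: v n)
  case Nil
  then show ?case by (intro exI[of _ n]) simp
next
  case (Cons i "is")
  have v: "v \<circ> s i \<in> W" using Cons.prems(1) by (rule W_comp_s)
  have c: "f \<in> completion_carrier C (v \<circ> s i \<circ> sw is)" using Cons.prems(2) by (simp only: comp_sw_Cons)
  have "Th i (v \<circ> s i) (TW is (v \<circ> s i) f) n \<noteq> 0" using Cons.prems(3) unfolding TW.simps .
  from Th_below[OF v TW_carrier[OF v c] this] obtain m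
    where m: "TW is (v \<circ> s i) f m \<noteq> 0" "(v \<circ> s i) (weight m) - (v \<circ> s i \<circ> s i) (weight n) \<in> Q_plus C" by blast
  from Cons.IH[OF v c m(1)] obtain k
    where k: "f k \<noteq> 0" "(v \<circ> s i \<circ> sw is) (weight k) - (v \<circ> s i) (weight m) \<in> Q_plus C" by blast
  have "(v \<circ> s i \<circ> sw is) (weight k) - (v \<circ> s i \<circ> s i) (weight n) \<in> Q_plus C"
    using Q_plus_add[OF k(2) m(2)] by simp
  then show ?case using k(1) unfolding comp_s_s comp_sw_Cons by blast
qed

lemma TW_Inv:
  "v \<in> W \<Longrightarrow> \<forall>i\<in>set is. F \<in> Inv i \<Longrightarrow> TW is v (Poly_Mapping.lookup F) = Poly_Mapping.lookup F"
proof (induction "is" arbitrary: v)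
  case (Cons i "is")
  have v: "v \<circ> s i \<in> W" using Cons.prems(1) by (rule W_comp_s)
  have "TW is (v \<circ> s i) (Poly_Mapping.lookup F) = Poly_Mapping.lookup F"
    by (rule Cons.IH[OF v]) (use Cons.prems(2) in simp)
  moreover have "Th i (v \<circ> s i) (Poly_Mapping.lookup F) = Poly_Mapping.lookup F"
    using v Cons.prems(2) unfolding Inv_def by simp
  ultimately show ?case unfolding TW.simps by simp
qed simp


subsection \<open>A uniqueness principle\<close>

text \<open>Comparing an invariant of the form \<open>g + lower terms\<close> with its image shows that the image of
  \<open>g\<close> agrees with \<open>g\<close> to one order more than is already known for all monomials.\<close>

context
  fixes v and "is" :: "'i list" and G :: "'i monomial set"
  assumes v: "v \<in> W" and trivial: "sw is = id"
    and generates: "\<And>H m. G \<subseteq> H \<Longrightarrow> 0 \<in> H \<Longrightarrow> (\<And>m n. m \<in> H \<Longrightarrow> n \<in> H \<Longrightarrow> m - n \<in> H) \<Longrightarrow> m \<in> monomials \<Longrightarrow> m \<in> H"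
    and G_monomials: "G \<subseteq> monomials"
    and invariants: "\<And>g. g \<in> G \<Longrightarrow> \<exists>F. (\<forall>i\<in>set is. F \<in> Inv i) \<and> Poly_Mapping.keys F \<subseteq> monomials \<and>
      (\<forall>p\<in>Poly_Mapping.keys (F - Poly_Mapping.single g 1). v (weight g - weight p) \<in> Q_plus C \<and> weight g \<noteq> weight p)"
begin

interpretation degree "deg v" by (rule degree_deg[OF v])

lemma TW_carrier': "f \<in> completion_carrier C v \<Longrightarrow> TW is v f \<in> completion_carrier C v"
  and TW_add': "f \<in> completion_carrier C v \<Longrightarrow> g \<in> completion_carrier C v \<Longrightarrow>
    TW is v (\<lambda>n. f n + g n) = (\<lambda>n. TW is v f n + TW is v g n)"
  and TW_conv': "f \<in> completion_carrier C v \<Longrightarrow> g \<in> completion_carrier C v \<Longrightarrow>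
    TW is v (conv f g) = conv (TW is v f) (TW is v g)"
  and TW_below': "f \<in> completion_carrier C v \<Longrightarrow> TW is v f n \<noteq> 0 \<Longrightarrow>
    \<exists>m. f m \<noteq> 0 \<and> v (weight m) - v (weight n) \<in> Q_plus C"
  using TW_carrier[OF v, of f "is"] TW_add[OF v, of f "is" g] TW_conv[OF v, of f "is" g] TW_below[OF v, of f "is" n]
  by (simp_all add: trivial)

lemma TW_diff':
  assumes "f \<in> completion_carrier C v" "g \<in> completion_carrier C v"
  shows "TW is v (\<lambda>n. f n - g n) = (\<lambda>n. TW is v f n - TW is v g n)"
  using TW_add'[OF completion_diff[OF v assms] assms(2)] by (simp add: fun_eq_iff)

definition err :: "'i series \<Rightarrow> 'i series" where "err f = (\<lambda>n. TW is v f n - f n)"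

lemma err_diff:
  assumes "f \<in> completion_carrier C v" "g \<in> completion_carrier C v"
  shows "err (\<lambda>n. f n - g n) = (\<lambda>n. err f n - err g n)"
  unfolding err_def TW_diff'[OF assms] by (simp add: fun_eq_iff)

lemma err_polynomial:
  assumes "Poly_Mapping.keys F \<subseteq> T" "T \<subseteq> monomials" "\<And>m. m \<in> T \<Longrightarrow> err (mono_series m) \<in> lower v n \<nu>"
  shows "err (Poly_Mapping.lookup F) \<in> lower v n \<nu>"
proof -
  have "Poly_Mapping.keys F \<subseteq> monomials \<and> err (Poly_Mapping.lookup F) \<in> lower v n \<nu>"
    using assms(1)
  proof (induction F rule: frag_induction)
    case zero
    have "err (\<lambda>_. 0) = (\<lambda>_. 0)"
      using err_diff[OF completion_zero[OF v] completion_zero[OF v]] by (simp add: fun_eq_iff)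
    moreover have "Poly_Mapping.lookup 0 = (\<lambda>_ :: 'i monomial. 0 :: int)" by (simp add: fun_eq_iff)
    ultimately show ?case by (simp add: lower_zero)
  next
    case (one m)
    then show ?case using assms(2,3) by (auto simp: lookup_single_mono_series simp del: lookup_frag_of)
  next
    case (diff F G)
    have l: "Poly_Mapping.lookup (F - G) = (\<lambda>n. Poly_Mapping.lookup F n - Poly_Mapping.lookup G n)"
      by (simp add: fun_eq_iff lookup_minus)
    have "err (Poly_Mapping.lookup (F - G)) = (\<lambda>n. err (Poly_Mapping.lookup F) n + - err (Poly_Mapping.lookup G) n)"
      unfolding l using err_diff[of "Poly_Mapping.lookup F" "Poly_Mapping.lookup G"] diff
      by (simp add: polynomial_carrier[OF v])
    moreover have "(\<lambda>n. err (Poly_Mapping.lookup F) n + - err (Poly_Mapping.lookup G) n) \<in> lower v n \<nu>"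
      by (rule lower_add[OF _ lower_uminus]) (use diff in simp_all)
    moreover have "Poly_Mapping.keys (F - G) \<subseteq> monomials"
      using Poly_Mapping.keys_diff[of F G] diff by blast
    ultimately show ?case by simp
  qed
  then show ?thesis ..
qed

text \<open>Agreement is measured relative to the weight of each monomial, which makes these
  monomials a subgroup (\<open>good_diff\<close>).\<close>

definition good :: "nat \<Rightarrow> 'i monomial set" where
  "good n = {m \<in> monomials. err (mono_series m) \<in> lower v (real n) (v (weight m))}"

text \<open>The error at m - k, multiplied by k, is the error at m minus the image of m - k times
  the error at k. Both terms have depth n below the weight of m, and shifting back by k gives the
  claim.\<close>

lemma good_diff: assumes "m \<in> good n" "k \<in> good n" shows "m - k \<in> good n"
proof -
  have mk: "m \<in> monomials" "k \<in> monomials" "m - k \<in> monomials" using assms monomials_diff by (auto simp: good_def)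
  let ?D = "err (mono_series (m - k))"
  note c = completion_mono[OF v mk(1)] completion_mono[OF v mk(2)] completion_mono[OF v mk(3)]
  note Tc = TW_carrier'[OF c(1)] TW_carrier'[OF c(2)] TW_carrier'[OF c(3)]
  note nov = completion_nov[OF v]
  have T: "TW is v (mono_series m) = conv (TW is v (mono_series (m - k))) (TW is v (mono_series k))"
    using TW_conv'[OF c(3,2)] by (simp add: conv_mono_mono)
  have low0: "TW is v (mono_series (m - k)) \<in> lower v 0 (v (weight (m - k)))"
    unfolding lower_def using TW_below'[OF c(3)] height_nonneg by fastforce
  have "conv (TW is v (mono_series (m - k))) (err (mono_series k))
     \<in> lower v (0 + real n) (v (weight (m - k)) + v (weight k))"
    by (rule lower_conv[OF v low0]) (use assms(2) in \<open>simp add: good_def\<close>)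
  moreover have "v (weight (m - k)) + v (weight k) = v (weight m)"
    by (simp add: weight_diff W_diff[OF v])
  ultimately have 1: "conv (TW is v (mono_series (m - k))) (err (mono_series k)) \<in> lower v (real n) (v (weight m))" by simp
  have D: "?D (p - k) = err (mono_series m) p + - conv (TW is v (mono_series (m - k))) (err (mono_series k)) p" for p
  proof -
    have "conv (TW is v (mono_series (m - k))) (err (mono_series k)) p
      = conv (TW is v (mono_series (m - k))) (TW is v (mono_series k)) p
        - conv (TW is v (mono_series (m - k))) (mono_series k) p"
      unfolding err_def conv_comm[of "TW is v (mono_series (m - k))"]
      by (subst conv_diff_left) (intro nov Tc c refl)+
    also have "conv (TW is v (mono_series (m - k))) (mono_series k) p = TW is v (mono_series (m - k)) (p - k)"
      unfolding conv_comm[of _ "mono_series k"] conv_mono_series ..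
    finally show ?thesis unfolding err_def T by (simp add: mono_series_def algebra_simps)
  qed
  have 2: "(\<lambda>p. ?D (p - k)) \<in> lower v (real n) (v (weight m))"
    unfolding D by (rule lower_add[OF _ lower_uminus[OF 1]]) (use assms(1) in \<open>simp add: good_def\<close>)
  have "?D \<in> lower v (real n) (v (weight (m - k)))"
    unfolding lower_def
  proof (intro CollectI allI impI)
    fix p assume "?D p \<noteq> 0"
    then have "?D ((p + k) - k) \<noteq> 0" by simp
    with 2 have "v (weight m) - v (weight (p + k)) \<in> Q_plus C \<and> real n \<le> height (v (weight m) - v (weight (p + k)))"
      unfolding lower_def by blast
    moreover have "v (weight m) - v (weight (p + k)) = v (weight (m - k)) - v (weight p)"
      by (simp add: weight_diff weight_add W_diff[OF v] W_add[OF v])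
    ultimately show "v (weight (m - k)) - v (weight p) \<in> Q_plus C \<and> real n \<le> height (v (weight (m - k)) - v (weight p))"
      by simp
  qed
  then show ?thesis using mk by (simp add: good_def)
qed

lemma good_0: "0 \<in> good n"
  using TW_one[OF v, of "is"] monomials_0 by (simp add: good_def err_def lower_zero)

lemma good_Suc: assumes all: "monomials \<subseteq> good n" and g: "g \<in> G" shows "g \<in> good (Suc n)"
proof -
  have gm: "g \<in> monomials" using g G_monomials by blast
  obtain F where F: "\<forall>i\<in>set is. F \<in> Inv i" "Poly_Mapping.keys F \<subseteq> monomials"
    "\<And>p. p \<in> Poly_Mapping.keys (F - Poly_Mapping.single g 1) \<Longrightarrow> v (weight g - weight p) \<in> Q_plus C \<and> weight g \<noteq> weight p"
    using invariants[OF g] by blast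
  define E where "E = F - Poly_Mapping.single g 1"
  have Em: "Poly_Mapping.keys E \<subseteq> monomials"
    using Poly_Mapping.keys_diff[of F "Poly_Mapping.single g 1"] F(2) gm unfolding E_def by auto
  have lE: "Poly_Mapping.lookup E = (\<lambda>n. Poly_Mapping.lookup F n - mono_series g n)"
    unfolding E_def by (rule ext) (simp only: lookup_minus lookup_single_mono_series)
  have "err (Poly_Mapping.lookup F) = (\<lambda>_. 0)" unfolding err_def using TW_Inv[OF v F(1)] by simp
  then have eE: "err (Poly_Mapping.lookup E) = (\<lambda>p. - err (mono_series g) p)"
    unfolding lE using err_diff[OF polynomial_carrier[OF v F(2)] completion_mono[OF v gm]] by simp
  have "err (Poly_Mapping.lookup E) \<in> lower v (real (Suc n)) (v (weight g))"
  proof (rule err_polynomial[OF subset_refl Em])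
    fix m assume m: "m \<in> Poly_Mapping.keys E"
    then have *: "v (weight g) - v (weight m) \<in> Q_plus C" "weight g \<noteq> weight m"
      using F(3) unfolding E_def by (auto simp: W_diff[OF v])
    then have "v (weight g) - v (weight m) \<noteq> 0" using W_inj[OF v] by (auto dest: injD)
    \<comment> \<open>This is the gained order: a nonzero element of the positive cone has height at
      least 1.\<close>
    then have h: "height (v (weight g) - v (weight m)) \<ge> 1" by (rule height_ge_1[OF *(1)])
    have "err (mono_series m) \<in> lower v (real n) (v (weight m))" using m Em all by (auto simp: good_def)
    from lower_trans[OF this *(1) refl] show "err (mono_series m) \<in> lower v (real (Suc n)) (v (weight g))"
      by (rule lower_mono) (use h in simp)
  qed
  from lower_uminus[OF this] have "err (mono_series g) \<in> lower v (real (Suc n)) (v (weight g))" unfolding eE by simp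
  then show ?thesis using gm by (simp add: good_def)
qed

lemma all_good: "monomials \<subseteq> good n"
proof (induction n)
  case 0
  show ?case
  proof
    fix m :: "'i monomial" assume m: "m \<in> monomials"
    have "TW is v (mono_series m) \<in> lower v 0 (v (weight m))"
      unfolding lower_def using TW_below'[OF completion_mono[OF v m]] height_nonneg by fastforce
    from lower_add[OF this lower_uminus[OF lower_mono_series[of m v]]]
    show "m \<in> good 0" using m by (simp add: good_def err_def)
  qed
next
  case (Suc n)
  show ?case
  proof
    fix m :: "'i monomial" assume m: "m \<in> monomials"
    show "m \<in> good (Suc n)"
      by (rule generates[OF _ _ _ m]) (use good_Suc[OF Suc] good_0 good_diff in auto)
  qed
qed

lemma err_mono: assumes "m \<in> monomials" shows "err (mono_series m) p = 0"
proof (rule ccontr)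
  assume "err (mono_series m) p \<noteq> 0"
  then have "real n \<le> height (v (weight m) - v (weight p))" for n
    using all_good[of n] assms by (auto simp: good_def lower_def)
  then show False using reals_Archimedean2 not_less by blast
qed

lemma err_finite:
  assumes "Poly_Mapping.keys F \<subseteq> monomials" shows "err (Poly_Mapping.lookup F) p = 0"
proof (rule ccontr)
  assume p: "err (Poly_Mapping.lookup F) p \<noteq> 0"
  have "err (Poly_Mapping.lookup F) \<in> lower v n \<nu>" for n \<nu>
    by (rule err_polynomial[OF assms subset_refl]) (simp add: lower_def err_mono)
  then have "n \<le> height (0 - v (weight p))" for n using p unfolding lower_def by blast
  from this[of "height (0 - v (weight p)) + 1"] show False by simp
qed

text \<open>To compare the coefficients at \<open>p\<close>, split \<open>f\<close> at the degree of
  \<open>p\<close>. The upper part is a Laurent polynomial and is fixed; the image of the lower part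
  stays in smaller degrees and cannot reach \<open>p\<close>.\<close>

lemma TW_trivial: assumes f: "f \<in> completion_carrier C v" shows "TW is v f = f"
proof
  fix p
  define f1 where "f1 = (\<lambda>m. if deg v m \<ge> deg v p then f m else 0)"
  define f2 where "f2 = (\<lambda>m. f m - f1 m)"
  have fin: "finite {m. f1 m \<noteq> 0}"
    using novD[OF completion_nov[OF v f], of "deg v p"] unfolding f1_def by (auto elim: rev_finite_subset)
  define F where "F = Abs_poly_mapping f1"
  have l: "Poly_Mapping.lookup F = f1" unfolding F_def using fin by simp
  have F: "Poly_Mapping.keys F \<subseteq> monomials"
    using completion_monomials[OF v f] by (auto simp: in_keys_iff l f1_def split: if_splits)
  have c1: "f1 \<in> completion_carrier C v" using polynomial_carrier[OF v F] l by simp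
  have c2: "f2 \<in> completion_carrier C v" unfolding f2_def by (rule completion_diff[OF v f c1])
  have "TW is v f2 p = 0"
  proof (rule ccontr)
    assume "TW is v f2 p \<noteq> 0"
    from TW_below'[OF c2 this] obtain m where m: "f2 m \<noteq> 0" "v (weight m) - v (weight p) \<in> Q_plus C" by blast
    from height_nonneg[OF m(2)] m(1) show False by (simp add: f2_def f1_def height_diff)
  qed
  moreover have "f2 p = 0" by (simp add: f2_def f1_def)
  moreover have "TW is v f1 p = f1 p" using err_finite[OF F, of p] unfolding l err_def by simp
  moreover have "f = (\<lambda>n. f1 n + f2 n)" by (simp add: f2_def)
  ultimately show "TW is v f p = f p" using TW_add'[OF c1 c2] by metis
qed

end

lemma monomials_generated:
  assumes "\<And>j a. a \<noteq> 0 \<Longrightarrow> Yvar j a \<in> H" "0 \<in> H" "\<And>m n. m \<in> H \<Longrightarrow> n \<in> H \<Longrightarrow> m - n \<in> H" "m \<in> monomials"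
  shows "m \<in> H"
proof -
  have "Poly_Mapping.keys m \<subseteq> {p. snd p \<noteq> 0}" using assms(4) by (auto simp: monomials_def)
  then show ?thesis
  proof (induction m rule: frag_induction)
    case (one p)
    then show ?case using assms(1)[of "snd p" "fst p"] by (simp add: Yvar_def)
  qed (use assms in auto)
qed

lemma Inv_other: assumes "j \<noteq> i" "a \<noteq> 0" shows "Poly_Mapping.single (Yvar j a) 1 \<in> Inv i"
  by (rule Inv_single) (use assms monomials_Yvar Th_other in auto)

text \<open>In the completion at v the invariant Y_i (1 + A^{-1}) leads with Y_i or with Y_i A^{-1},
  according to the sign of v(\<alpha> i). The latter is an inverse variable of node i times
  neighbours, so either family generates.\<close>

lemma TW_involution:
  assumes v: "v \<in> W" and f: "f \<in> completion_carrier C v"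
  shows "TW [i, i] v f = f"
proof -
  let ?Z = "\<lambda>a. Yvar i a - A i (a * qq i)"
  define pos where "pos \<longleftrightarrow> v (\<alpha> i) \<in> Q_plus C"
  define g where "g = (\<lambda>a. if pos then Yvar i a else ?Z a)"
  define G where "G = {Yvar j a | j a. j \<noteq> i \<and> a \<noteq> 0} \<union> {g a | a. a \<noteq> 0}"
  have Zm: "?Z a \<in> monomials" if "a \<noteq> 0" for a
    using that q_nonzero by (simp add: monomials_Yvar monomials_diff A_monomials)
  have sw: "sw [i, i] = id" by (simp add: sw_Cons)
  show ?thesis
  proof (rule TW_trivial[OF v sw, of G])
    show "f \<in> completion_carrier C v" by (rule f)
    show "G \<subseteq> monomials" unfolding G_def g_def by (auto simp: Zm intro!: monomials_Yvar)
    fix H :: "'i monomial set" and m :: "'i monomial"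
    assume H: "G \<subseteq> H" "0 \<in> H" "\<And>m n. m \<in> H \<Longrightarrow> n \<in> H \<Longrightarrow> m - n \<in> H" and m: "m \<in> monomials"
    have add: "m + n \<in> H" if "m \<in> H" "n \<in> H" for m n
      using H(3)[OF that(1) H(3)[OF H(2) that(2)]] by simp
    have sum: "sum f T \<in> H" if "\<And>x. x \<in> T \<Longrightarrow> f x \<in> H" for f :: "'i \<Rightarrow> 'i monomial" and T
      using that by (induction T rule: infinite_finite_induct) (simp_all add: H(2) add)
    have other: "Yvar j a \<in> H" if "j \<noteq> i" "a \<noteq> 0" for j a using H(1) that unfolding G_def by blast
    have KH: "K i a \<in> H" if "a \<noteq> 0" for a
    proof -
      have o: "Yvar j b \<in> H" if "C $ j $ i < 0" "b \<noteq> 0" for j b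
        using other[of j b] that by force
      show ?thesis unfolding K_def by (intro add sum) (auto intro!: o simp: that q_nonzero)
    qed
    have gH: "g a \<in> H" if "a \<noteq> 0" for a using H(1) that unfolding G_def by blast
    have same: "Yvar i a \<in> H" if a: "a \<noteq> 0" for a
    proof (cases pos)
      case True then show ?thesis using gH[OF a] by (simp add: g_def)
    next
      case False
      \<comment> \<open>With b = a q_i^{-2} the monomial \<open>g b\<close> is K_{i, b q_i} divided
        by Y_{i,a}, from which the variable is recovered.\<close>
      define b where "b = a / (qq i)\<^sup>2"
      have b: "b \<noteq> 0" "b * (qq i)\<^sup>2 = a" "b * qq i \<noteq> 0" using a q_nonzero by (simp_all add: b_def)
      have "g b = K i (b * qq i) - Yvar i a"
        using False Y_minus_A[OF W_id, of i b] b(2) by (simp add: g_def)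
      then have "Yvar i a = K i (b * qq i) - g b" by simp
      then show ?thesis using H(3)[OF KH[OF b(3)] gH[OF b(1)]] by simp
    qed
    have all: "Yvar j a \<in> H" if "a \<noteq> 0" for j a using other[of j a] same[of a] that by (cases "j = i") auto
    show "m \<in> H" by (rule monomials_generated[OF all H(2,3) m])
  next
    fix g' assume g': "g' \<in> G"
    then consider j a where "g' = Yvar j a" "j \<noteq> i" "a \<noteq> 0" | a where "g' = g a" "a \<noteq> 0" unfolding G_def by blast
    then show "\<exists>F. (\<forall>i\<in>set [i, i]. F \<in> Inv i) \<and> Poly_Mapping.keys F \<subseteq> monomials \<and>
      (\<forall>p\<in>Poly_Mapping.keys (F - Poly_Mapping.single g' 1). v (weight g' - weight p) \<in> Q_plus C \<and> weight g' \<noteq> weight p)"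
    proof cases
      case (1 j a)
      then show ?thesis using Inv_other[of j i a] monomials_Yvar[of a j]
        by (intro exI[of _ "Poly_Mapping.single (Yvar j a) 1"]) simp
    next
      case (2 a)
      define F where "F = Poly_Mapping.single (Yvar i a) 1 + Poly_Mapping.single (?Z a) (1 :: int)"
      have F: "F \<in> Inv i" unfolding F_def by (rule Inv_string[OF 2(2)])
      show ?thesis
      proof (cases pos)
        case True
        have "F - Poly_Mapping.single g' 1 = Poly_Mapping.single (?Z a) 1" using True by (simp add: F_def 2 g_def)
        then show ?thesis using F True simple_root_nonzero
          by (intro exI[of _ F]) (auto simp: 2 g_def pos_def weight_diff weight_A Inv_def)
      next
        case False
        then have neg: "- v (\<alpha> i) \<in> Q_plus C" using root_dichotomy[OF v] unfolding pos_def by blast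
        have "F - Poly_Mapping.single g' 1 = Poly_Mapping.single (Yvar i a) 1" using False by (simp add: F_def 2 g_def)
        then show ?thesis using F False neg simple_root_nonzero
          by (intro exI[of _ F]) (auto simp: 2 g_def weight_diff weight_A W_uminus[OF v] Inv_def)
      qed
    qed
  qed
qed

end

section \<open>Invariants in rank two\<close>

text \<open>At least one factor is divided off, which later makes the weight strictly lower.
  Divisions by \<open>Ai\<close> and \<open>Aj\<close> may come in any order, matching the branching
  of the q-characters.\<close>

inductive_set below :: "(int \<Rightarrow> 'm::ab_group_add) \<Rightarrow> (int \<Rightarrow> 'm) \<Rightarrow> 'm \<Rightarrow> 'm set" for Ai Aj g where
  "g - Ai n \<in> below Ai Aj g"
| "g - Aj n \<in> below Ai Aj g"
| "m \<in> below Ai Aj g \<Longrightarrow> m - Ai n \<in> below Ai Aj g"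
| "m \<in> below Ai Aj g \<Longrightarrow> m - Aj n \<in> below Ai Aj g"

lemma below_swap: "below Aj Ai g \<subseteq> below Ai Aj g"
proof
  fix m assume "m \<in> below Aj Ai g"
  then show "m \<in> below Ai Aj g" by induction (auto intro: below.intros)
qed

lemma keys_add_subset: "Poly_Mapping.keys F \<subseteq> S \<Longrightarrow> Poly_Mapping.keys G \<subseteq> S \<Longrightarrow> Poly_Mapping.keys (F + G) \<subseteq> S"
  using Poly_Mapping.keys_add[of F G] by blast

lemma keys_single_subset: "m \<in> S \<Longrightarrow> Poly_Mapping.keys (frag_of m) \<subseteq> S" by simp

text \<open>\<open>y\<close> and \<open>z\<close> are the variables of the two nodes along a \<open>q\<close>-string, \<open>Ai\<close> and \<open>Aj\<close> the
  corresponding monomials \<open>A\<close>; \<open>Fi\<close> and \<open>Ii\<close> are the monomials and the polynomials invariant under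
  the operator of the first node. The variables of the other nodes enter \<open>Ai\<close> through a factor that
  is invariant under both operators.\<close>

locale rank_two =
  fixes y z Ai Aj e f :: "int \<Rightarrow> 'm::ab_group_add" and di dj :: int
    and Fi Fj :: "'m set" and Ii Ij :: "('m \<Rightarrow>\<^sub>0 int) set"
  assumes Fi_0: "0 \<in> Fi" and Fi_diff: "\<And>m n. m \<in> Fi \<Longrightarrow> n \<in> Fi \<Longrightarrow> m - n \<in> Fi"
    and Fj_0: "0 \<in> Fj" and Fj_diff: "\<And>m n. m \<in> Fj \<Longrightarrow> n \<in> Fj \<Longrightarrow> m - n \<in> Fj"
    and Fi_var: "\<And>n. z n \<in> Fi" "\<And>n. e n \<in> Fi" "\<And>n. f n \<in> Fi"
    and Fj_var: "\<And>n. y n \<in> Fj" "\<And>n. e n \<in> Fj" "\<And>n. f n \<in> Fj"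
    and Ii_add: "\<And>F G. F \<in> Ii \<Longrightarrow> G \<in> Ii \<Longrightarrow> F + G \<in> Ii"
    and Ii_diff: "\<And>F G. F \<in> Ii \<Longrightarrow> G \<in> Ii \<Longrightarrow> F - G \<in> Ii"
    and Ii_mult: "\<And>F G. F \<in> Ii \<Longrightarrow> G \<in> Ii \<Longrightarrow> F * G \<in> Ii"
    and Ij_add: "\<And>F G. F \<in> Ij \<Longrightarrow> G \<in> Ij \<Longrightarrow> F + G \<in> Ij"
    and Ij_mult: "\<And>F G. F \<in> Ij \<Longrightarrow> G \<in> Ij \<Longrightarrow> F * G \<in> Ij"
    and Ii_single: "\<And>m. m \<in> Fi \<Longrightarrow> frag_of m \<in> Ii"
    and Ij_single: "\<And>m. m \<in> Fj \<Longrightarrow> frag_of m \<in> Ij"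
    and Ii_string: "\<And>n. frag_of (y n) + frag_of (y n - Ai (n + di)) \<in> Ii"
    and Ij_string: "\<And>n. frag_of (z n) + frag_of (z n - Aj (n + dj)) \<in> Ij"
    and Fi_K: "\<And>n. y n + y (n + 2 * di) - Ai (n + di) \<in> Fi"
begin

lemma Fi_add: "m \<in> Fi \<Longrightarrow> n \<in> Fi \<Longrightarrow> m + n \<in> Fi"
  using Fi_diff[of m "0 - n"] Fi_diff[OF Fi_0, of n] by simp

lemmas Fi_rules = Fi_0 Fi_var Fi_add Fi_diff

text \<open>The strings below are the \<open>q\<close>-characters of evaluation modules of dimensions 2, 3, 4 and of
  a product of two of dimension 2, times an invariant monomial.\<close>

lemma string_i1:
  assumes "m - y n \<in> Fi"
  shows "frag_of m + frag_of (m - Ai (n + di)) \<in> Ii"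
proof -
  have "frag_of (m - y n) * (frag_of (y n) + frag_of (y n - Ai (n + di)))
    = frag_of m + frag_of (m - Ai (n + di))"
    by (simp add: distrib_left mult_single)
  then show ?thesis using Ii_mult[OF Ii_single[OF assms] Ii_string[of n]] by simp
qed

lemma string_i11:
  assumes "m - y n - y n' \<in> Fi"
  shows "frag_of m + frag_of (m - Ai (n + di)) + frag_of (m - Ai (n' + di))
    + frag_of (m - Ai (n + di) - Ai (n' + di)) \<in> Ii"
proof -
  have "frag_of (m - y n - y n') *
      ((frag_of (y n) + frag_of (y n - Ai (n + di))) * (frag_of (y n') + frag_of (y n' - Ai (n' + di))))
    = frag_of m + frag_of (m - Ai (n + di)) + frag_of (m - Ai (n' + di))
      + frag_of (m - Ai (n + di) - Ai (n' + di))"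
    by (simp add: distrib_left distrib_right mult_single algebra_simps)
  then show ?thesis using Ii_mult[OF Ii_single[OF assms] Ii_mult[OF Ii_string[of n] Ii_string[of n']]] by simp
qed

lemma string_i2:
  assumes F: "m - y n - y n' \<in> Fi" and n': "n' = n + 2 * di"
  shows "frag_of m + frag_of (m - Ai (n' + di)) + frag_of (m - Ai (n' + di) - Ai (n + di)) \<in> Ii"
proof -
  \<comment> \<open>For adjacent parameters Y_n Y_{n'} A^{-1} equals K, so the product of the two
    2-term strings contains an invariant monomial, which is split off: 4 = 3 + 1.\<close>
  have "m - Ai (n + di) \<in> Fi"
    using Fi_add[OF F Fi_K[of n]] by (simp add: n' algebra_simps)
  from Ii_diff[OF string_i11[OF F] Ii_single[OF this]]
  show ?thesis by (simp add: algebra_simps)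
qed

lemma string_i3:
  assumes F: "m - y n - y n' - y n'' \<in> Fi" and n': "n' = n + 2 * di" and n'': "n'' = n' + 2 * di"
  shows "frag_of m + frag_of (m - Ai (n'' + di)) + frag_of (m - Ai (n'' + di) - Ai (n' + di))
    + frag_of (m - Ai (n'' + di) - Ai (n' + di) - Ai (n + di)) \<in> Ii"
proof -
  have 1: "(m - Ai (n + di)) - y n'' \<in> Fi"
    using Fi_add[OF F Fi_K[of n]] by (simp add: n' algebra_simps)
  have 2: "(m - y n'') - y n - y n' \<in> Fi" using F by (simp add: algebra_simps)
  have 3: "(m - Ai (n' + di)) - y n \<in> Fi"
    using Fi_add[OF F Fi_K[of n']] by (simp add: n'' algebra_simps)
  \<comment> \<open>The product of a 3-term and a 2-term string is the 4-term string plus a 2-term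
    string headed by \<open>m - Ai (n' + di)\<close>, which is subtracted: 6 = 4 + 2.\<close>
  have "(frag_of (m - y n'') + frag_of ((m - y n'') - Ai (n' + di)) + frag_of ((m - y n'') - Ai (n' + di) - Ai (n + di)))
      * (frag_of (y n'') + frag_of (y n'' - Ai (n'' + di)))
    = (frag_of m + frag_of (m - Ai (n'' + di)) + frag_of (m - Ai (n'' + di) - Ai (n' + di))
       + frag_of (m - Ai (n'' + di) - Ai (n' + di) - Ai (n + di)))
      + (frag_of (m - Ai (n' + di)) + frag_of (m - Ai (n' + di) - Ai (n + di)))"
    by (simp add: distrib_left distrib_right mult_single algebra_simps)
  note eq = this
  show ?thesis using Ii_diff[OF Ii_mult[OF string_i2[OF 2 n'] Ii_string[of n'']] string_i1[OF 3]]
    unfolding eq by simp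
qed

lemma Fj_add: "m \<in> Fj \<Longrightarrow> n \<in> Fj \<Longrightarrow> m + n \<in> Fj"
  using Fj_diff[of m "0 - n"] Fj_diff[OF Fj_0, of n] by simp

lemmas Fj_rules = Fj_0 Fj_var Fj_add Fj_diff

lemma string_j1:
  assumes "m - z n \<in> Fj"
  shows "frag_of m + frag_of (m - Aj (n + dj)) \<in> Ij"
proof -
  have "frag_of (m - z n) * (frag_of (z n) + frag_of (z n - Aj (n + dj)))
    = frag_of m + frag_of (m - Aj (n + dj))"
    by (simp add: distrib_left mult_single)
  then show ?thesis using Ij_mult[OF Ij_single[OF assms] Ij_string[of n]] by simp
qed

lemma string_j11:
  assumes "m - z n - z n' \<in> Fj"
  shows "frag_of m + frag_of (m - Aj (n + dj)) + frag_of (m - Aj (n' + dj))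
    + frag_of (m - Aj (n + dj) - Aj (n' + dj)) \<in> Ij"
proof -
  have "frag_of (m - z n - z n') *
      ((frag_of (z n) + frag_of (z n - Aj (n + dj))) * (frag_of (z n') + frag_of (z n' - Aj (n' + dj))))
    = frag_of m + frag_of (m - Aj (n + dj)) + frag_of (m - Aj (n' + dj))
      + frag_of (m - Aj (n + dj) - Aj (n' + dj))"
    by (simp add: distrib_left distrib_right mult_single algebra_simps)
  then show ?thesis using Ij_mult[OF Ij_single[OF assms] Ij_mult[OF Ij_string[of n] Ij_string[of n']]] by simp
qed

text \<open>The invariants are the \<open>q\<close>-characters of the fundamental representations of the quantum
  affine algebras of rank two (dimensions 3; 4 and 5; 7 and 15), as given by the Frenkel--Mukhin
  algorithm. For each node they split into the strings above.\<close>

lemma invariant_A2: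
  assumes "di = 1" "dj = 1" "\<And>n. Ai n = y (n - 1) + y (n + 1) - z n - e n" "\<And>n. Aj n = z (n - 1) + z (n + 1) - y n - f n"
  shows "\<exists>F\<in>Ii \<inter> Ij. Poly_Mapping.keys (F - frag_of (y 0)) \<subseteq> below Ai Aj (y 0)"
proof
  let ?m0 = "y 0"
  let ?m1 = "?m0 - Ai 1"
  let ?m2 = "?m1 - Aj 2"
  let ?E = "frag_of ?m1 + frag_of ?m2"
  let ?F = "frag_of ?m0 + ?E"
  have Ii: "?F \<in> Ii"
  proof -
    have c0: "?m0 - y 0 = 0" by (simp add: assms)
    have k0: "?m0 - y 0 \<in> Fi" unfolding c0 by (intro Fi_rules)
    have g0: "frag_of ?m0 + frag_of ?m1 \<in> Ii"
      using string_i1[OF k0] by (simp add: assms(1-2) diff_diff_eq ac_simps)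
    have c1: "?m2 = e 1 + f 2 - z 3" by (simp add: assms)
    have k1: "?m2 \<in> Fi" unfolding c1 by (intro Fi_rules)
    have g1: "frag_of ?m2 \<in> Ii"
      using Ii_single[OF k1] by (simp add: assms(1-2) diff_diff_eq ac_simps)
    have eq: "?F = (frag_of ?m0 + frag_of ?m1) + (frag_of ?m2)"
      by (simp only: ac_simps)
    show ?thesis by (subst eq) (intro Ii_add g0 g1)
  qed
  have Ij: "?F \<in> Ij"
  proof -
    have k0: "?m0 \<in> Fj" by (intro Fj_rules)
    have g0: "frag_of ?m0 \<in> Ij"
      using Ij_single[OF k0] by (simp add: assms(1-2) diff_diff_eq ac_simps)
    have c1: "?m1 - z 1 = e 1 - y 2" by (simp add: assms)
    have k1: "?m1 - z 1 \<in> Fj" unfolding c1 by (intro Fj_rules)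
    have g1: "frag_of ?m1 + frag_of ?m2 \<in> Ij"
      using string_j1[OF k1] by (simp add: assms(1-2) diff_diff_eq ac_simps)
    have eq: "?F = (frag_of ?m0) + (frag_of ?m1 + frag_of ?m2)"
      by (simp only: ac_simps)
    show ?thesis by (subst eq) (intro Ij_add g0 g1)
  qed
  show "?F \<in> Ii \<inter> Ij" using Ii Ij by blast
  show "Poly_Mapping.keys (?F - frag_of ?m0) \<subseteq> below Ai Aj ?m0"
    unfolding add_diff_cancel_left' by (intro keys_add_subset keys_single_subset; blast intro: below.intros)
qed

lemma invariant_B2_short:
  assumes "di = 1" "dj = 2" "\<And>n. Ai n = y (n - 1) + y (n + 1) - z n - e n" "\<And>n. Aj n = z (n - 2) + z (n + 2) - y (n - 1) - y (n + 1) - f n"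
  shows "\<exists>F\<in>Ii \<inter> Ij. Poly_Mapping.keys (F - frag_of (y 0)) \<subseteq> below Ai Aj (y 0)"
proof
  let ?m0 = "y 0"
  let ?m1 = "?m0 - Ai 1"
  let ?m2 = "?m1 - Aj 3"
  let ?m3 = "?m2 - Ai 5"
  let ?E = "frag_of ?m1 + frag_of ?m2 + frag_of ?m3"
  let ?F = "frag_of ?m0 + ?E"
  have Ii: "?F \<in> Ii"
  proof -
    have c0: "?m0 - y 0 = 0" by (simp add: assms)
    have k0: "?m0 - y 0 \<in> Fi" unfolding c0 by (intro Fi_rules)
    have g0: "frag_of ?m0 + frag_of ?m1 \<in> Ii"
      using string_i1[OF k0] by (simp add: assms(1-2) diff_diff_eq ac_simps)
    have c1: "?m2 - y 4 = e 1 + f 3 - z 5" by (simp add: assms)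
    have k1: "?m2 - y 4 \<in> Fi" unfolding c1 by (intro Fi_rules)
    have g1: "frag_of ?m2 + frag_of ?m3 \<in> Ii"
      using string_i1[OF k1] by (simp add: assms(1-2) diff_diff_eq ac_simps)
    have eq: "?F = (frag_of ?m0 + frag_of ?m1) + (frag_of ?m2 + frag_of ?m3)"
      by (simp only: ac_simps)
    show ?thesis by (subst eq) (intro Ii_add g0 g1)
  qed
  have Ij: "?F \<in> Ij"
  proof -
    have k0: "?m0 \<in> Fj" by (intro Fj_rules)
    have g0: "frag_of ?m0 \<in> Ij"
      using Ij_single[OF k0] by (simp add: assms(1-2) diff_diff_eq ac_simps)
    have c1: "?m1 - z 1 = e 1 - y 2" by (simp add: assms)
    have k1: "?m1 - z 1 \<in> Fj" unfolding c1 by (intro Fj_rules)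
    have g1: "frag_of ?m1 + frag_of ?m2 \<in> Ij"
      using string_j1[OF k1] by (simp add: assms(1-2) diff_diff_eq ac_simps)
    have c2: "?m3 = e 1 + e 5 + f 3 - y 6" by (simp add: assms)
    have k2: "?m3 \<in> Fj" unfolding c2 by (intro Fj_rules)
    have g2: "frag_of ?m3 \<in> Ij"
      using Ij_single[OF k2] by (simp add: assms(1-2) diff_diff_eq ac_simps)
    have eq: "?F = (frag_of ?m0) + (frag_of ?m1 + frag_of ?m2) + (frag_of ?m3)"
      by (simp only: ac_simps)
    show ?thesis by (subst eq) (intro Ij_add g0 g1 g2)
  qed
  show "?F \<in> Ii \<inter> Ij" using Ii Ij by blast
  show "Poly_Mapping.keys (?F - frag_of ?m0) \<subseteq> below Ai Aj ?m0"
    unfolding add_diff_cancel_left' by (intro keys_add_subset keys_single_subset; blast intro: below.intros)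
qed

lemma invariant_B2_long:
  assumes "di = 1" "dj = 2" "\<And>n. Ai n = y (n - 1) + y (n + 1) - z n - e n" "\<And>n. Aj n = z (n - 2) + z (n + 2) - y (n - 1) - y (n + 1) - f n"
  shows "\<exists>F\<in>Ii \<inter> Ij. Poly_Mapping.keys (F - frag_of (z 0)) \<subseteq> below Ai Aj (z 0)"
proof
  let ?m0 = "z 0"
  let ?m1 = "?m0 - Aj 2"
  let ?m2 = "?m1 - Ai 4"
  let ?m3 = "?m2 - Ai 2"
  let ?m4 = "?m3 - Aj 4"
  let ?E = "frag_of ?m1 + frag_of ?m2 + frag_of ?m3 + frag_of ?m4"
  let ?F = "frag_of ?m0 + ?E"
  have Ii: "?F \<in> Ii"
  proof -
    have k0: "?m0 \<in> Fi" by (intro Fi_rules)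
    have g0: "frag_of ?m0 \<in> Ii"
      using Ii_single[OF k0] by (simp add: assms(1-2) diff_diff_eq ac_simps)
    have c1: "?m1 - y 1 - y 3 = f 2 - z 4" by (simp add: assms)
    have k1: "?m1 - y 1 - y 3 \<in> Fi" unfolding c1 by (intro Fi_rules)
    have g1: "frag_of ?m1 + frag_of ?m2 + frag_of ?m3 \<in> Ii"
      using string_i2[OF k1] by (simp add: assms(1-2) diff_diff_eq ac_simps)
    have c2: "?m4 = e 2 + e 4 + f 2 + f 4 - z 6" by (simp add: assms)
    have k2: "?m4 \<in> Fi" unfolding c2 by (intro Fi_rules)
    have g2: "frag_of ?m4 \<in> Ii"
      using Ii_single[OF k2] by (simp add: assms(1-2) diff_diff_eq ac_simps)
    have eq: "?F = (frag_of ?m0) + (frag_of ?m1 + frag_of ?m2 + frag_of ?m3) + (frag_of ?m4)"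
      by (simp only: ac_simps)
    show ?thesis by (subst eq) (intro Ii_add g0 g1 g2)
  qed
  have Ij: "?F \<in> Ij"
  proof -
    have c0: "?m0 - z 0 = 0" by (simp add: assms)
    have k0: "?m0 - z 0 \<in> Fj" unfolding c0 by (intro Fj_rules)
    have g0: "frag_of ?m0 + frag_of ?m1 \<in> Ij"
      using string_j1[OF k0] by (simp add: assms(1-2) diff_diff_eq ac_simps)
    have c1: "?m2 = e 4 + f 2 + y 1 - y 5" by (simp add: assms)
    have k1: "?m2 \<in> Fj" unfolding c1 by (intro Fj_rules)
    have g1: "frag_of ?m2 \<in> Ij"
      using Ij_single[OF k1] by (simp add: assms(1-2) diff_diff_eq ac_simps)
    have c2: "?m3 - z 2 = e 2 + e 4 + f 2 - y 3 - y 5" by (simp add: assms)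
    have k2: "?m3 - z 2 \<in> Fj" unfolding c2 by (intro Fj_rules)
    have g2: "frag_of ?m3 + frag_of ?m4 \<in> Ij"
      using string_j1[OF k2] by (simp add: assms(1-2) diff_diff_eq ac_simps)
    have eq: "?F = (frag_of ?m0 + frag_of ?m1) + (frag_of ?m2) + (frag_of ?m3 + frag_of ?m4)"
      by (simp only: ac_simps)
    show ?thesis by (subst eq) (intro Ij_add g0 g1 g2)
  qed
  show "?F \<in> Ii \<inter> Ij" using Ii Ij by blast
  show "Poly_Mapping.keys (?F - frag_of ?m0) \<subseteq> below Ai Aj ?m0"
    unfolding add_diff_cancel_left' by (intro keys_add_subset keys_single_subset; blast intro: below.intros)
qed

lemma invariant_G2_short:
  assumes "di = 1" "dj = 3" "\<And>n. Ai n = y (n - 1) + y (n + 1) - z n - e n" "\<And>n. Aj n = z (n - 3) + z (n + 3) - y (n - 2) - y n - y (n + 2) - f n"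
  shows "\<exists>F\<in>Ii \<inter> Ij. Poly_Mapping.keys (F - frag_of (y 0)) \<subseteq> below Ai Aj (y 0)"
proof
  let ?m0 = "y 0"
  let ?m1 = "?m0 - Ai 1"
  let ?m2 = "?m1 - Aj 4"
  let ?m3 = "?m2 - Ai 7"
  let ?m4 = "?m3 - Ai 5"
  let ?m5 = "?m4 - Aj 8"
  let ?m6 = "?m5 - Ai 11"
  let ?E = "frag_of ?m1 + frag_of ?m2 + frag_of ?m3 + frag_of ?m4 + frag_of ?m5 + frag_of ?m6"
  let ?F = "frag_of ?m0 + ?E"
  have Ii: "?F \<in> Ii"
  proof -
    have c0: "?m0 - y 0 = 0" by (simp add: assms)
    have k0: "?m0 - y 0 \<in> Fi" unfolding c0 by (intro Fi_rules)
    have g0: "frag_of ?m0 + frag_of ?m1 \<in> Ii"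
      using string_i1[OF k0] by (simp add: assms(1-2) diff_diff_eq ac_simps)
    have c1: "?m2 - y 4 - y 6 = e 1 + f 4 - z 7" by (simp add: assms)
    have k1: "?m2 - y 4 - y 6 \<in> Fi" unfolding c1 by (intro Fi_rules)
    have g1: "frag_of ?m2 + frag_of ?m3 + frag_of ?m4 \<in> Ii"
      using string_i2[OF k1] by (simp add: assms(1-2) diff_diff_eq ac_simps)
    have c2: "?m5 - y 10 = e 1 + e 5 + e 7 + f 4 + f 8 - z 11" by (simp add: assms)
    have k2: "?m5 - y 10 \<in> Fi" unfolding c2 by (intro Fi_rules)
    have g2: "frag_of ?m5 + frag_of ?m6 \<in> Ii"
      using string_i1[OF k2] by (simp add: assms(1-2) diff_diff_eq ac_simps)
    have eq: "?F = (frag_of ?m0 + frag_of ?m1) + (frag_of ?m2 + frag_of ?m3 + frag_of ?m4) + (frag_of ?m5 + frag_of ?m6)"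
      by (simp only: ac_simps)
    show ?thesis by (subst eq) (intro Ii_add g0 g1 g2)
  qed
  have Ij: "?F \<in> Ij"
  proof -
    have k0: "?m0 \<in> Fj" by (intro Fj_rules)
    have g0: "frag_of ?m0 \<in> Ij"
      using Ij_single[OF k0] by (simp add: assms(1-2) diff_diff_eq ac_simps)
    have c1: "?m1 - z 1 = e 1 - y 2" by (simp add: assms)
    have k1: "?m1 - z 1 \<in> Fj" unfolding c1 by (intro Fj_rules)
    have g1: "frag_of ?m1 + frag_of ?m2 \<in> Ij"
      using string_j1[OF k1] by (simp add: assms(1-2) diff_diff_eq ac_simps)
    have c2: "?m3 = e 1 + e 7 + f 4 + y 4 - y 8" by (simp add: assms)
    have k2: "?m3 \<in> Fj" unfolding c2 by (intro Fj_rules)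
    have g2: "frag_of ?m3 \<in> Ij"
      using Ij_single[OF k2] by (simp add: assms(1-2) diff_diff_eq ac_simps)
    have c3: "?m4 - z 5 = e 1 + e 5 + e 7 + f 4 - y 6 - y 8" by (simp add: assms)
    have k3: "?m4 - z 5 \<in> Fj" unfolding c3 by (intro Fj_rules)
    have g3: "frag_of ?m4 + frag_of ?m5 \<in> Ij"
      using string_j1[OF k3] by (simp add: assms(1-2) diff_diff_eq ac_simps)
    have c4: "?m6 = e 1 + e 5 + e 7 + e 11 + f 4 + f 8 - y 12" by (simp add: assms)
    have k4: "?m6 \<in> Fj" unfolding c4 by (intro Fj_rules)
    have g4: "frag_of ?m6 \<in> Ij"
      using Ij_single[OF k4] by (simp add: assms(1-2) diff_diff_eq ac_simps)
    have eq: "?F = (frag_of ?m0) + (frag_of ?m1 + frag_of ?m2) + (frag_of ?m3) + (frag_of ?m4 + frag_of ?m5) + (frag_of ?m6)"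
      by (simp only: ac_simps)
    show ?thesis by (subst eq) (intro Ij_add g0 g1 g2 g3 g4)
  qed
  show "?F \<in> Ii \<inter> Ij" using Ii Ij by blast
  show "Poly_Mapping.keys (?F - frag_of ?m0) \<subseteq> below Ai Aj ?m0"
    unfolding add_diff_cancel_left' by (intro keys_add_subset keys_single_subset; blast intro: below.intros)
qed

text \<open>The monomials \<open>?m6\<close>, \<open>?m7\<close> and \<open>?m8\<close>, each with
  three \<open>Ai\<close> and two \<open>Aj\<close> divided off, have weight zero, one more than the
  rank: the module restricts to the adjoint representation of dimension 14 plus a trivial
  one.\<close>

lemma invariant_G2_long:
  assumes "di = 1" "dj = 3" "\<And>n. Ai n = y (n - 1) + y (n + 1) - z n - e n" "\<And>n. Aj n = z (n - 3) + z (n + 3) - y (n - 2) - y n - y (n + 2) - f n"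
  shows "\<exists>F\<in>Ii \<inter> Ij. Poly_Mapping.keys (F - frag_of (z 0)) \<subseteq> below Ai Aj (z 0)"
proof
  let ?m0 = "z 0"
  let ?m1 = "?m0 - Aj 3"
  let ?m2 = "?m1 - Ai 6"
  let ?m3 = "?m2 - Ai 4"
  let ?m4 = "?m3 - Ai 2"
  let ?m5 = "?m3 - Aj 7"
  let ?m6 = "?m5 - Ai 2"
  let ?m7 = "?m4 - Aj 5"
  let ?m8 = "?m5 - Ai 10"
  let ?m9 = "?m7 - Aj 7"
  let ?m10 = "?m8 - Ai 2"
  let ?m11 = "?m10 - Aj 5"
  let ?m12 = "?m11 - Ai 8"
  let ?m13 = "?m12 - Ai 6"
  let ?m14 = "?m13 - Aj 9"
  let ?E = "frag_of ?m1 + frag_of ?m2 + frag_of ?m3 + frag_of ?m4 + frag_of ?m5 + frag_of ?m6 + frag_of ?m7 + frag_of ?m8 + frag_of ?m9 + frag_of ?m10 + frag_of ?m11 + frag_of ?m12 + frag_of ?m13 + frag_of ?m14"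
  let ?F = "frag_of ?m0 + ?E"
  have Ii: "?F \<in> Ii"
  proof -
    have k0: "?m0 \<in> Fi" by (intro Fi_rules)
    have g0: "frag_of ?m0 \<in> Ii"
      using Ii_single[OF k0] by (simp add: assms(1-2) diff_diff_eq ac_simps)
    have c1: "?m1 - y 1 - y 3 - y 5 = f 3 - z 6" by (simp add: assms)
    have k1: "?m1 - y 1 - y 3 - y 5 \<in> Fi" unfolding c1 by (intro Fi_rules)
    have g1: "frag_of ?m1 + frag_of ?m2 + frag_of ?m3 + frag_of ?m4 \<in> Ii"
      using string_i3[OF k1] by (simp add: assms(1-2) diff_diff_eq ac_simps)
    \<comment> \<open>The parameters 1 and 9 do not differ by 2 di, so this is the full 4-term
      product and nothing splits off. The same happens for node j at z 2 and z 4.\<close>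
    have c2: "?m5 - y 1 - y 9 = e 4 + e 6 + f 3 + f 7 - z 10" by (simp add: assms)
    have k2: "?m5 - y 1 - y 9 \<in> Fi" unfolding c2 by (intro Fi_rules)
    have g2: "frag_of ?m5 + frag_of ?m6 + frag_of ?m8 + frag_of ?m10 \<in> Ii"
      using string_i11[OF k2] by (simp add: assms(1-2) diff_diff_eq ac_simps)
    have c3: "?m7 = e 2 + e 4 + e 6 + f 3 + f 5 + z 4 - z 8" by (simp add: assms)
    have k3: "?m7 \<in> Fi" unfolding c3 by (intro Fi_rules)
    have g3: "frag_of ?m7 \<in> Ii"
      using Ii_single[OF k3] by (simp add: assms(1-2) diff_diff_eq ac_simps)
    have c4: "?m9 - y 5 - y 7 - y 9 = e 2 + e 4 + e 6 + f 3 + f 5 + f 7 - z 8 - z 10" by (simp add: assms)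
    have k4: "?m9 - y 5 - y 7 - y 9 \<in> Fi" unfolding c4 by (intro Fi_rules)
    have g4: "frag_of ?m9 + frag_of ?m11 + frag_of ?m12 + frag_of ?m13 \<in> Ii"
      using string_i3[OF k4] by (simp add: assms(1-2) diff_diff_eq ac_simps)
    have c5: "?m14 = e 2 + e 4 + e 6 + e 6 + e 8 + e 10 + f 3 + f 5 + f 7 + f 9 - z 12" by (simp add: assms)
    have k5: "?m14 \<in> Fi" unfolding c5 by (intro Fi_rules)
    have g5: "frag_of ?m14 \<in> Ii"
      using Ii_single[OF k5] by (simp add: assms(1-2) diff_diff_eq ac_simps)
    have eq: "?F = (frag_of ?m0) + (frag_of ?m1 + frag_of ?m2 + frag_of ?m3 + frag_of ?m4) + (frag_of ?m5 + frag_of ?m6 + frag_of ?m8 + frag_of ?m10) + (frag_of ?m7) + (frag_of ?m9 + frag_of ?m11 + frag_of ?m12 + frag_of ?m13) + (frag_of ?m14)"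
      by (simp only: ac_simps)
    show ?thesis by (subst eq) (intro Ii_add g0 g1 g2 g3 g4 g5)
  qed
  have Ij: "?F \<in> Ij"
  proof -
    have c0: "?m0 - z 0 = 0" by (simp add: assms)
    have k0: "?m0 - z 0 \<in> Fj" unfolding c0 by (intro Fj_rules)
    have g0: "frag_of ?m0 + frag_of ?m1 \<in> Ij"
      using string_j1[OF k0] by (simp add: assms(1-2) diff_diff_eq ac_simps)
    have c1: "?m2 = e 6 + f 3 + y 1 + y 3 - y 7" by (simp add: assms)
    have k1: "?m2 \<in> Fj" unfolding c1 by (intro Fj_rules)
    have g1: "frag_of ?m2 \<in> Ij"
      using Ij_single[OF k1] by (simp add: assms(1-2) diff_diff_eq ac_simps)
    have c2: "?m3 - z 4 = e 4 + e 6 + f 3 + y 1 - y 5 - y 7" by (simp add: assms)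
    have k2: "?m3 - z 4 \<in> Fj" unfolding c2 by (intro Fj_rules)
    have g2: "frag_of ?m3 + frag_of ?m5 \<in> Ij"
      using string_j1[OF k2] by (simp add: assms(1-2) diff_diff_eq ac_simps)
    have c3: "?m4 - z 2 - z 4 = e 2 + e 4 + e 6 + f 3 - y 3 - y 5 - y 7" by (simp add: assms)
    have k3: "?m4 - z 2 - z 4 \<in> Fj" unfolding c3 by (intro Fj_rules)
    have g3: "frag_of ?m4 + frag_of ?m7 + frag_of ?m6 + frag_of ?m9 \<in> Ij"
      using string_j11[OF k3] by (simp add: assms(1-2) diff_diff_eq ac_simps)
    have c4: "?m8 = e 4 + e 6 + e 10 + f 3 + f 7 + y 1 - y 11" by (simp add: assms)
    have k4: "?m8 \<in> Fj" unfolding c4 by (intro Fj_rules)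
    have g4: "frag_of ?m8 \<in> Ij"
      using Ij_single[OF k4] by (simp add: assms(1-2) diff_diff_eq ac_simps)
    have c5: "?m10 - z 2 = e 2 + e 4 + e 6 + e 10 + f 3 + f 7 - y 3 - y 11" by (simp add: assms)
    have k5: "?m10 - z 2 \<in> Fj" unfolding c5 by (intro Fj_rules)
    have g5: "frag_of ?m10 + frag_of ?m11 \<in> Ij"
      using string_j1[OF k5] by (simp add: assms(1-2) diff_diff_eq ac_simps)
    have c6: "?m12 = e 2 + e 4 + e 6 + e 8 + e 10 + f 3 + f 5 + f 7 + y 5 - y 9 - y 11" by (simp add: assms)
    have k6: "?m12 \<in> Fj" unfolding c6 by (intro Fj_rules)
    have g6: "frag_of ?m12 \<in> Ij"
      using Ij_single[OF k6] by (simp add: assms(1-2) diff_diff_eq ac_simps)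
    have c7: "?m13 - z 6 = e 2 + e 4 + e 6 + e 6 + e 8 + e 10 + f 3 + f 5 + f 7 - y 7 - y 9 - y 11" by (simp add: assms)
    have k7: "?m13 - z 6 \<in> Fj" unfolding c7 by (intro Fj_rules)
    have g7: "frag_of ?m13 + frag_of ?m14 \<in> Ij"
      using string_j1[OF k7] by (simp add: assms(1-2) diff_diff_eq ac_simps)
    have eq: "?F = (frag_of ?m0 + frag_of ?m1) + (frag_of ?m2) + (frag_of ?m3 + frag_of ?m5) + (frag_of ?m4 + frag_of ?m7 + frag_of ?m6 + frag_of ?m9) + (frag_of ?m8) + (frag_of ?m10 + frag_of ?m11) + (frag_of ?m12) + (frag_of ?m13 + frag_of ?m14)"
      by (simp only: ac_simps)
    show ?thesis by (subst eq) (intro Ij_add g0 g1 g2 g3 g4 g5 g6 g7)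
  qed
  show "?F \<in> Ii \<inter> Ij" using Ii Ij by blast
  show "Poly_Mapping.keys (?F - frag_of ?m0) \<subseteq> below Ai Aj ?m0"
    unfolding add_diff_cancel_left' by (intro keys_add_subset keys_single_subset; blast intro: below.intros)
qed

end

section \<open>Rank two invariants for every pair of nodes\<close>

context weyl_action
begin

definition Fix :: "'i \<Rightarrow> 'i monomial set" where
  "Fix i = {m \<in> monomials. \<forall>w\<in>W. Th i w (mono_series m) = mono_series m}"

lemma Fix_0: "0 \<in> Fix i" using Th_one monomials_0 by (simp add: Fix_def)

lemma Fix_add: "m \<in> Fix i \<Longrightarrow> n \<in> Fix i \<Longrightarrow> m + n \<in> Fix i"
  unfolding Fix_def using Th_fixed_add[of _ m n i] monomials_add[of m n] by blast

lemma Fix_uminus: "m \<in> Fix i \<Longrightarrow> - m \<in> Fix i"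
  unfolding Fix_def using Th_fixed_uminus[of _ m i] monomials_uminus[of m] by blast

lemma Fix_diff: "m \<in> Fix i \<Longrightarrow> n \<in> Fix i \<Longrightarrow> m - n \<in> Fix i"
  using Fix_add[OF _ Fix_uminus, of m i n] by simp

lemma Fix_sum: "(\<And>x. x \<in> T \<Longrightarrow> f x \<in> Fix i) \<Longrightarrow> sum f T \<in> Fix i"
  by (induction T rule: infinite_finite_induct) (simp_all add: Fix_0 Fix_add)

lemma Fix_Yvar: "j \<noteq> i \<Longrightarrow> a \<noteq> 0 \<Longrightarrow> Yvar j a \<in> Fix i"
  unfolding Fix_def using Th_other[of _ j i a] monomials_Yvar[of a j] by blast

lemma Fix_K: "a \<noteq> 0 \<Longrightarrow> K i a \<in> Fix i"
  unfolding Fix_def using Th_K K_monomials by blast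

lemma Inv_Fix: "m \<in> Fix i \<Longrightarrow> Poly_Mapping.single m 1 \<in> Inv i"
  by (rule Inv_single) (auto simp: Fix_def)

definition K_other :: "'i \<Rightarrow> 'i \<Rightarrow> complex \<Rightarrow> 'i monomial" where
  "K_other i j a = (\<Sum>k | C $ k $ i = -1 \<and> k \<noteq> j. Yvar k a)
      + (\<Sum>k | C $ k $ i = -2 \<and> k \<noteq> j. Yvar k (a * q powi (-1)) + Yvar k (a * q))
      + (\<Sum>k | C $ k $ i = -3 \<and> k \<noteq> j. Yvar k (a * q powi (-2)) + Yvar k a + Yvar k (a * q ^ 2))"

lemma K_other_Fix: assumes "a \<noteq> 0" "l \<in> {i, j}" shows "K_other i j a \<in> Fix l"
proof -
  have Y: "Yvar k b \<in> Fix l" if "C $ k $ i < 0" "k \<noteq> j" "b \<noteq> 0" for k b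
    using that assms(2) by (intro Fix_Yvar) auto
  show ?thesis unfolding K_other_def
    by (intro Fix_add Fix_sum) (auto intro!: Y simp: assms(1) q_nonzero)
qed

lemma K_split:
  "K i a = (if C $ j $ i = -1 then Yvar j a else 0)
    + (if C $ j $ i = -2 then Yvar j (a / q) + Yvar j (a * q) else 0)
    + (if C $ j $ i = -3 then Yvar j (a / q ^ 2) + Yvar j a + Yvar j (a * q ^ 2) else 0) + K_other i j a"
proof -
  have split: "(\<Sum>k | P k. g k) = (if P j then g j else 0) + (\<Sum>k | P k \<and> k \<noteq> j. g k)"
    for P :: "'i \<Rightarrow> bool" and g :: "'i \<Rightarrow> 'i monomial"
  proof (cases "P j")
    case True
    have "{k. P k} = insert j {k. P k \<and> k \<noteq> j}" using True by auto
    then show ?thesis using True by simp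
  next
    case False
    then have "{k. P k} = {k. P k \<and> k \<noteq> j}" by auto
    then show ?thesis using False by simp
  qed
  show ?thesis unfolding K_def K_other_def
    by (subst (1 2 3) split) (simp add: power_int_minus divide_inverse algebra_simps)
qed

lemma K_shift:
  assumes "C $ j $ i = - c"
  shows "c = 1 \<Longrightarrow> K i b = Yvar j b + K_other i j b"
    and "c = 2 \<Longrightarrow> K i (a * q powi n) = Yvar j (a * q powi (n - 1)) + Yvar j (a * q powi (n + 1)) + K_other i j (a * q powi n)"
    and "c = 3 \<Longrightarrow> K i (a * q powi n) = Yvar j (a * q powi (n - 2)) + Yvar j (a * q powi n)
      + Yvar j (a * q powi (n + 2)) + K_other i j (a * q powi n)"
  using assms q_nonzero by (simp_all add: K_split[of i _ j] power_int_add power_int_diff mult.assoc)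

context
  fixes i j :: 'i and a Q :: complex and di dj :: int
  assumes ij: "i \<noteq> j" and a: "a \<noteq> 0" and Q: "Q \<noteq> 0" "Q powi di = qq i" "Q powi dj = qq j"
begin

lemma nz: "a * Q powi n \<noteq> 0" using a Q(1) by (simp add: power_int_eq_0_iff)

lemma shift:
  "a * Q powi n * qq i = a * Q powi (n + di)" "a * Q powi n / qq i = a * Q powi (n - di)"
  "a * Q powi n * qq j = a * Q powi (n + dj)" "a * Q powi n / qq j = a * Q powi (n - dj)"
  unfolding Q(2,3)[symmetric] using Q(1) by (simp_all add: power_int_add power_int_diff)

lemma A_shift:
  "A i (a * Q powi n) = Yvar i (a * Q powi (n - di)) + Yvar i (a * Q powi (n + di)) - K i (a * Q powi n)"
  "A j (a * Q powi n) = Yvar j (a * Q powi (n - dj)) + Yvar j (a * Q powi (n + dj)) - K j (a * Q powi n)"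
  unfolding A_eq shift by simp_all

text \<open>\<open>Q\<close> is a common base for the spectral shifts of both nodes: q_i for a
  single bond, where d_i = d_j, and q for a multiple bond. Neighbours other than i and j supply
  \<open>e\<close> and \<open>f\<close>.\<close>

lemma rank_two_pair:
  "rank_two (\<lambda>n. Yvar i (a * Q powi n)) (\<lambda>n. Yvar j (a * Q powi n))
     (\<lambda>n. A i (a * Q powi n)) (\<lambda>n. A j (a * Q powi n))
     (\<lambda>n. K_other i j (a * Q powi n)) (\<lambda>n. K_other j i (a * Q powi n)) di dj
     (Fix i) (Fix j) (Inv i) (Inv j)"
proof
  fix n
  show "Poly_Mapping.single (Yvar i (a * Q powi n)) 1
      + Poly_Mapping.single (Yvar i (a * Q powi n) - A i (a * Q powi (n + di))) 1 \<in> Inv i"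
    using Inv_string[OF nz[of n], of i] unfolding shift .
  show "Poly_Mapping.single (Yvar j (a * Q powi n)) 1
      + Poly_Mapping.single (Yvar j (a * Q powi n) - A j (a * Q powi (n + dj))) 1 \<in> Inv j"
    using Inv_string[OF nz[of n], of j] unfolding shift .
  have "Yvar i (a * Q powi n) + Yvar i (a * Q powi (n + 2 * di)) - A i (a * Q powi (n + di)) = K i (a * Q powi (n + di))"
    unfolding A_shift by (simp add: algebra_simps)
  then show "Yvar i (a * Q powi n) + Yvar i (a * Q powi (n + 2 * di)) - A i (a * Q powi (n + di)) \<in> Fix i"
    using Fix_K[OF nz] by simp
qed (use ij nz in \<open>simp_all add: Fix_0 Fix_diff Fix_Yvar K_other_Fix Inv_add Inv_diff Inv_mult Inv_Fix\<close>)

end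

lemma weight_below:
  assumes "p \<in> below Ai Aj g" "\<And>n. weight (Ai n) = \<gamma>" "\<And>n. weight (Aj n) = \<epsilon>"
  shows "\<exists>x y::nat. x + y > 0 \<and> weight p = weight g - (int x *s \<gamma> + int y *s \<epsilon>)"
  using assms(1)
proof induction
  case (1 n)
  show ?case by (intro exI[of _ 1] exI[of _ 0]) (simp add: weight_diff assms)
next
  case (2 n)
  show ?case by (intro exI[of _ 0] exI[of _ 1]) (simp add: weight_diff assms)
next
  case (3 m n)
  then obtain x y :: nat where "weight m = weight g - (int x *s \<gamma> + int y *s \<epsilon>)" by blast
  then show ?case by (intro exI[of _ "Suc x"] exI[of _ y]) (simp add: weight_diff assms vector_sadd_rdistrib)
next
  case (4 m n)
  then obtain x y :: nat where "weight m = weight g - (int x *s \<gamma> + int y *s \<epsilon>)" by blast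
  then show ?case by (intro exI[of _ x] exI[of _ "Suc y"]) (simp add: weight_diff assms vector_sadd_rdistrib)
qed

definition fundamental_invariant :: "'i \<Rightarrow> 'i \<Rightarrow> complex \<Rightarrow> bool" where
  "fundamental_invariant i j a \<longleftrightarrow> (\<exists>F\<in>Inv i \<inter> Inv j.
     \<forall>p\<in>Poly_Mapping.keys (F - Poly_Mapping.single (Yvar i a) 1).
       \<exists>x y::nat. x + y > 0 \<and> weight p = fund_weight i - (int x *s \<alpha> i + int y *s \<alpha> j))"

lemma fundamental_invariantI:
  assumes "\<exists>F\<in>Inv i \<inter> Inv j. Poly_Mapping.keys (F - Poly_Mapping.single (Yvar i a) 1)
     \<subseteq> below (\<lambda>n. A i (b n)) (\<lambda>n. A j (c n)) (Yvar i a)"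
  shows "fundamental_invariant i j a"
proof -
  obtain F where F: "F \<in> Inv i \<inter> Inv j" "Poly_Mapping.keys (F - Poly_Mapping.single (Yvar i a) 1)
     \<subseteq> below (\<lambda>n. A i (b n)) (\<lambda>n. A j (c n)) (Yvar i a)" using assms by blast
  have "\<exists>x y::nat. x + y > 0 \<and> weight p = fund_weight i - (int x *s \<alpha> i + int y *s \<alpha> j)"
    if "p \<in> Poly_Mapping.keys (F - Poly_Mapping.single (Yvar i a) 1)" for p
    using weight_below[of p "\<lambda>n. A i (b n)" "\<lambda>n. A j (c n)" "Yvar i a" "\<alpha> i" "\<alpha> j"] F(2) that weight_A by auto
  then show ?thesis using F(1) unfolding fundamental_invariant_def by blast
qed

text \<open>The invariants for a multiple bond take the short node as the first one; this version
  serves the case where i is the long node.\<close>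

lemma fundamental_invariantI':
  assumes "\<exists>F\<in>Inv j \<inter> Inv i. Poly_Mapping.keys (F - Poly_Mapping.single (Yvar i a) 1)
     \<subseteq> below (\<lambda>n. A j (c n)) (\<lambda>n. A i (b n)) (Yvar i a)"
  shows "fundamental_invariant i j a"
proof (rule fundamental_invariantI)
  show "\<exists>F\<in>Inv i \<inter> Inv j. Poly_Mapping.keys (F - Poly_Mapping.single (Yvar i a) 1)
     \<subseteq> below (\<lambda>n. A i (b n)) (\<lambda>n. A j (c n)) (Yvar i a)"
    using assms below_swap[of "\<lambda>n. A j (c n)" "\<lambda>n. A i (b n)" "Yvar i a"] by blast
qed

lemma rank_two_fundamental_invariant:
  assumes ij: "i \<noteq> j" and a: "a \<noteq> 0" shows "fundamental_invariant i j a"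
proof -
  consider "C $ i $ j = 0" "C $ j $ i = 0" | "C $ i $ j = -1" "C $ j $ i = -1"
    | "C $ i $ j = -2" | "C $ i $ j = -3" | "C $ j $ i = -2" | "C $ j $ i = -3"
    using cartan_pairs[OF ij] by auto
  then show ?thesis
  proof cases
    \<comment> \<open>Without a bond no variable of j occurs in the string of i, so both of its
      monomials are already fixed by the operator of j.\<close>
    case 1
    let ?b = "a * qq i"
    have b: "?b \<noteq> 0" "a * (qq i)\<^sup>2 \<noteq> 0" using a q_nonzero by simp_all
    define F where "F = Poly_Mapping.single (Yvar i a) 1 + Poly_Mapping.single (Yvar i a - A i ?b) (1 :: int)"
    have "K i ?b = K_other i j ?b" using K_split[of i ?b j] 1 by simp
    then have "Yvar i a - A i ?b = K_other i j ?b - Yvar i (a * (qq i)\<^sup>2)"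
      using Y_minus_A[OF W_id, of i a] by simp
    then have "Yvar i a - A i ?b \<in> Fix j"
      using Fix_diff[OF K_other_Fix[OF b(1), of j i j] Fix_Yvar[OF ij b(2)]] by simp
    then have "F \<in> Inv j" unfolding F_def using Inv_Fix Inv_add Fix_Yvar[OF ij a] by blast
    moreover have "F \<in> Inv i" unfolding F_def by (rule Inv_string[OF a])
    moreover have "F - Poly_Mapping.single (Yvar i a) 1 = Poly_Mapping.single (Yvar i a - A i ?b) 1" by (simp add: F_def)
    moreover have "weight (Yvar i a - A i ?b) = fund_weight i - (int 1 *s \<alpha> i + int 0 *s \<alpha> j)"
      by (simp add: weight_diff weight_A)
    then have "\<exists>x y::nat. x + y > 0 \<and> weight (Yvar i a - A i ?b) = fund_weight i - (int x *s \<alpha> i + int y *s \<alpha> j)"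
      by (intro exI[of _ 1] exI[of _ 0] conjI) simp_all
    ultimately show ?thesis unfolding fundamental_invariant_def
      by (intro bexI[of _ F]) simp_all
  next
    case 2
    then have "d i = d j" by (rule d_equal)
    then have Q: "qq i \<noteq> 0" "qq i powi 1 = qq i" "qq i powi 1 = qq j" by (simp_all add: q_nonzero)
    interpret rank_two "\<lambda>n. Yvar i (a * qq i powi n)" "\<lambda>n. Yvar j (a * qq i powi n)"
      "\<lambda>n. A i (a * qq i powi n)" "\<lambda>n. A j (a * qq i powi n)"
      "\<lambda>n. K_other i j (a * qq i powi n)" "\<lambda>n. K_other j i (a * qq i powi n)" 1 1
      "Fix i" "Fix j" "Inv i" "Inv j"
      by (rule rank_two_pair[OF ij a Q])
    have sh: "Yvar i (a * qq i powi 0) = Yvar i a" by simp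
    show ?thesis
      by (rule fundamental_invariantI, rule invariant_A2[unfolded sh])
        (simp_all add: A_shift[OF ij a Q] K_shift(1)[of j i 1] K_shift(1)[of i j 1] 2)
  next
    \<comment> \<open>\<open>C $ i $ j = -2\<close> makes i the short node, so \<open>Q\<close> is q
      and the steps are 1 for i and 2 for j.\<close>
    case 3
    have s: "d i = 1" "int (d j) = 2" "C $ j $ i = -1" using d_short[OF ij[symmetric] 3] by simp_all
    then have dj: "d j = 2" by simp
    have Q: "q \<noteq> 0" "q powi 1 = qq i" "q powi 2 = qq j" using q_nonzero by (simp_all add: s dj)
    interpret rank_two "\<lambda>n. Yvar i (a * q powi n)" "\<lambda>n. Yvar j (a * q powi n)"
      "\<lambda>n. A i (a * q powi n)" "\<lambda>n. A j (a * q powi n)"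
      "\<lambda>n. K_other i j (a * q powi n)" "\<lambda>n. K_other j i (a * q powi n)" 1 2
      "Fix i" "Fix j" "Inv i" "Inv j"
      by (rule rank_two_pair[OF ij a Q])
    have sh: "Yvar i (a * q powi 0) = Yvar i a" by simp
    show ?thesis
      by (rule fundamental_invariantI, rule invariant_B2_short[unfolded sh])
        (simp_all add: A_shift[OF ij a Q] K_shift(1)[of j i 1] K_shift(2)[of i j 2] 3 s)
  next
    case 4
    have s: "d i = 1" "int (d j) = 3" "C $ j $ i = -1" using d_short[OF ij[symmetric] 4] by simp_all
    then have dj: "d j = 3" by simp
    have Q: "q \<noteq> 0" "q powi 1 = qq i" "q powi 3 = qq j" using q_nonzero by (simp_all add: s dj)
    interpret rank_two "\<lambda>n. Yvar i (a * q powi n)" "\<lambda>n. Yvar j (a * q powi n)"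
      "\<lambda>n. A i (a * q powi n)" "\<lambda>n. A j (a * q powi n)"
      "\<lambda>n. K_other i j (a * q powi n)" "\<lambda>n. K_other j i (a * q powi n)" 1 3
      "Fix i" "Fix j" "Inv i" "Inv j"
      by (rule rank_two_pair[OF ij a Q])
    have sh: "Yvar i (a * q powi 0) = Yvar i a" by simp
    show ?thesis
      by (rule fundamental_invariantI, rule invariant_G2_short[unfolded sh])
        (simp_all add: A_shift[OF ij a Q] K_shift(1)[of j i 1] K_shift(3)[of i j 3] 4 s)
  next
    case 5
    have s: "d j = 1" "int (d i) = 2" "C $ i $ j = -1" using d_short[OF ij 5] by simp_all
    then have di: "d i = 2" by simp
    have Q: "q \<noteq> 0" "q powi 1 = qq j" "q powi 2 = qq i" using q_nonzero by (simp_all add: s di)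
    interpret rank_two "\<lambda>n. Yvar j (a * q powi n)" "\<lambda>n. Yvar i (a * q powi n)"
      "\<lambda>n. A j (a * q powi n)" "\<lambda>n. A i (a * q powi n)"
      "\<lambda>n. K_other j i (a * q powi n)" "\<lambda>n. K_other i j (a * q powi n)" 1 2
      "Fix j" "Fix i" "Inv j" "Inv i"
      by (rule rank_two_pair[OF ij[symmetric] a Q])
    have sh: "Yvar i (a * q powi 0) = Yvar i a" by simp
    show ?thesis
      by (rule fundamental_invariantI', rule invariant_B2_long[unfolded sh])
        (simp_all add: A_shift[OF ij[symmetric] a Q] K_shift(1)[of i j 1] K_shift(2)[of j i 2] 5 s)
  next
    case 6
    have s: "d j = 1" "int (d i) = 3" "C $ i $ j = -1" using d_short[OF ij 6] by simp_all
    then have di: "d i = 3" by simp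
    have Q: "q \<noteq> 0" "q powi 1 = qq j" "q powi 3 = qq i" using q_nonzero by (simp_all add: s di)
    interpret rank_two "\<lambda>n. Yvar j (a * q powi n)" "\<lambda>n. Yvar i (a * q powi n)"
      "\<lambda>n. A j (a * q powi n)" "\<lambda>n. A i (a * q powi n)"
      "\<lambda>n. K_other j i (a * q powi n)" "\<lambda>n. K_other i j (a * q powi n)" 1 3
      "Fix j" "Fix i" "Inv j" "Inv i"
      by (rule rank_two_pair[OF ij[symmetric] a Q])
    have sh: "Yvar i (a * q powi 0) = Yvar i a" by simp
    show ?thesis
      by (rule fundamental_invariantI', rule invariant_G2_long[unfolded sh])
        (simp_all add: A_shift[OF ij[symmetric] a Q] K_shift(1)[of i j 1] K_shift(3)[of j i 3] 6 s)
  qed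
qed


section \<open>The action\<close>

text \<open>Here dividing by A of node i or j lowers the weight in the completion at v, so in the
  fundamental q-characters the variables themselves lead.\<close>

lemma TW_dihedral_positive:
  assumes v: "v \<in> W" "v (\<alpha> i) \<in> Q_plus C" "v (\<alpha> j) \<in> Q_plus C" and ij: "i \<noteq> j"
    and r: "set r \<subseteq> {i, j}" "sw r = id" and f: "f \<in> completion_carrier C v"
  shows "TW r v f = f"
proof (rule TW_trivial[OF v(1) r(2), of "{Yvar k a | k a. a \<noteq> 0}"])
  show "f \<in> completion_carrier C v" by (rule f)
  show "{Yvar k a | k a. a \<noteq> 0} \<subseteq> (monomials :: 'i monomial set)" by (auto intro!: monomials_Yvar)
  fix H :: "'i monomial set" and m :: "'i monomial"
  assume H: "{Yvar k a | k a. a \<noteq> 0} \<subseteq> H" "0 \<in> H" "\<And>m n. m \<in> H \<Longrightarrow> n \<in> H \<Longrightarrow> m - n \<in> H" and m: "m \<in> monomials"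
  show "m \<in> H" by (rule monomials_generated[OF _ H(2,3) m]) (use H(1) in blast)
next
  fix g :: "'i monomial" assume "g \<in> {Yvar k a | k a. a \<noteq> 0}"
  then obtain k a where g: "g = Yvar k a" "a \<noteq> 0" by blast
  show "\<exists>F. (\<forall>l\<in>set r. F \<in> Inv l) \<and> Poly_Mapping.keys F \<subseteq> monomials \<and>
      (\<forall>p\<in>Poly_Mapping.keys (F - Poly_Mapping.single g 1). v (weight g - weight p) \<in> Q_plus C \<and> weight g \<noteq> weight p)"
  proof (cases "k \<in> {i, j}")
    case False
    then have "Poly_Mapping.single g 1 \<in> Inv l" if "l \<in> set r" for l
      using that r(1) Inv_other[of k l a] g by auto
    moreover have "g \<in> monomials" using g monomials_Yvar[of a k] by simp
    ultimately show ?thesis by (intro exI[of _ "Poly_Mapping.single g 1"]) simp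
  next
    case True
    obtain k' where k': "{k, k'} = {i, j}" "k \<noteq> k'" using True ij by auto
    obtain F where F: "F \<in> Inv k \<inter> Inv k'" "\<forall>p\<in>Poly_Mapping.keys (F - Poly_Mapping.single g 1).
       \<exists>x y::nat. x + y > 0 \<and> weight p = fund_weight k - (int x *s \<alpha> k + int y *s \<alpha> k')"
      using rank_two_fundamental_invariant[OF k'(2) g(2)] unfolding fundamental_invariant_def g(1) by blast
    have pos: "v (\<alpha> k) \<in> Q_plus C" "v (\<alpha> k') \<in> Q_plus C" using k'(1) v(2,3) by (auto simp: doubleton_eq_iff)
    have "F \<in> Inv l" if "l \<in> set r" for l using that r(1) F(1) k'(1) by auto
    moreover have "Poly_Mapping.keys F \<subseteq> monomials" using F(1) by (auto simp: Inv_def)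
    moreover have "v (weight g - weight p) \<in> Q_plus C \<and> weight g \<noteq> weight p"
      if p: "p \<in> Poly_Mapping.keys (F - Poly_Mapping.single g 1)" for p
    proof -
      obtain x y :: nat where xy: "x + y > 0" "weight p = fund_weight k - (int x *s \<alpha> k + int y *s \<alpha> k')"
        using bspec[OF F(2) p] by (elim exE conjE) (rule that)
      then have e: "weight g - weight p = int x *s \<alpha> k + int y *s \<alpha> k'" by (simp add: g(1))
      have "v (weight g - weight p) = int x *s v (\<alpha> k) + int y *s v (\<alpha> k')"
        unfolding e by (simp only: W_add[OF v(1)] W_scale[OF v(1)])
      also have "\<dots> \<in> Q_plus C" by (intro Q_plus_add Q_plus_scale pos) simp_all
      finally have 1: "v (weight g - weight p) \<in> Q_plus C" .
      have "height (weight g - weight p) = real (x + y)" unfolding e by (simp add: height_add height_scale_nat)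
      then have "weight g \<noteq> weight p" using xy(1) by auto
      with 1 show ?thesis by simp
    qed
    ultimately show ?thesis by blast
  qed
qed

lemma sw_rev_comp: "sw (rev b) \<circ> sw b = id" "sw b \<circ> sw (rev b) = id"
  using sw_rev[of b] sw_rev[of "rev b"] by (auto simp: fun_eq_iff)

text \<open>The involutions make the reversed word an inverse; the innermost pair of equal letters
  cancels at each step.\<close>

lemma TW_rev_cancel: "v \<in> W \<Longrightarrow> f \<in> completion_carrier C v \<Longrightarrow> TW (rev b) v (TW b (v \<circ> sw (rev b)) f) = f"
proof (induction b)
  case (Cons i b)
  let ?v = "v \<circ> sw (rev b)"
  have vW: "?v \<in> W" using Cons.prems(1) by (rule W_comp_sw)
  have c: "TW b ?v f \<in> completion_carrier C ?v"
    by (rule TW_carrier[OF vW]) (use Cons.prems(2) in \<open>simp add: comp_assoc sw_rev_comp\<close>)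
  have e: "v \<circ> sw (rev (i # b)) = ?v \<circ> s i" by (simp add: sw_append comp_assoc)
  have "TW (rev (i # b)) v (TW (i # b) (v \<circ> sw (rev (i # b))) f)
    = TW (rev b) v (TW [i] ?v (TW (i # b) (?v \<circ> s i) f))"
    unfolding e by (simp only: rev.simps TW_append)
  also have "TW [i] ?v (TW (i # b) (?v \<circ> s i) f) = TW [i, i] ?v (TW b ?v f)"
    by (simp only: TW.simps comp_s_s)
  also have "\<dots> = TW b ?v f" by (rule TW_involution[OF vW c])
  also have "TW (rev b) v \<dots> = f" by (rule Cons.IH[OF Cons.prems])
  finally show ?case .
qed simp

text \<open>Write v as u followed by a word \<open>b\<close> in i and j, with u keeping both simple
  roots positive. Conjugating by \<open>b\<close> moves the relation to the completion at u, where
  it is known, and \<open>TW_rev_cancel\<close> removes the conjugation.\<close>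

lemma TW_dihedral:
  assumes v: "v \<in> W" and ij: "i \<noteq> j" and r: "set r \<subseteq> {i, j}" "sw r = id"
    and f: "f \<in> completion_carrier C v"
  shows "TW r v f = f"
proof -
  obtain u b where u: "u \<in> W" "set b \<subseteq> {i, j}" "v = u \<circ> sw b" "\<And>k. k \<in> {i, j} \<Longrightarrow> u (\<alpha> k) \<in> Q_plus C"
    by (rule parabolic_decomposition[OF v, of "{i, j}"]) (rule that)
  have uv: "v \<circ> sw (rev b) = u" unfolding u(3) by (simp add: comp_assoc sw_rev_comp)
  define h where "h = TW b u f"
  have h: "h \<in> completion_carrier C u" unfolding h_def by (rule TW_carrier[OF u(1)]) (use f u(3) in simp)
  have undo: "TW (rev b) v h = f" unfolding h_def using TW_rev_cancel[OF v f, of b] unfolding uv .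
  have Tf: "TW r v f \<in> completion_carrier C v"
    by (rule TW_carrier[OF v]) (use f r(2) in simp)
  have "TW (b @ r @ rev b) u h = h"
    by (rule TW_dihedral_positive[OF u(1) _ _ ij _ _ h])
      (use u r in \<open>auto simp: sw_append sw_rev_comp\<close>)
  then have "TW b u (TW r v f) = h"
    unfolding TW_append u(3)[symmetric] using r(2) undo by simp
  then have "TW (rev b) v (TW b u (TW r v f)) = f" using undo by simp
  then show ?thesis using TW_rev_cancel[OF v Tf, of b] unfolding uv by simp
qed

lemma TW_cong:
  assumes eq: "sw is = sw js" and v: "v \<in> W" and f: "f \<in> completion_carrier C (v \<circ> sw is)"
  shows "TW is v f = TW js v f"
proof -
  \<comment> \<open>Equality is demanded on the completions only, but for every target v at once;
    this makes the relation stable under adding letters on either side.\<close>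
  define R where "R = (\<lambda>a b. sw a = sw b \<and>
     (\<forall>v\<in>W. \<forall>f\<in>completion_carrier C (v \<circ> sw a). TW a v f = TW b v f))"
  have "R is js"
  proof (rule word_congruence[of R, OF _ _ _ _ _ _ eq])
    show "R a a" for a by (simp add: R_def)
    show "R b a" if "R a b" for a b using that by (simp add: R_def)
    show "R a c" if "R a b" "R b c" for a b c using that by (simp add: R_def)
    show "R (x @ a @ y) (x @ b @ y)" if R: "R a b" for a b x y
    proof -
      have e: "sw a = sw b" using R by (simp add: R_def)
      have "TW (x @ a @ y) v f = TW (x @ b @ y) v f"
        if v: "v \<in> W" and f: "f \<in> completion_carrier C (v \<circ> sw (x @ a @ y))" for v f
      proof -
        let ?v = "v \<circ> sw x"
        have "TW y (?v \<circ> sw a) f \<in> completion_carrier C (?v \<circ> sw a)"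
          by (rule TW_carrier) (use v f in \<open>simp_all add: sw_append comp_assoc W_comp\<close>)
        moreover have "?v \<in> W" using v by (rule W_comp_sw)
        ultimately have "TW a ?v (TW y (?v \<circ> sw a) f) = TW b ?v (TW y (?v \<circ> sw a) f)"
          using R unfolding R_def by blast
        then show ?thesis by (simp only: TW_append e)
      qed
      then show ?thesis using e by (simp add: R_def sw_append)
    qed
    show "R [i, i] []" for i
      unfolding R_def
    proof (intro conjI ballI)
      show e: "sw [i, i] = sw []" by (simp add: sw_Cons)
      fix v f assume "v \<in> W" "f \<in> completion_carrier C (v \<circ> sw [i, i])"
      then show "TW [i, i] v f = TW [] v f" using TW_involution[of v f i] by (simp only: e sw_Nil comp_id TW.simps(1))
    qed
    show "R a b" if ab: "i \<noteq> j" "set a \<subseteq> {i, j}" "set b \<subseteq> {i, j}" "sw a = sw b" for i j a b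
      unfolding R_def
    proof (intro conjI ballI)
      fix v f assume v: "v \<in> W" and f: "f \<in> completion_carrier C (v \<circ> sw a)"
      \<comment> \<open>Compare \<open>a\<close> and \<open>b\<close> through
        \<open>a @ rev b\<close>, a word in the two letters with trivial product.\<close>
      define g where "g = TW b v f"
      have g: "g \<in> completion_carrier C v" unfolding g_def by (rule TW_carrier[OF v]) (use f ab(4) in simp)
      have e: "v \<circ> sw b \<circ> sw (rev b) = v" by (simp add: comp_assoc sw_rev_comp)
      have "TW (rev b) (v \<circ> sw a) g = f"
        using TW_rev_cancel[of "v \<circ> sw b" f b] v f unfolding g_def ab(4) e by simp
      moreover have "TW (a @ rev b) v g = g"
        by (rule TW_dihedral[OF v ab(1) _ _ g]) (use ab in \<open>auto simp: sw_append sw_rev_comp\<close>)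
      ultimately show "TW a v f = TW b v f" unfolding TW_append g_def by simp
    qed (rule ab(4))
  qed
  then show ?thesis using v f unfolding R_def by blast
qed

section \<open>The ring Pi and the action of the Weyl group on it\<close>

lemma Pi_ring_sel:
  "carrier (Pi_ring C) = (\<Pi>\<^sub>E w\<in>W. completion_carrier C w)"
  "f \<otimes>\<^bsub>Pi_ring C\<^esub> g = (\<lambda>w\<in>W. conv (f w) (g w))"
  "\<one>\<^bsub>Pi_ring C\<^esub> = (\<lambda>w\<in>W. mono_series 0)"
  "\<zero>\<^bsub>Pi_ring C\<^esub> = (\<lambda>w\<in>W. (\<lambda>_. 0))"
  "f \<oplus>\<^bsub>Pi_ring C\<^esub> g = (\<lambda>w\<in>W. (\<lambda>n. f w n + g w n))"
  by (simp_all add: Pi_ring_def completion_sel completion_mult)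

lemma ring_Pi_ring: "ring (Pi_ring C)"
proof (rule ringI)
  note c = completion_add completion_zero completion_uminus completion_conv completion_mono[OF _ monomials_0]
  have m: "f w \<in> completion_carrier C w" if "f \<in> carrier (Pi_ring C)" "w \<in> W" for f w
    using that by (auto simp: Pi_ring_sel)
  note nov = completion_nov[OF _ m]
  have ext: "f = g" if "f \<in> carrier (Pi_ring C)" "g \<in> carrier (Pi_ring C)" "\<And>w. w \<in> W \<Longrightarrow> f w = g w" for f g
    using that unfolding Pi_ring_sel by (rule PiE_ext)
  have add: "f \<oplus>\<^bsub>Pi_ring C\<^esub> g \<in> carrier (Pi_ring C)" if "f \<in> carrier (Pi_ring C)" "g \<in> carrier (Pi_ring C)" for f g
    using m[OF that(1)] m[OF that(2)] c by (simp add: Pi_ring_sel)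
  have mult: "f \<otimes>\<^bsub>Pi_ring C\<^esub> g \<in> carrier (Pi_ring C)" if "f \<in> carrier (Pi_ring C)" "g \<in> carrier (Pi_ring C)" for f g
    using m[OF that(1)] m[OF that(2)] c by (simp add: Pi_ring_sel)
  have zero: "\<zero>\<^bsub>Pi_ring C\<^esub> \<in> carrier (Pi_ring C)" and one: "\<one>\<^bsub>Pi_ring C\<^esub> \<in> carrier (Pi_ring C)"
    using c by (simp_all add: Pi_ring_sel)
  show "abelian_group (Pi_ring C)"
  proof (rule abelian_groupI)
    fix f assume f: "f \<in> carrier (Pi_ring C)"
    show "\<exists>g\<in>carrier (Pi_ring C). g \<oplus>\<^bsub>Pi_ring C\<^esub> f = \<zero>\<^bsub>Pi_ring C\<^esub>"
      using m[OF f] c by (intro bexI[of _ "\<lambda>w\<in>W. (\<lambda>n. - f w n)"]) (simp_all add: Pi_ring_sel fun_eq_iff)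
    show "\<zero>\<^bsub>Pi_ring C\<^esub> \<oplus>\<^bsub>Pi_ring C\<^esub> f = f"
      by (rule ext, rule add[OF zero f], rule f) (simp add: Pi_ring_sel(4,5))
  qed (use add zero in \<open>simp_all add: Pi_ring_sel(5) fun_eq_iff\<close>)
  show "monoid (Pi_ring C)"
  proof (rule monoidI)
    fix f g h assume f: "f \<in> carrier (Pi_ring C)" and g: "g \<in> carrier (Pi_ring C)" and h: "h \<in> carrier (Pi_ring C)"
    show "(f \<otimes>\<^bsub>Pi_ring C\<^esub> g) \<otimes>\<^bsub>Pi_ring C\<^esub> h = f \<otimes>\<^bsub>Pi_ring C\<^esub> (g \<otimes>\<^bsub>Pi_ring C\<^esub> h)"
      by (rule ext, rule mult[OF mult[OF f g] h], rule mult[OF f mult[OF g h]])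
        (simp add: Pi_ring_sel(2) degree.conv_assoc[OF degree_deg nov[OF _ f] nov[OF _ g] nov[OF _ h]])
  next
    fix f assume f: "f \<in> carrier (Pi_ring C)"
    have l: "conv (mono_series 0) x = x" for x :: "'i series" by (simp add: fun_eq_iff conv_mono_series)
    show "\<one>\<^bsub>Pi_ring C\<^esub> \<otimes>\<^bsub>Pi_ring C\<^esub> f = f" "f \<otimes>\<^bsub>Pi_ring C\<^esub> \<one>\<^bsub>Pi_ring C\<^esub> = f"
      by (rule ext, rule mult[OF one f], rule f, simp add: Pi_ring_sel(2,3) l,
        rule ext, rule mult[OF f one], rule f, simp add: Pi_ring_sel(2,3) l conv_comm[of _ "mono_series 0"])
  qed (use mult one in auto)
  fix f g h assume f: "f \<in> carrier (Pi_ring C)" and g: "g \<in> carrier (Pi_ring C)" and h: "h \<in> carrier (Pi_ring C)"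
  show "(f \<oplus>\<^bsub>Pi_ring C\<^esub> g) \<otimes>\<^bsub>Pi_ring C\<^esub> h = f \<otimes>\<^bsub>Pi_ring C\<^esub> h \<oplus>\<^bsub>Pi_ring C\<^esub> g \<otimes>\<^bsub>Pi_ring C\<^esub> h"
    by (rule ext, rule mult[OF add[OF f g] h], rule add[OF mult[OF f h] mult[OF g h]])
      (simp add: Pi_ring_sel(2,5) degree.conv_add_left[OF degree_deg nov[OF _ f] nov[OF _ g] nov[OF _ h]])
  show "h \<otimes>\<^bsub>Pi_ring C\<^esub> (f \<oplus>\<^bsub>Pi_ring C\<^esub> g) = h \<otimes>\<^bsub>Pi_ring C\<^esub> f \<oplus>\<^bsub>Pi_ring C\<^esub> h \<otimes>\<^bsub>Pi_ring C\<^esub> g"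
    by (rule ext, rule mult[OF h add[OF f g]], rule add[OF mult[OF h f] mult[OF h g]])
      (simp add: Pi_ring_sel(2,5) degree.conv_add_right[OF degree_deg nov[OF _ h] nov[OF _ f] nov[OF _ g]])
qed

text \<open>An arbitrary word for w; \<open>TW_cong\<close> makes the operator independent of the
  choice.\<close>

definition word :: "(int^'i \<Rightarrow> int^'i) \<Rightarrow> 'i list" where "word w = (SOME is. sw is = w)"

lemma sw_word: "w \<in> W \<Longrightarrow> sw (word w) = w"
  unfolding word_def weyl_group_carrier by (rule someI_ex) auto

definition act :: "(int^'i \<Rightarrow> int^'i) \<Rightarrow> ((int^'i \<Rightarrow> int^'i) \<Rightarrow> 'i series) \<Rightarrow> (int^'i \<Rightarrow> int^'i) \<Rightarrow> 'i series" where
  "act w = (\<lambda>f\<in>carrier (Pi_ring C). \<lambda>v\<in>W. TW (word w) v (f (v \<circ> w)))"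

lemma Pi_component: "f \<in> carrier (Pi_ring C) \<Longrightarrow> w \<in> W \<Longrightarrow> f w \<in> completion_carrier C w"
  by (auto simp: Pi_ring_sel)

lemma act_component:
  assumes "w \<in> W" "f \<in> carrier (Pi_ring C)" "v \<in> W"
  shows "act w f v = TW (word w) v (f (v \<circ> w))"
    and "f (v \<circ> w) \<in> completion_carrier C (v \<circ> sw (word w))"
  using assms by (simp_all add: act_def sw_word Pi_component W_comp)

lemma act_carrier: "w \<in> W \<Longrightarrow> f \<in> carrier (Pi_ring C) \<Longrightarrow> act w f \<in> carrier (Pi_ring C)"
  using TW_carrier act_component(2) by (auto simp: act_def Pi_ring_sel(1))

lemma Pi_ext:
  "f \<in> carrier (Pi_ring C) \<Longrightarrow> g \<in> carrier (Pi_ring C) \<Longrightarrow> (\<And>v. v \<in> W \<Longrightarrow> f v = g v) \<Longrightarrow> f = g"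
  unfolding Pi_ring_sel by (rule PiE_ext)

lemma act_word:
  assumes "sw is = w" "f \<in> carrier (Pi_ring C)" "v \<in> W"
  shows "act w f v = TW is v (f (v \<circ> w))"
proof -
  have w: "w \<in> W" using assms(1) W_sw by blast
  show ?thesis unfolding act_component(1)[OF w assms(2,3)]
    by (rule TW_cong) (use assms w in \<open>simp_all add: sw_word Pi_component W_comp\<close>)
qed

text \<open>The v-component of \<open>act w\<close> reads component v w, and \<open>act w'\<close>
  then reads v w w'. Right multiplication on the index thus gives a left action.\<close>

lemma act_comp:
  assumes w: "w \<in> W" "w' \<in> W" and f: "f \<in> carrier (Pi_ring C)"
  shows "act (w \<circ> w') f = act w (act w' f)"
proof (rule Pi_ext)
  fix v assume v: "v \<in> W"
  have "sw (word w @ word w') = w \<circ> w'" by (simp add: sw_append sw_word w)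
  then have "act (w \<circ> w') f v = TW (word w @ word w') v (f (v \<circ> (w \<circ> w')))"
    by (rule act_word[OF _ f v])
  also have "\<dots> = act w (act w' f) v"
    by (simp add: TW_append sw_word w act_component(1) act_carrier f v W_comp comp_assoc)
  finally show "act (w \<circ> w') f v = act w (act w' f) v" .
qed (use assms in \<open>simp_all add: act_carrier W_comp\<close>)

lemma act_id: "f \<in> carrier (Pi_ring C) \<Longrightarrow> act id f = f"
  by (rule Pi_ext) (simp_all add: act_carrier act_word[of "[]"])

text \<open>The word chosen for \<open>s i\<close> may differ from \<open>[i]\<close>, and
  \<open>act_word\<close> exchanges the two. Outside the carrier both functions are restricted to
  the same default, so they agree as functions.\<close>

lemma act_simple_reflection: "act (s i) = Theta C d q i"
proof
  fix f
  show "act (s i) f = Theta C d q i f"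
  proof (cases "f \<in> carrier (Pi_ring C)")
    case True
    have "act (s i) f \<in> (\<Pi>\<^sub>E w\<in>W. completion_carrier C w)"
      using act_carrier[OF W_s[of i] True] by (simp only: Pi_ring_sel)
    then have "act (s i) f = (\<lambda>v\<in>W. act (s i) f v)" by (rule PiE_restrict[symmetric])
    also have "\<dots> = (\<lambda>v\<in>W. Th i (v \<circ> s i) (f (v \<circ> s i)))"
      using act_word[of "[i]" "s i" f] True by (intro restrict_ext) simp
    also have "\<dots> = Theta C d q i f" using True by (simp add: Theta_def)
    finally show ?thesis .
  qed (simp add: act_def Theta_def)
qed

lemma act_bij: assumes w: "w \<in> W" shows "bij_betw (act w) (carrier (Pi_ring C)) (carrier (Pi_ring C))"
proof -
  define w' where "w' = sw (rev (word w))"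
  have w': "w' \<in> W" by (simp add: w'_def)
  have "w \<circ> w' = id" "w' \<circ> w = id"
    using sw_rev_comp[of "word w"] by (simp_all add: w'_def sw_word w)
  then show ?thesis
    using act_comp[OF w w'] act_comp[OF w' w] act_id act_carrier[OF w] act_carrier[OF w']
    by (intro bij_betw_byWitness[of _ "act w'"]) (auto simp: image_subset_iff)
qed

lemma act_ring_iso: assumes w: "w \<in> W" shows "act w \<in> ring_iso (Pi_ring C) (Pi_ring C)"
  unfolding ring_iso_def
proof (intro CollectI conjI)
  interpret ring "Pi_ring C" by (rule ring_Pi_ring)
  note cmp = act_component(2)[OF w]
  show "act w \<in> ring_hom (Pi_ring C) (Pi_ring C)"
  proof (rule ring_hom_memI)
    show "act w f \<in> carrier (Pi_ring C)" if "f \<in> carrier (Pi_ring C)" for f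
      by (rule act_carrier[OF w that])
    fix f g assume f: "f \<in> carrier (Pi_ring C)" and g: "g \<in> carrier (Pi_ring C)"
    show "act w (f \<otimes>\<^bsub>Pi_ring C\<^esub> g) = act w f \<otimes>\<^bsub>Pi_ring C\<^esub> act w g"
    proof (rule Pi_ext)
      fix v assume v: "v \<in> W"
      have "(f \<otimes>\<^bsub>Pi_ring C\<^esub> g) (v \<circ> w) = conv (f (v \<circ> w)) (g (v \<circ> w))"
        using W_comp[OF v w] by (simp add: Pi_ring_sel(2))
      then show "act w (f \<otimes>\<^bsub>Pi_ring C\<^esub> g) v = (act w f \<otimes>\<^bsub>Pi_ring C\<^esub> act w g) v"
        using TW_conv[OF v cmp[OF f v] cmp[OF g v]] v
        by (simp add: act_component(1)[OF w _ v] f g m_closed) (simp add: Pi_ring_sel(2) act_component(1)[OF w _ v] f g)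
    qed (use f g act_carrier[OF w] in simp_all)
    show "act w (f \<oplus>\<^bsub>Pi_ring C\<^esub> g) = act w f \<oplus>\<^bsub>Pi_ring C\<^esub> act w g"
    proof (rule Pi_ext)
      fix v assume v: "v \<in> W"
      have "(f \<oplus>\<^bsub>Pi_ring C\<^esub> g) (v \<circ> w) = (\<lambda>n. f (v \<circ> w) n + g (v \<circ> w) n)"
        using W_comp[OF v w] by (simp add: Pi_ring_sel(5))
      then show "act w (f \<oplus>\<^bsub>Pi_ring C\<^esub> g) v = (act w f \<oplus>\<^bsub>Pi_ring C\<^esub> act w g) v"
        using TW_add[OF v cmp[OF f v] cmp[OF g v]] v
        by (simp add: act_component(1)[OF w _ v] f g a_closed) (simp add: Pi_ring_sel(5) act_component(1)[OF w _ v] f g)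
    qed (use f g act_carrier[OF w] in simp_all)
  next
    show "act w \<one>\<^bsub>Pi_ring C\<^esub> = \<one>\<^bsub>Pi_ring C\<^esub>"
    proof (rule Pi_ext)
      fix v assume v: "v \<in> W"
      show "act w \<one>\<^bsub>Pi_ring C\<^esub> v = \<one>\<^bsub>Pi_ring C\<^esub> v"
        unfolding act_component(1)[OF w one_closed v]
        using W_comp[OF v w] v by (simp add: Pi_ring_sel(3) TW_one)
    qed (use act_carrier[OF w] in simp_all)
  qed
  show "bij_betw (act w) (carrier (Pi_ring C)) (carrier (Pi_ring C))" by (rule act_bij[OF w])
qed

lemma act_group_action: "group_action (weyl_group C) (carrier (Pi_ring C)) act"
proof (intro group_action.intro group_hom.intro group_hom_axioms.intro)
  show "group (weyl_group C)" by (rule weyl_group_group)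
  show "group (BijGroup (carrier (Pi_ring C)))" by (rule group_BijGroup)
  have B: "act w \<in> Bij (carrier (Pi_ring C))" if "w \<in> W" for w
    using act_bij[OF that] by (simp add: Bij_def act_def)
  show "act \<in> hom (weyl_group C) (BijGroup (carrier (Pi_ring C)))"
  proof (rule homI)
    fix w assume "w \<in> W"
    then show "act w \<in> carrier (BijGroup (carrier (Pi_ring C)))" using B by (simp add: BijGroup_def)
  next
    fix w w' assume w: "w \<in> W" "w' \<in> W"
    have "act (w \<circ> w') = compose (carrier (Pi_ring C)) (act w) (act w')"
    proof
      fix f
      show "act (w \<circ> w') f = compose (carrier (Pi_ring C)) (act w) (act w') f"
        using act_comp[OF w, of f] by (cases "f \<in> carrier (Pi_ring C)") (simp_all add: compose_def act_def)
    qed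
    then show "act (w \<otimes>\<^bsub>weyl_group C\<^esub> w') = act w \<otimes>\<^bsub>BijGroup (carrier (Pi_ring C))\<^esub> act w'"
      using B w by (simp add: weyl_group_mult BijGroup_def)
  qed
qed

end

theorem theorem3p4:
  fixes C :: "int^'i^'i::finite" and d :: "'i \<Rightarrow> nat" and q :: complex
  assumes "simple_cartan_matrix C"
    and "symmetrizer C d"
    and "q \<noteq> 0" and "\<forall>k::nat. k > 0 \<longrightarrow> q ^ k \<noteq> 1"
  shows "ring (Pi_ring C) \<and>
    (\<exists>\<phi>. group_action (weyl_group C) (carrier (Pi_ring C)) \<phi> \<and>
         (\<forall>w\<in>carrier (weyl_group C). \<phi> w \<in> ring_iso (Pi_ring C) (Pi_ring C)) \<and>
         (\<forall>i. \<phi> (simple_reflection C i) = Theta C d q i))"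
proof -
  interpret weyl_action C d q by unfold_locales (use assms in auto)
  show ?thesis
    using ring_Pi_ring act_group_action act_ring_iso act_simple_reflection by blast
qed

end
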